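(* One has $\lim_{\ell\to\infty}\lambda_\ell^1=\min(\nu_\infty^+,\nu_\infty^-)$. Moreover, if $A_{12}\cdot\nabla W_1$ is not a.e. equal to $0$ on $\omega$, then $\lim_{\ell\to\infty}\lambda_\ell^1<\mu^1$; otherwise (i.e. if $A_{12}\cdot\nabla W_1=0$ a.e. on $\omega$), $\lambda_\ell^1=\mu^1$ for all $\ell>0$.
   Context: Let $n\ge 2$ and let $\omega\subset\mathbb{R}^{n-1}$ be a bounded domain. Points of $\mathbb{R}\times\omega$ are written $x=(x_1,X_2)$ with $X_2=(x_2,\dots,x_n)\in\omega$. Let $A(X_2)=\begin{pmatrix} a_{11}(X_2) & A_{12}(X_2)\\ A_{12}^t(X_2) & A_{22}(X_2)\end{pmatrix}$ be a symmetric $n\times n$ matrix with bounded measurable entries on $\omega$, where $a_{11}$ is scalar, $A_{12}$ is $1\times(n-1)$ and $A_{22}$ is $(n-1)\times(n-1)$. Assume that there are constants $C_A,\lambda_A>0$ with $\|A(X_2)\|\le C_A$ (Euclidean operator norm) and $A(X_2)\xi\cdot\xi\ge\lambda_A|\xi|^2$ for all $\xi\in\mathbb{R}^n$ and a.e. $X_2\in\omega$. $A_{12}\cdot\nabla W_1$ denotes the scalar function obtained by applying the row $A_{12}(X_2)$ to $\nabla W_1(X_2)$. $\mu^1=\inf\{\int_\omega (A_{22}\nabla u)\cdot\nabla u : u\in H_0^1(\omega),\ \int_\omega u^2=1\}$, and $W_1\in H_0^1(\omega)$ is the unique positive minimizer with $\int_\omega W_1^2=1$ (first Dirichlet eigenvalue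 and eigenfunction of $-\mathrm{div}(A_{22}\nabla\cdot)$ on $\omega$). For $\ell>0$: $\Omega_\ell=(-\ell,\ell)\times\omega$, $\gamma_\ell=(-\ell,\ell)\times\partial\omega$, $V(\Omega_\ell)=\{v\in H^1(\Omega_\ell): v=0\text{ on }\gamma_\ell\}$ (in the sense of traces), and $\lambda_\ell^1=\inf\{\int_{\Omega_\ell}A\nabla u\cdot\nabla u : u\in V(\Omega_\ell),\ \int_{\Omega_\ell}u^2=1\}$ (the first eigenvalue of $-\mathrm{div}(A\nabla\cdot)$ with Dirichlet condition on $\gamma_\ell$ and Neumann condition $(A\nabla u)\cdot\nu=0$ on the two ends $\{\pm\ell\}\times\omega$). $\Omega_\infty^+=(0,\infty)\times\omega$, $\Omega_\infty^-=(-\infty,0)\times\omega$, $\gamma_\infty^+=(0,\infty)\times\partial\omega$, $\gamma_\infty^-=(-\infty,0)\times\partial\omega$, $V(\Omega_\infty^\pm)=\{u\in H^1(\Omega_\infty^\pm): u=0\text{ on }\gamma_\infty^\pm\}$, and $\nu_\infty^\pm=\inf_{0\ne u\in V(\Omega_\infty^\pm)}\frac{\int_{\Omega_\infty^\pm}A\nabla u\cdot\nabla u}{\int_{\Omega_\infty^\pm}u^2}$. *)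

theory Defs
  imports "HOL-Analysis.Analysis"
begin

definition partial_deriv :: "'a::euclidean_space \<Rightarrow> ('a \<Rightarrow> real) \<Rightarrow> 'a \<Rightarrow> real" where
  "partial_deriv b f x = frechet_derivative f (at x) b"

primrec C_k :: "nat \<Rightarrow> ('a::euclidean_space \<Rightarrow> real) \<Rightarrow> bool" where
  "C_k 0 f \<longleftrightarrow> continuous_on UNIV f"
| "C_k (Suc k) f \<longleftrightarrow> (\<forall>x. f differentiable (at x)) \<and> (\<forall>b\<in>Basis. C_k k (partial_deriv b f))"

definition test_functions :: "'a::euclidean_space set \<Rightarrow> ('a \<Rightarrow> real) set" where
  "test_functions \<Omega> =
     {\<phi>. (\<forall>k. C_k k \<phi>) \<and> compact (closure {x. \<phi> x \<noteq> 0}) \<and> closure {x. \<phi> x \<noteq> 0} \<subseteq> \<Omega>}"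

text \<open>
  Elements of the function spaces are represented by functions on the whole type, of which only
  the restriction to the open set \<open>\<Omega>\<close>, up to null sets, is relevant.
\<close>

definition L2 :: "'a::euclidean_space set \<Rightarrow> ('a \<Rightarrow> 'b::euclidean_space) set" where
  "L2 \<Omega> = {f. f \<in> borel_measurable (lebesgue_on \<Omega>) \<and> integrable (lebesgue_on \<Omega>) (\<lambda>x. (norm (f x))\<^sup>2)}"

definition locally_integrable :: "'a::euclidean_space set \<Rightarrow> ('a \<Rightarrow> 'b::euclidean_space) \<Rightarrow> bool" where
  "locally_integrable \<Omega> f \<longleftrightarrow> (\<forall>K. compact K \<and> K \<subseteq> \<Omega> \<longrightarrow> integrable (lebesgue_on K) f)"

definition has_weak_gradient :: "'a::euclidean_space set \<Rightarrow> ('a \<Rightarrow> real) \<Rightarrow> ('a \<Rightarrow> 'a) \<Rightarrow> bool" where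
  "has_weak_gradient \<Omega> u g \<longleftrightarrow>
     locally_integrable \<Omega> u \<and> locally_integrable \<Omega> g \<and>
     (\<forall>\<phi>\<in>test_functions \<Omega>. \<forall>b\<in>Basis.
        (LINT x|lebesgue_on \<Omega>. u x * partial_deriv b \<phi> x) = - (LINT x|lebesgue_on \<Omega>. (g x \<bullet> b) * \<phi> x))"

text \<open>
  The weak gradient is unique up to null sets, so the choice below does not affect
  integrals or almost-everywhere statements.
\<close>

definition weak_gradient :: "'a::euclidean_space set \<Rightarrow> ('a \<Rightarrow> real) \<Rightarrow> 'a \<Rightarrow> 'a" where
  "weak_gradient \<Omega> u = (SOME g. has_weak_gradient \<Omega> u g)"

definition H1 :: "'a::euclidean_space set \<Rightarrow> ('a \<Rightarrow> real) set" where
  "H1 \<Omega> = {u \<in> L2 \<Omega>. \<exists>g \<in> L2 \<Omega>. has_weak_gradient \<Omega> u g}"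

definition H1_norm :: "'a::euclidean_space set \<Rightarrow> ('a \<Rightarrow> real) \<Rightarrow> real" where
  "H1_norm \<Omega> u =
     sqrt ((LINT x|lebesgue_on \<Omega>. (u x)\<^sup>2) + (LINT x|lebesgue_on \<Omega>. (norm (weak_gradient \<Omega> u x))\<^sup>2))"

definition H1_closure :: "'a::euclidean_space set \<Rightarrow> ('a \<Rightarrow> real) set \<Rightarrow> ('a \<Rightarrow> real) set" where
  "H1_closure \<Omega> S =
     {u \<in> H1 \<Omega>. \<exists>\<phi>. (\<forall>k::nat. \<phi> k \<in> S) \<and> (\<lambda>k. H1_norm \<Omega> (\<lambda>x. u x - \<phi> k x)) \<longlonglongrightarrow> 0}"

definition H10 :: "'a::euclidean_space set \<Rightarrow> ('a \<Rightarrow> real) set" where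
  "H10 \<Omega> = H1_closure \<Omega> (test_functions \<Omega>)"

text \<open>
  For an open interval \<open>I\<close>, the functions in \<open>H1 (I \<times> \<omega>)\<close> with zero trace on the lateral boundary
  \<open>I \<times> \<partial>\<omega>\<close>. No regularity of \<open>\<omega>\<close> is assumed, so a trace operator need not exist; as for \<open>H10\<close>, the
  condition is expressed as a closure, here of functions that vanish near the lateral boundary
  but are unconstrained at the ends \<open>\<partial>I \<times> \<omega>\<close> (only their restrictions to \<open>I \<times> \<omega>\<close> matter).
\<close>

definition V :: "real set \<Rightarrow> 'a::euclidean_space set \<Rightarrow> (real \<times> 'a \<Rightarrow> real) set" where
  "V I \<omega> = H1_closure (I \<times> \<omega>) (test_functions (UNIV \<times> \<omega>))"

definition energy :: "'a::euclidean_space set \<Rightarrow> ('a \<Rightarrow> 'a \<Rightarrow> 'a) \<Rightarrow> ('a \<Rightarrow> real) \<Rightarrow> real" where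
  "energy \<Omega> A u = (LINT x|lebesgue_on \<Omega>. A x (weak_gradient \<Omega> u x) \<bullet> weak_gradient \<Omega> u x)"

definition block_op :: "real \<Rightarrow> real^'n \<Rightarrow> real^'n^'n \<Rightarrow> real \<times> (real^'n) \<Rightarrow> real \<times> (real^'n)" where
  "block_op a b M \<xi> = (a * fst \<xi> + b \<bullet> snd \<xi>, fst \<xi> *\<^sub>R b + M *v snd \<xi>)"

definition coeff_op ::
  "(real^'n \<Rightarrow> real) \<Rightarrow> (real^'n \<Rightarrow> real^'n) \<Rightarrow> (real^'n \<Rightarrow> real^'n^'n)
    \<Rightarrow> real \<times> (real^'n) \<Rightarrow> real \<times> (real^'n) \<Rightarrow> real \<times> (real^'n)" where
  "coeff_op a11 A12 A22 x = block_op (a11 (snd x)) (A12 (snd x)) (A22 (snd x))"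

definition mu1 :: "(real^'n) set \<Rightarrow> (real^'n \<Rightarrow> real^'n^'n) \<Rightarrow> real" where
  "mu1 \<omega> A22 =
     Inf {energy \<omega> (\<lambda>X. (*v) (A22 X)) u | u. u \<in> H10 \<omega> \<and> (LINT X|lebesgue_on \<omega>. (u X)\<^sup>2) = 1}"

definition first_eigenfunction :: "(real^'n) set \<Rightarrow> (real^'n \<Rightarrow> real^'n^'n) \<Rightarrow> (real^'n \<Rightarrow> real) \<Rightarrow> bool" where
  "first_eigenfunction \<omega> A22 W \<longleftrightarrow>
     W \<in> H10 \<omega> \<and> (LINT X|lebesgue_on \<omega>. (W X)\<^sup>2) = 1 \<and>
     energy \<omega> (\<lambda>X. (*v) (A22 X)) W = mu1 \<omega> A22 \<and> (AE X in lebesgue_on \<omega>. W X > 0)"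

definition lambda1 ::
  "(real^'n) set \<Rightarrow> (real^'n \<Rightarrow> real) \<Rightarrow> (real^'n \<Rightarrow> real^'n) \<Rightarrow> (real^'n \<Rightarrow> real^'n^'n) \<Rightarrow> real \<Rightarrow> real" where
  "lambda1 \<omega> a11 A12 A22 l =
     Inf {energy ({-l<..<l} \<times> \<omega>) (coeff_op a11 A12 A22) u | u.
            u \<in> V {-l<..<l} \<omega> \<and> (LINT x|lebesgue_on ({-l<..<l} \<times> \<omega>). (u x)\<^sup>2) = 1}"

definition nu ::
  "real set \<Rightarrow> (real^'n) set \<Rightarrow> (real^'n \<Rightarrow> real) \<Rightarrow> (real^'n \<Rightarrow> real^'n) \<Rightarrow> (real^'n \<Rightarrow> real^'n^'n) \<Rightarrow> real" where
  "nu I \<omega> a11 A12 A22 =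
     Inf {energy (I \<times> \<omega>) (coeff_op a11 A12 A22) u / (LINT x|lebesgue_on (I \<times> \<omega>). (u x)\<^sup>2) | u.
            u \<in> V I \<omega> \<and> \<not> (AE x in lebesgue_on (I \<times> \<omega>). u x = 0)}"

abbreviation nu_plus ::
  "(real^'n) set \<Rightarrow> (real^'n \<Rightarrow> real) \<Rightarrow> (real^'n \<Rightarrow> real^'n) \<Rightarrow> (real^'n \<Rightarrow> real^'n^'n) \<Rightarrow> real" where
  "nu_plus \<equiv> nu {0<..}"

abbreviation nu_minus ::
  "(real^'n) set \<Rightarrow> (real^'n \<Rightarrow> real) \<Rightarrow> (real^'n \<Rightarrow> real^'n) \<Rightarrow> (real^'n \<Rightarrow> real^'n^'n) \<Rightarrow> real" where
  "nu_minus \<equiv> nu {..<0}"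

end

(* Everything is reduced to test functions: the infima defining lambda, nu and mu are the best constants c in
   c * int phi^2 <= int A grad phi . grad phi over test functions, and there weak gradients are classical.

   Limit.  A test function for the half-cylinder has compact support, so after a translation it is an exact competitor
   on every long cylinder; this bounds lambda from above.  For the lower bound, cut off at both ends with
   cos(theta(x1/l)) and sin(theta(x1/l)): since cos^2 + sin^2 = 1, the energies add up to the original one up to
   O(l^-2) int phi^2, and each piece extends by zero to a half-cylinder.

   Strict inequality.  If nu+ and nu- were both at least mu, insert chi(x1/R) W(X2) + delta rho(x1) z(X2) with
   chi = 1 on the support of rho.  The boundary terms at x1 = 0 on the two half-cylinders have opposite signs, so letting
   R tend to infinity and adding the inequality for delta on one side to that for -delta on the other leaves
   0 <= -4 delta int (A12 . grad W) z + O(delta^2); hence A12 . grad W is orthogonal to all z.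

   Equality.  If A12 . grad W = 0, the function W is a positive solution on the cylinder, and Picone's inequality
   (testing the equation of W on every slice with phi^2/W, regularised) gives lambda >= mu without any existence or
   simplicity theory for the eigenvalue problem on the cylinder. *)

theory Submission
  imports Defs
begin

section \<open>Smooth functions and test functions\<close>

text \<open>Three obstacles shape the argument. \<open>W\<close> is only an element of
  \<open>H10\<close>, neither smooth nor known to be bounded, so chi W and phi^2/W are not directly
  admissible. Every inequality is first written for smooth approximants \<open>p k\<close> of
  \<open>W\<close>; the limit in k is taken in the finished formula, where only bilinear expressions
  and bounded continuous functions of \<open>p k\<close> occur. Since \<open>p k\<close> may change
  sign, the regularised reciprocal has to be smooth and bounded on the whole line. The coefficients
  are given up to null sets. They are replaced by Borel versions that are bounded and elliptic at
  every point, so that translations and Fubini apply without exceptional sets. The order of limits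
  matters on the half-cylinders: k tends to infinity first, with the width R of the plateau fixed,
  because the zero-order term carries a factor growing with R, and only the exact eigenvalue
  identity for the limit \<open>W\<close> removes it.\<close>

definition grad :: "('a::euclidean_space \<Rightarrow> real) \<Rightarrow> 'a \<Rightarrow> 'a" where
  "grad f x = (\<Sum>b\<in>Basis. partial_deriv b f x *\<^sub>R b)"

lemma grad_inner_Basis: "b \<in> Basis \<Longrightarrow> grad f x \<bullet> b = partial_deriv b f x"
  by (simp add: grad_def inner_sum_left inner_Basis if_distrib cong: if_cong)

lemma partial_deriv_eqI: "(f has_derivative D) (at x) \<Longrightarrow> partial_deriv b f x = D b"
  by (simp add: partial_deriv_def frechet_derivative_at[symmetric])

lemma has_derivative_grad:
  assumes "f differentiable (at x)"
  shows "(f has_derivative (\<lambda>h. grad f x \<bullet> h)) (at x)"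
proof -
  obtain D where D: "(f has_derivative D) (at x)" using assms by (auto simp: differentiable_def)
  then interpret bounded_linear D by (rule has_derivative_bounded_linear)
  have "D h = grad f x \<bullet> h" for h
  proof -
    have "D h = D (\<Sum>b\<in>Basis. (h \<bullet> b) *\<^sub>R b)" by (simp add: euclidean_representation)
    also have "\<dots> = grad f x \<bullet> h"
      by (simp add: sum scaleR grad_def inner_sum_left partial_deriv_eqI[OF D] inner_commute[of h] mult.commute)
    finally show ?thesis .
  qed
  then have "D = (\<lambda>h. grad f x \<bullet> h)" by auto
  then show ?thesis using D by simp
qed

lemma grad_eqI:
  assumes "(f has_derivative (\<lambda>h. g \<bullet> h)) (at x)"
  shows "grad f x = g"
  using partial_deriv_eqI[OF assms] by (simp add: grad_def euclidean_representation)

lemma C_k_continuous: "C_k k f \<Longrightarrow> continuous_on UNIV f"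
  by (cases k) (auto intro!: differentiable_imp_continuous_on simp: differentiable_on_def)

lemma C_k_Suc_D: "C_k (Suc k) f \<Longrightarrow> C_k k f"
proof (induction k arbitrary: f)
  case 0
  then show ?case using C_k_continuous[OF 0] by simp
next
  case (Suc k)
  then show ?case by (metis C_k.simps(2))
qed

lemma C_k_SucI:
  assumes "\<And>x. (f has_derivative D x) (at x)" "\<And>b. b \<in> Basis \<Longrightarrow> C_k k (\<lambda>x. D x b)"
  shows "C_k (Suc k) f"
proof -
  have "partial_deriv b f = (\<lambda>x. D x b)" for b using partial_deriv_eqI[OF assms(1)] by auto
  with assms show ?thesis by (auto simp: differentiable_def)
qed

lemma C_k_grad:
  assumes "C_k (Suc k) f" "b \<in> Basis"
  shows "C_k k (\<lambda>x. grad f x \<bullet> b)"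
  using assms by (simp add: grad_inner_Basis)

lemma C_k_has_derivative: "C_k (Suc k) f \<Longrightarrow> (f has_derivative (\<lambda>h. grad f x \<bullet> h)) (at x)"
  by (rule has_derivative_grad) simp

lemma C_k_const: "C_k k (\<lambda>x. c)"
proof (induction k arbitrary: c)
  case (Suc k)
  show ?case by (rule C_k_SucI[where D="\<lambda>x h. 0"]) (auto intro: Suc)
qed auto

lemma C_k_add: "C_k k f \<Longrightarrow> C_k k g \<Longrightarrow> C_k k (\<lambda>x. f x + g x)"
proof (induction k arbitrary: f g)
  case (Suc k)
  show ?case
    by (rule C_k_SucI[where D="\<lambda>x h. grad f x \<bullet> h + grad g x \<bullet> h"])
      (use Suc in \<open>auto intro!: has_derivative_add C_k_has_derivative Suc.IH C_k_grad simp del: C_k.simps\<close>)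
qed (auto intro: continuous_on_add)

lemma C_k_mult: "C_k k f \<Longrightarrow> C_k k g \<Longrightarrow> C_k k (\<lambda>x. f x * g x)"
proof (induction k arbitrary: f g)
  case (Suc k)
  have "C_k k f" "C_k k g" by (rule C_k_Suc_D, rule Suc.prems)+
  then show ?case
    by (intro C_k_SucI[where D="\<lambda>x h. f x * (grad g x \<bullet> h) + (grad f x \<bullet> h) * g x"])
      (use Suc in \<open>auto intro!: has_derivative_mult C_k_add C_k_has_derivative Suc.IH C_k_grad simp del: C_k.simps\<close>)
qed (auto intro: continuous_on_mult)

lemma C_k_sum: "(\<And>i. i \<in> I \<Longrightarrow> C_k k (f i)) \<Longrightarrow> C_k k (\<lambda>x. \<Sum>i\<in>I. f i x)"
  by (induction I rule: infinite_finite_induct) (auto intro: C_k_const C_k_add)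

lemma C_k_prod: "(\<And>i. i \<in> I \<Longrightarrow> C_k k (f i)) \<Longrightarrow> C_k k (\<lambda>x. \<Prod>i\<in>I. f i x)"
  by (induction I rule: infinite_finite_induct) (auto intro: C_k_const C_k_mult)

lemma C_k_affine:
  fixes L :: "'a::euclidean_space \<Rightarrow> 'b::euclidean_space"
  assumes L: "bounded_linear L"
  shows "C_k k f \<Longrightarrow> C_k k (\<lambda>x. f (c + L x))"
proof (induction k arbitrary: f)
  case 0
  then have "continuous_on (range (\<lambda>x. c + L x)) f" by (auto intro: continuous_on_subset)
  moreover have "continuous_on UNIV (\<lambda>x. c + L x)"
    by (intro continuous_intros linear_continuous_on L)
  ultimately show ?case using continuous_on_compose[of UNIV "\<lambda>x. c + L x" f] by (simp add: o_def)
next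
  case (Suc k)
  have 1: "((\<lambda>x. c + L x) has_derivative L) (at x)" for x
    using has_derivative_add[OF has_derivative_const bounded_linear_imp_has_derivative[OF L]] by simp
  have 2: "C_k k (\<lambda>x. grad f (c + L x) \<bullet> L b)" for b
  proof -
    have "(\<lambda>x. grad f (c + L x) \<bullet> L b) = (\<lambda>x. \<Sum>b'\<in>Basis. partial_deriv b' f (c + L x) * (b' \<bullet> L b))"
      by (simp add: grad_def inner_sum_left)
    then show ?thesis using Suc.prems
      by (auto intro!: C_k_sum C_k_mult C_k_const Suc.IH)
  qed
  show ?case
    by (rule C_k_SucI[where D="\<lambda>x h. grad f (c + L x) \<bullet> L h"])
      (use has_derivative_compose[OF 1 C_k_has_derivative[OF Suc.prems]] 2 in auto)
qed

lemma C_k_compose: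
  fixes g :: "real \<Rightarrow> real"
  shows "C_k k g \<Longrightarrow> C_k k f \<Longrightarrow> C_k k (\<lambda>x. g (f x))"
proof (induction k arbitrary: g f)
  case 0
  then show ?case using continuous_on_compose[of UNIV f g] continuous_on_subset by (fastforce simp: o_def)
next
  case (Suc k)
  have g: "C_k k (grad g)" using C_k_grad[OF Suc.prems(1), of 1] by simp
  show ?case
  proof (rule C_k_SucI[where D="\<lambda>x h. grad g (f x) * (grad f x \<bullet> h)"])
    show "((\<lambda>x. g (f x)) has_derivative (\<lambda>h. grad g (f x) * (grad f x \<bullet> h))) (at x)" for x
      using has_derivative_compose[OF C_k_has_derivative[OF Suc.prems(2)] C_k_has_derivative[OF Suc.prems(1)]]
      by simp
    show "C_k k (\<lambda>x. grad g (f x) * (grad f x \<bullet> b))" if "b \<in> Basis" for b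
      by (rule C_k_mult[OF Suc.IH[OF g C_k_Suc_D[OF Suc.prems(2)]] C_k_grad[OF Suc.prems(2) that]])
  qed
qed

lemma C_k_inverse:
  assumes "\<And>x. f x \<noteq> 0"
  shows "C_k k f \<Longrightarrow> C_k k (\<lambda>x. inverse (f x))"
proof (induction k)
  case 0
  then show ?case using assms by (auto intro: continuous_on_inverse)
next
  case (Suc k)
  have "C_k k (\<lambda>x. inverse (f x))" by (rule Suc.IH[OF C_k_Suc_D[OF Suc.prems]])
  then have "C_k k (\<lambda>x. (-1) * (inverse (f x) * (grad f x \<bullet> b) * inverse (f x)))" if "b \<in> Basis" for b
    using that by (intro C_k_mult C_k_const C_k_grad Suc.prems)
  then have 1: "C_k k (\<lambda>x. - (inverse (f x) * (grad f x \<bullet> b) * inverse (f x)))" if "b \<in> Basis" for b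
    using that by simp
  have 2: "((\<lambda>x. inverse (f x)) has_derivative (\<lambda>h. - (inverse (f x) * (grad f x \<bullet> h) * inverse (f x)))) (at x)" for x
    by (rule Deriv.has_derivative_inverse[OF assms C_k_has_derivative[OF Suc.prems]])
  show ?case by (rule C_k_SucI[OF 2 1])
qed

lemma C_k_realI:
  assumes "\<And>x. (f has_real_derivative f' x) (at x)" "C_k k f'"
  shows "C_k (Suc k) f"
  by (rule C_k_SucI[where D="\<lambda>x h. f' x * h"]) (use assms in \<open>auto simp: has_field_derivative_def\<close>)

lemma grad_real: "(f has_real_derivative d) (at x) \<Longrightarrow> grad f x = d"
  by (rule grad_eqI) (simp add: has_field_derivative_def)

lemma C_k_id: "C_k k (\<lambda>x::real. x)"
  by (cases k) (auto intro!: C_k_realI[where f'="\<lambda>x. 1"] C_k_const simp del: C_k.simps(2))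

definition smooth :: "('a::euclidean_space \<Rightarrow> real) \<Rightarrow> bool" where
  "smooth f \<longleftrightarrow> (\<forall>k. C_k k f)"

lemma smooth_const: "smooth (\<lambda>x. c)" by (simp add: smooth_def C_k_const)
lemma smooth_add: "smooth f \<Longrightarrow> smooth g \<Longrightarrow> smooth (\<lambda>x. f x + g x)" by (simp add: smooth_def C_k_add)
lemma smooth_mult: "smooth f \<Longrightarrow> smooth g \<Longrightarrow> smooth (\<lambda>x. f x * g x)" by (simp add: smooth_def C_k_mult)
lemma smooth_prod: "(\<And>i. i \<in> I \<Longrightarrow> smooth (f i)) \<Longrightarrow> smooth (\<lambda>x. \<Prod>i\<in>I. f i x)"
  by (simp add: smooth_def C_k_prod)
lemma smooth_affine: "smooth f \<Longrightarrow> bounded_linear L \<Longrightarrow> smooth (\<lambda>x. f (c + L x))"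
  by (simp add: smooth_def C_k_affine)
lemma smooth_linear: "smooth f \<Longrightarrow> bounded_linear L \<Longrightarrow> smooth (\<lambda>x. f (L x))"
  using smooth_affine[of f L 0] by simp
lemma smooth_compose: "smooth (g :: real \<Rightarrow> real) \<Longrightarrow> smooth f \<Longrightarrow> smooth (\<lambda>x. g (f x))"
  by (simp add: smooth_def C_k_compose)
lemma smooth_inverse: "smooth f \<Longrightarrow> (\<And>x. f x \<noteq> 0) \<Longrightarrow> smooth (\<lambda>x. inverse (f x))"
  by (simp add: smooth_def C_k_inverse)
lemma smooth_id: "smooth (\<lambda>x::real. x)" by (simp add: smooth_def C_k_id)

lemma smooth_has_derivative: "smooth f \<Longrightarrow> (f has_derivative (\<lambda>h. grad f x \<bullet> h)) (at x)"
  unfolding smooth_def using C_k_has_derivative[of 0 f] by blast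

lemma smooth_continuous: "smooth f \<Longrightarrow> continuous_on UNIV f"
  unfolding smooth_def using C_k_continuous by blast

lemma smooth_grad: "smooth f \<Longrightarrow> b \<in> Basis \<Longrightarrow> smooth (\<lambda>x. grad f x \<bullet> b)"
  unfolding smooth_def using C_k_grad by blast

lemma continuous_grad: "smooth f \<Longrightarrow> continuous_on UNIV (grad f)"
  by (subst continuous_on_componentwise) (auto intro: smooth_continuous smooth_grad)

lemma smooth_realI:
  assumes "\<And>x. (f has_real_derivative f' x) (at x)" "smooth f'"
  shows "smooth f"
  unfolding smooth_def
proof
  fix k show "C_k k f"
    using C_k_realI[OF assms(1)] C_k_Suc_D assms(2) unfolding smooth_def by blast
qed

lemma smooth_has_real_derivative: "smooth f \<Longrightarrow> (f has_real_derivative grad f x) (at x)"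
  using smooth_has_derivative[of f x] by (simp add: has_field_derivative_def inner_real_def)

lemma smooth_sin_cos: "smooth (sin :: real \<Rightarrow> real)" "smooth (cos :: real \<Rightarrow> real)"
proof -
  have "C_k k (sin :: real \<Rightarrow> real) \<and> C_k k (cos :: real \<Rightarrow> real)" for k
  proof (induction k)
    case 0 show ?case by (auto intro: continuous_intros)
  next
    case (Suc k)
    then have "C_k k (\<lambda>x::real. - 1 * sin x)" using C_k_mult[OF C_k_const] by blast
    then have "C_k (Suc k) (cos :: real \<Rightarrow> real)"
      by (intro C_k_realI[where f'="\<lambda>x. - sin x"]) (auto intro!: derivative_eq_intros)
    moreover have "C_k (Suc k) (sin :: real \<Rightarrow> real)"
      by (intro C_k_realI[where f'="cos"]) (use Suc in \<open>auto intro!: derivative_eq_intros\<close>)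
    ultimately show ?case by blast
  qed
  then show "smooth (sin :: real \<Rightarrow> real)" "smooth (cos :: real \<Rightarrow> real)" by (auto simp: smooth_def)
qed

section \<open>Smooth cut-offs built from exp (-1/t)\<close>

definition flat :: "real poly \<Rightarrow> real \<Rightarrow> real" where
  "flat p t = (if t \<le> 0 then 0 else poly p (inverse t) * exp (- inverse t))"

lemma poly_div_exp_tendsto: "((\<lambda>s. poly p s * exp (- s)) \<longlongrightarrow> 0) (at_top :: real filter)"
proof -
  have "((\<lambda>s. \<Sum>i\<le>degree p. coeff p i * (s ^ i / exp s)) \<longlongrightarrow> (\<Sum>i\<le>degree p. coeff p i * 0)) (at_top :: real filter)"
    by (intro tendsto_sum tendsto_mult tendsto_const tendsto_power_div_exp_0)
  moreover have "(\<lambda>s. \<Sum>i\<le>degree p. coeff p i * (s ^ i / exp s)) = (\<lambda>s. poly p s * exp (- s))"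
    by (simp add: poly_altdef sum_distrib_right exp_minus divide_inverse mult.assoc)
  ultimately show ?thesis by simp
qed

text \<open>With s = 1/t the chain rule reads d/dt = - s^2 d/ds, and d/ds (p(s) e^(-s)) = (p'(s) -
  p(s)) e^(-s); hence the polynomial s^2 (p - p'). Carrying an arbitrary polynomial makes the class
  closed under differentiation, so one induction gives smoothness of all its members.\<close>

lemma flat_deriv: "(flat p has_real_derivative flat ([:0,0,1:] * (p - pderiv p)) t) (at t)"
proof -
  consider "t < 0" | "t = 0" | "t > 0" by linarith
  then show ?thesis
  proof cases
    case 1
    have "((\<lambda>t. 0) has_real_derivative 0) (at t)" by simp
    then have "(flat p has_real_derivative 0) (at t)"
      by (rule has_field_derivative_transform_within_open[where S="{..<0}"]) (use 1 in \<open>auto simp: flat_def\<close>)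
    then show ?thesis using 1 by (simp add: flat_def)
  next
    case 3
    have i: "(inverse has_real_derivative - (inverse t ^ Suc (Suc 0))) (at t)"
      by (rule DERIV_inverse) (use 3 in simp)
    have "((\<lambda>t. poly p (inverse t) * exp (- inverse t)) has_real_derivative
      poly ([:0,0,1:] * (p - pderiv p)) (inverse t) * exp (- inverse t)) (at t)"
      by (rule DERIV_cong[OF DERIV_mult[OF DERIV_chain2[OF poly_DERIV i] DERIV_chain2[OF DERIV_exp DERIV_minus[OF i]]]])
        (simp add: algebra_simps)
    then have "(flat p has_real_derivative poly ([:0,0,1:] * (p - pderiv p)) (inverse t) * exp (- inverse t)) (at t)"
      by (rule has_field_derivative_transform_within_open[where S="{0<..}"]) (use 3 in \<open>auto simp: flat_def\<close>)
    then show ?thesis using 3 by (simp add: flat_def)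
  next
    case 2
    have "((\<lambda>h. flat p h / h) \<longlongrightarrow> 0) (at_left 0)"
      by (rule tendsto_eventually)
        (auto simp: eventually_at_left_field flat_def intro!: exI[of _ "-1"])
    \<comment> \<open>In the variable s = 1/h the difference quotient at 0 is s p(s) e^(-s); hence
      the extra factor \<open>[:0,1:]\<close>.\<close>
    moreover have "((\<lambda>h. flat p h / h) \<longlongrightarrow> 0) (at_right 0)"
      unfolding filterlim_at_right_to_top
    proof (rule Lim_transform_eventually[OF poly_div_exp_tendsto[of "[:0,1:] * p"]])
      show "\<forall>\<^sub>F x in at_top. poly ([:0, 1:] * p) x * exp (- x) = flat p (inverse x) / inverse x"
        using eventually_gt_at_top[of 0] by eventually_elim (simp add: flat_def field_simps)
    qed
    ultimately have "((\<lambda>h. flat p h / h) \<longlongrightarrow> 0) (at 0)"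
      by (simp add: filterlim_split_at)
    then show ?thesis using 2 by (simp add: has_field_derivative_iff flat_def)
  qed
qed

lemma smooth_flat: "smooth (flat p)"
proof -
  have "C_k k (flat p)" for k
  proof (induction k arbitrary: p)
    case 0
    show ?case by (simp add: continuous_at_imp_continuous_on DERIV_isCont[OF flat_deriv])
  next
    case (Suc k)
    show ?case by (rule C_k_realI[OF flat_deriv Suc])
  qed
  then show ?thesis by (simp add: smooth_def)
qed

definition ramp :: "real \<Rightarrow> real" where "ramp = flat 1"

lemma ramp: "smooth ramp" "t \<le> 0 \<Longrightarrow> ramp t = 0" "t > 0 \<Longrightarrow> ramp t = exp (- inverse t)"
  "0 \<le> ramp t" "ramp t \<le> 1" "t > 0 \<Longrightarrow> ramp t > 0"
  by (auto simp: ramp_def flat_def smooth_flat)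

definition step :: "real \<Rightarrow> real" where "step t = ramp t * inverse (ramp t + ramp (1 - t))"

lemma step_denom: "ramp t + ramp (1 - t) > 0"
  using ramp(4,6)[of t] ramp(4,6)[of "1 - t"] by (cases "t > 0") (auto intro: add_pos_nonneg add_nonneg_pos)

lemma step: "smooth step" "t \<le> 0 \<Longrightarrow> step t = 0" "t \<ge> 1 \<Longrightarrow> step t = 1" "0 \<le> step t"
proof -
  have 1: "smooth (\<lambda>t. ramp (1 + (- t)))"
    by (rule smooth_affine[OF ramp(1)]) (intro bounded_linear_minus bounded_linear_ident)
  have nz: "ramp t + ramp (1 + (- t)) \<noteq> 0" for t using step_denom[of t] by simp
  have "smooth (\<lambda>t. ramp t * inverse (ramp t + ramp (1 + (- t))))"
    by (rule smooth_mult[OF ramp(1) smooth_inverse[OF smooth_add[OF ramp(1) 1] nz]])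
  then show "smooth step" by (simp add: step_def[abs_def])
  show "t \<le> 0 \<Longrightarrow> step t = 0" "0 \<le> step t" using ramp by (auto simp: step_def intro!: mult_nonneg_nonneg add_nonneg_nonneg)
  show "t \<ge> 1 \<Longrightarrow> step t = 1" using ramp(2)[of "1-t"] ramp(6)[of t] by (auto simp: step_def)
qed

text \<open>Allowing any compact set off which the function vanishes, instead of the exact support,
  spares the computation of closures for sums, products, translates and slices.\<close>

lemma test_functions_iff:
  "\<phi> \<in> test_functions \<Omega> \<longleftrightarrow> smooth \<phi> \<and> (\<exists>K. compact K \<and> K \<subseteq> \<Omega> \<and> (\<forall>x. x \<notin> K \<longrightarrow> \<phi> x = 0))"
proof safe
  assume "\<phi> \<in> test_functions \<Omega>"
  then show "smooth \<phi>" "\<exists>K. compact K \<and> K \<subseteq> \<Omega> \<and> (\<forall>x. x \<notin> K \<longrightarrow> \<phi> x = 0)"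
    using closure_subset[of "{x. \<phi> x \<noteq> 0}"]
    by (auto simp: test_functions_def smooth_def intro!: exI[of _ "closure {x. \<phi> x \<noteq> 0}"])
next
  fix K assume s: "smooth \<phi>" and K: "compact K" "K \<subseteq> \<Omega>" "\<forall>x. x \<notin> K \<longrightarrow> \<phi> x = 0"
  have "closure {x. \<phi> x \<noteq> 0} \<subseteq> K"
    by (rule closure_minimal) (use K compact_imp_closed in auto)
  then show "\<phi> \<in> test_functions \<Omega>" using K s
    by (auto simp: test_functions_def smooth_def compact_closure intro: bounded_subset compact_imp_bounded)
qed

lemma test_functionsI:
  "smooth \<phi> \<Longrightarrow> compact K \<Longrightarrow> K \<subseteq> \<Omega> \<Longrightarrow> (\<And>x. x \<notin> K \<Longrightarrow> \<phi> x = 0) \<Longrightarrow> \<phi> \<in> test_functions \<Omega>"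
  by (auto simp: test_functions_iff)

lemma test_smooth: "\<phi> \<in> test_functions \<Omega> \<Longrightarrow> smooth \<phi>" by (simp add: test_functions_iff)

lemma grad_eq_0_off:
  assumes "closed K" "\<And>x. x \<notin> K \<Longrightarrow> \<phi> x = 0" "x \<notin> K"
  shows "grad \<phi> x = 0"
proof -
  have "(\<phi> has_derivative (\<lambda>h. 0)) (at x)"
    by (rule has_derivative_transform_within_open[of "\<lambda>_. 0" _ _ _ "- K"]) (use assms in auto)
  then show ?thesis by (intro grad_eqI) simp
qed

lemma test_support:
  assumes "\<phi> \<in> test_functions \<Omega>"
  shows "\<exists>K. compact K \<and> K \<subseteq> \<Omega> \<and> (\<forall>x. x \<notin> K \<longrightarrow> \<phi> x = 0 \<and> grad \<phi> x = 0)"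
  using assms grad_eq_0_off[of _ \<phi>] by (metis compact_imp_closed test_functions_iff)

lemma test_mono: "\<phi> \<in> test_functions \<Omega> \<Longrightarrow> \<Omega> \<subseteq> \<Omega>' \<Longrightarrow> \<phi> \<in> test_functions \<Omega>'"
  unfolding test_functions_iff by blast

lemma test_add: "\<phi> \<in> test_functions \<Omega> \<Longrightarrow> \<psi> \<in> test_functions \<Omega> \<Longrightarrow> (\<lambda>x. \<phi> x + \<psi> x) \<in> test_functions \<Omega>"
proof -
  assume a: "\<phi> \<in> test_functions \<Omega>" and b: "\<psi> \<in> test_functions \<Omega>"
  obtain K where K: "compact K" "K \<subseteq> \<Omega>" "\<forall>x. x \<notin> K \<longrightarrow> \<phi> x = 0 \<and> grad \<phi> x = 0"
    using test_support[OF a] by blast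
  obtain L where L: "compact L" "L \<subseteq> \<Omega>" "\<forall>x. x \<notin> L \<longrightarrow> \<psi> x = 0 \<and> grad \<psi> x = 0"
    using test_support[OF b] by blast
  show ?thesis
    by (rule test_functionsI[of _ "K \<union> L"]) (use K L a b in \<open>auto simp: smooth_add test_smooth\<close>)
qed

lemma test_mult: "\<phi> \<in> test_functions \<Omega> \<Longrightarrow> smooth \<psi> \<Longrightarrow> (\<lambda>x. \<psi> x * \<phi> x) \<in> test_functions \<Omega>"
  by (auto simp: test_functions_iff smooth_mult)

lemma test_scale: "\<phi> \<in> test_functions \<Omega> \<Longrightarrow> (\<lambda>x. c * \<phi> x) \<in> test_functions \<Omega>"
  by (rule test_mult[OF _ smooth_const])

lemma test_zero: "(\<lambda>x. 0) \<in> test_functions \<Omega>"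
  by (rule test_functionsI[of _ "{}"]) (auto intro: smooth_const)

lemma grad_add: "smooth f \<Longrightarrow> smooth g \<Longrightarrow> grad (\<lambda>x. f x + g x) x = grad f x + grad g x"
  by (rule grad_eqI) (auto intro!: derivative_eq_intros smooth_has_derivative simp: inner_add_left)

lemma grad_mult: "smooth f \<Longrightarrow> smooth g \<Longrightarrow> grad (\<lambda>x. f x * g x) x = f x *\<^sub>R grad g x + g x *\<^sub>R grad f x"
  by (rule grad_eqI) (auto intro!: derivative_eq_intros smooth_has_derivative simp: inner_add_left)

lemma grad_const[simp]: "grad (\<lambda>x. c) x = 0" by (rule grad_eqI) simp

lemma grad_scale: "smooth f \<Longrightarrow> grad (\<lambda>x. c * f x) x = c *\<^sub>R grad f x"
  by (simp add: grad_mult smooth_const)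

lemma grad_compose: "smooth (g::real\<Rightarrow>real) \<Longrightarrow> smooth f \<Longrightarrow> grad (\<lambda>x. g (f x)) x = grad g (f x) *\<^sub>R grad f x"
  by (rule grad_eqI)
    (use has_derivative_compose[OF smooth_has_derivative smooth_has_derivative, of f g] in auto)

lemma has_derivative_affine:
  assumes "smooth f" "bounded_linear L"
  shows "((\<lambda>x. f (c + L x)) has_derivative (\<lambda>h. grad f (c + L x) \<bullet> L h)) (at x)"
proof -
  have "((\<lambda>x. c + L x) has_derivative L) (at x)"
    using has_derivative_add[OF has_derivative_const bounded_linear_imp_has_derivative[OF assms(2)]] by simp
  from has_derivative_compose[OF this smooth_has_derivative[OF assms(1)]] show ?thesis .
qed

lemma grad_translate: "smooth f \<Longrightarrow> grad (\<lambda>x. f (c + x)) x = grad f (c + x)"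
  by (rule grad_eqI[OF has_derivative_affine[OF _ bounded_linear_ident]])

lemma grad_fst:
  fixes f :: "'a::euclidean_space \<Rightarrow> real" and x :: "'a \<times> 'b::euclidean_space"
  assumes "smooth f"
  shows "grad (\<lambda>x. f (fst x)) x = (grad f (fst x), 0)"
  by (rule grad_eqI) (use has_derivative_affine[OF assms bounded_linear_fst, of 0 x] in \<open>simp add: inner_prod_def\<close>)

lemma grad_snd:
  fixes f :: "'b::euclidean_space \<Rightarrow> real" and x :: "'a::euclidean_space \<times> 'b"
  assumes "smooth f"
  shows "grad (\<lambda>x. f (snd x)) x = (0, grad f (snd x))"
  by (rule grad_eqI) (use has_derivative_affine[OF assms bounded_linear_snd, of 0 x] in \<open>simp add: inner_prod_def\<close>)

lemma bounded_linear_Pair2: "bounded_linear (\<lambda>y. (0::'a::real_normed_vector, y::'b::real_normed_vector))"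
  by (intro bounded_linear_Pair bounded_linear_zero bounded_linear_ident)

lemma grad_Pair:
  fixes f :: "'a::euclidean_space \<times> 'b::euclidean_space \<Rightarrow> real"
  assumes "smooth f"
  shows "grad (\<lambda>y. f (t, y)) y = snd (grad f (t, y))"
  by (rule grad_eqI)
    (use has_derivative_affine[OF assms bounded_linear_Pair2, of "(t, 0)" y] in \<open>simp add: inner_prod_def\<close>)

lemma smooth_fst: "smooth f \<Longrightarrow> smooth (\<lambda>x. f (fst x))"
  by (rule smooth_linear[OF _ bounded_linear_fst])

lemma smooth_snd: "smooth f \<Longrightarrow> smooth (\<lambda>x. f (snd x))"
  by (rule smooth_linear[OF _ bounded_linear_snd])

lemma smooth_Pair: "smooth f \<Longrightarrow> smooth (\<lambda>y. f (t, y))"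
  using smooth_affine[OF _ bounded_linear_Pair2, of f "(t, 0)"] by simp

section \<open>The fundamental lemma and weak gradients of smooth functions\<close>

lemma open_in_lebesgue: "open \<Omega> \<Longrightarrow> \<Omega> \<in> sets lebesgue"
  by (simp add: borel_open)

lemma lebesgue_on_lborel:
  fixes f :: "'a::euclidean_space \<Rightarrow> 'b::euclidean_space"
  assumes "open \<Omega>" "f \<in> borel_measurable borel"
  shows "integral\<^sup>L (lebesgue_on \<Omega>) f = (LINT x|lborel. indicator \<Omega> x *\<^sub>R f x)"
    and "integrable (lebesgue_on \<Omega>) f \<longleftrightarrow> integrable lborel (\<lambda>x. indicator \<Omega> x *\<^sub>R f x)"
proof -
  have [measurable]: "\<Omega> \<in> sets borel" "f \<in> borel_measurable borel" using assms by auto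
  have "(\<lambda>x. indicator \<Omega> x *\<^sub>R f x) \<in> borel_measurable lborel" by measurable
  then show "integral\<^sup>L (lebesgue_on \<Omega>) f = (LINT x|lborel. indicator \<Omega> x *\<^sub>R f x)"
    "integrable (lebesgue_on \<Omega>) f \<longleftrightarrow> integrable lborel (\<lambda>x. indicator \<Omega> x *\<^sub>R f x)"
    using assms(1) by (simp_all add: integral_restrict_space integrable_restrict_space open_in_lebesgue
        integral_completion integrable_completion)
qed

lemma compact_support_bounded:
  fixes g :: "'a::euclidean_space \<Rightarrow> 'b::real_normed_vector"
  assumes "continuous_on UNIV g" "compact K" "\<And>x. x \<notin> K \<Longrightarrow> g x = 0"
  obtains C where "C \<ge> 0" "\<And>x. norm (g x) \<le> C"
proof -
  have "compact (g ` K)" by (rule compact_continuous_image[OF continuous_on_subset[OF assms(1)] assms(2)]) auto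
  then obtain B where "\<forall>x\<in>K. norm (g x) \<le> B"
    using compact_imp_bounded bounded_iff by (metis imageI)
  then have "norm (g x) \<le> max B 0" for x using assms(3)[of x] by (cases "x \<in> K") (auto simp: le_max_iff_disj)
  then show ?thesis using that[of "max B 0"] by auto
qed

lemma compact_support_integrable:
  fixes g :: "'a::euclidean_space \<Rightarrow> 'b::euclidean_space"
  assumes "continuous_on UNIV g" "compact K" "\<And>x. x \<notin> K \<Longrightarrow> g x = 0"
  shows "integrable lborel g"
proof -
  have "integrable lborel (\<lambda>x. indicator K x *\<^sub>R g x)"
    by (rule borel_integrable_compact[OF assms(2) continuous_on_subset[OF assms(1)]]) auto
  moreover have "(\<lambda>x. indicator K x *\<^sub>R g x) = g" using assms(3) by (auto simp: indicator_def fun_eq_iff)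
  ultimately show ?thesis by simp
qed

lemma borel_of_continuous: "continuous_on UNIV f \<Longrightarrow> f \<in> borel_measurable borel"
  by (rule borel_measurable_continuous_onI)

section \<open>Integration by parts for smooth functions\<close>

lemma integral_lborel_translate:
  fixes f :: "'a::euclidean_space \<Rightarrow> 'b::euclidean_space"
  assumes [measurable]: "f \<in> borel_measurable borel"
  shows "(LINT x|lborel. f (c + x)) = (LINT x|lborel. f x)"
proof -
  have "(LINT x|lborel. f x) = (LINT x|distr lborel borel ((+) c). f x)" by (simp add: lborel_distr_plus)
  also have "\<dots> = (LINT x|lborel. f (c + x))" by (rule integral_distr) auto
  finally show ?thesis by simp
qed

text \<open>The difference quotients in direction \<open>b\<close> have integral zero by translation
  invariance, and they converge boundedly with supports in a common compact set. No iterated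
  integration is involved.\<close>

lemma integral_grad_eq_0:
  assumes "F \<in> test_functions UNIV"
  shows "(LINT x|lborel. grad F x \<bullet> b) = 0"
proof -
  have s: "smooth F" using assms test_smooth by blast
  obtain K where K: "compact K" "\<forall>x. x \<notin> K \<longrightarrow> F x = 0 \<and> grad F x = 0" using test_support[OF assms] by blast
  have cF: "continuous_on UNIV F" and cg: "continuous_on UNIV (grad F)" using s smooth_continuous continuous_grad by auto
  have [measurable]: "F \<in> borel_measurable borel" "grad F \<in> borel_measurable borel"
    using cF cg borel_of_continuous by auto
  obtain C where C: "C \<ge> 0" "\<And>x. norm (grad F x) \<le> C" using compact_support_bounded[OF cg K(1)] K(2) by metis
  have lip: "norm (F x - F y) \<le> C * norm (x - y)" for x y
    by (rule differentiable_bound[where S=UNIV, OF _ smooth_has_derivative[OF s]])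
      (use C in \<open>auto simp: onorm_inner_right intro!: onorm_le order_trans[OF Cauchy_Schwarz_ineq2] mult_right_mono\<close>)
  define h :: "nat \<Rightarrow> real" where "h n = inverse (real (Suc n))" for n
  have h: "h n > 0" "h n \<le> 1" for n by (auto simp: h_def divide_simps)
  have h0: "h \<longlonglongrightarrow> 0" unfolding h_def by (rule LIMSEQ_inverse_real_of_nat)
  \<comment> \<open>\<open>S\<close> is K - [0,1] b: it contains every x with x in K or x + h b in K
    for some h in (0,1], hence the supports of all difference quotients.\<close>
  define S where "S = {x - y | x y. x \<in> K \<and> y \<in> (\<lambda>t. t *\<^sub>R b) ` {0..1}}"
  have "compact ((\<lambda>t. t *\<^sub>R b) ` {0..1::real})"
    by (intro compact_continuous_image continuous_intros compact_Icc)
  then have S: "compact S" unfolding S_def by (rule compact_differences[OF K(1)])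
  have intF: "integrable lborel F" by (rule compact_support_integrable[OF cF K(1)]) (use K in auto)
  have "integrable lborel (\<lambda>x. F (h n *\<^sub>R b + x))" for n
    using integrable_distr[of "(+) (h n *\<^sub>R b)" lborel borel F] intF by (simp add: lborel_distr_plus)
  then have z: "(LINT x|lborel. (F (h n *\<^sub>R b + x) - F x) / h n) = 0" for n
    using intF integral_lborel_translate[of F "h n *\<^sub>R b"] by simp
  have "(\<lambda>n. LINT x|lborel. (F (h n *\<^sub>R b + x) - F x) / h n) \<longlonglongrightarrow> (LINT x|lborel. grad F x \<bullet> b)"
  proof (rule integral_dominated_convergence[where w="\<lambda>x. indicator S x *\<^sub>R (C * norm b)"])
    show "integrable lborel (\<lambda>x. indicator S x *\<^sub>R (C * norm b))"
      by (rule borel_integrable_compact[OF S]) auto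
    show "AE x in lborel. (\<lambda>n. (F (h n *\<^sub>R b + x) - F x) / h n) \<longlonglongrightarrow> grad F x \<bullet> b"
    proof (rule AE_I2)
      fix x
      have "((\<lambda>t. x + t *\<^sub>R b) has_derivative (\<lambda>t. t *\<^sub>R b)) (at (0::real))"
        by (auto intro!: derivative_eq_intros)
      from has_derivative_compose[OF this smooth_has_derivative[OF s]]
      have "((\<lambda>t. F (x + t *\<^sub>R b)) has_real_derivative grad F x \<bullet> b) (at 0)"
        by (simp add: has_field_derivative_def mult_commute_abs)
      then have "((\<lambda>t. (F (x + t *\<^sub>R b) - F x) / t) \<longlongrightarrow> grad F x \<bullet> b) (at 0)"
        by (simp add: has_field_derivative_iff)
      then have "((\<lambda>t. (F (x + t *\<^sub>R b) - F x) / t) \<circ> h) \<longlonglongrightarrow> grad F x \<bullet> b"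
        unfolding comp_def by (rule filterlim_compose) (use h0 h(1) in \<open>auto simp: filterlim_at intro!: always_eventually less_imp_neq[symmetric]\<close>)
      then show "(\<lambda>n. (F (h n *\<^sub>R b + x) - F x) / h n) \<longlonglongrightarrow> grad F x \<bullet> b"
        by (simp add: o_def add.commute)
    qed
    show "AE x in lborel. norm ((F (h n *\<^sub>R b + x) - F x) / h n) \<le> indicator S x *\<^sub>R (C * norm b)" for n
    proof (rule AE_I2)
      fix x
      show "norm ((F (h n *\<^sub>R b + x) - F x) / h n) \<le> indicator S x *\<^sub>R (C * norm b)"
      proof (cases "x \<in> S")
        case True
        then show ?thesis using lip[of "h n *\<^sub>R b + x" x] h(1)[of n] by (simp add: field_simps)
      next
        case False
        have "x \<notin> K"
        proof
          assume "x \<in> K"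
          then have "x - 0 *\<^sub>R b \<in> S" unfolding S_def by (intro CollectI exI[of _ x] exI[of _ "0 *\<^sub>R b"]) (auto intro!: imageI)
          then show False using False by simp
        qed
        moreover have "h n *\<^sub>R b + x \<notin> K"
        proof
          assume "h n *\<^sub>R b + x \<in> K"
          then have "(h n *\<^sub>R b + x) - h n *\<^sub>R b \<in> S" unfolding S_def using h[of n]
            by (intro CollectI exI[of _ "h n *\<^sub>R b + x"] exI[of _ "h n *\<^sub>R b"]) (auto intro!: imageI less_imp_le)
          then show False using False by simp
        qed
        ultimately show ?thesis using K(2) False by simp
      qed
    qed
  qed auto
  then show ?thesis unfolding z by (simp add: LIMSEQ_const_iff)
qed

lemma loc_integrable_mult:
  fixes u :: "'a::euclidean_space \<Rightarrow> 'b::euclidean_space"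
  assumes u: "locally_integrable \<Omega> u" and c: "continuous_on UNIV g" and K: "compact K" "K \<subseteq> \<Omega>" "\<And>x. x \<notin> K \<Longrightarrow> g x = 0"
  shows "integrable lebesgue (\<lambda>x. g x *\<^sub>R u x)" "open \<Omega> \<Longrightarrow> integrable (lebesgue_on \<Omega>) (\<lambda>x. g x *\<^sub>R u x)"
    "open \<Omega> \<Longrightarrow> integral\<^sup>L (lebesgue_on \<Omega>) (\<lambda>x. g x *\<^sub>R u x) = (LINT x|lebesgue. g x *\<^sub>R u x)"
proof -
  obtain C where C: "C \<ge> 0" "\<And>x. norm (g x) \<le> C" using compact_support_bounded[OF c K(1) K(3)] by metis
  have i: "integrable (lebesgue_on K) u" using u K by (auto simp: locally_integrable_def)
  have [measurable]: "g \<in> borel_measurable (lebesgue_on K)"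
    using borel_of_continuous[OF c] by (simp add: measurable_restrict_space1 measurable_completion)
  have [measurable]: "u \<in> borel_measurable (lebesgue_on K)" using i by auto
  have "integrable (lebesgue_on K) (\<lambda>x. g x *\<^sub>R u x)"
    by (rule Bochner_Integration.integrable_bound[of _ "\<lambda>x. C *\<^sub>R u x"])
      (use i C in \<open>auto intro!: mult_mono\<close>)
  moreover have "K \<in> sets lebesgue" using K(1) by (simp add: borel_compact)
  moreover have "(\<lambda>x. indicator K x *\<^sub>R g x *\<^sub>R u x) = (\<lambda>x. g x *\<^sub>R u x)"
    using K(3) by (auto simp: indicator_def fun_eq_iff)
  ultimately show 1: "integrable lebesgue (\<lambda>x. g x *\<^sub>R u x)" by (simp add: integrable_restrict_space)
  have 2: "(\<lambda>x. indicator \<Omega> x *\<^sub>R g x *\<^sub>R u x) = (\<lambda>x. g x *\<^sub>R u x)"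
    using K(2,3) by (auto simp: indicator_def fun_eq_iff)
  show "open \<Omega> \<Longrightarrow> integrable (lebesgue_on \<Omega>) (\<lambda>x. g x *\<^sub>R u x)"
    "open \<Omega> \<Longrightarrow> integral\<^sup>L (lebesgue_on \<Omega>) (\<lambda>x. g x *\<^sub>R u x) = (LINT x|lebesgue. g x *\<^sub>R u x)"
    using 1 by (simp_all add: integrable_restrict_space integral_restrict_space open_in_lebesgue 2 del: scaleR_scaleR)
qed

lemma locally_integrable_continuous:
  fixes f :: "'a::euclidean_space \<Rightarrow> 'b::euclidean_space"
  assumes "continuous_on UNIV f"
  shows "locally_integrable \<Omega> f"
  unfolding locally_integrable_def
proof safe
  fix K :: "'a set" assume K: "compact K"
  have [measurable]: "f \<in> borel_measurable borel" "K \<in> sets borel" using assms borel_of_continuous K borel_compact by auto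
  have "integrable lborel (\<lambda>x. indicator K x *\<^sub>R f x)"
    by (rule borel_integrable_compact[OF K continuous_on_subset[OF assms]]) auto
  then show "integrable (lebesgue_on K) f" by (simp add: integrable_restrict_space integrable_completion)
qed

lemma smooth_has_weak_gradient:
  assumes "open \<Omega>" and s: "smooth f"
  shows "has_weak_gradient \<Omega> f (grad f)"
  unfolding has_weak_gradient_def
proof (intro conjI ballI)
  have cf: "continuous_on UNIV f" and cg: "continuous_on UNIV (grad f)" using s smooth_continuous continuous_grad by auto
  show lf: "locally_integrable \<Omega> f" and "locally_integrable \<Omega> (grad f)"
    by (rule locally_integrable_continuous, fact)+
  fix \<phi> b assume t: "\<phi> \<in> test_functions \<Omega>" and b: "(b::'a) \<in> Basis"
  have s': "smooth \<phi>" using t test_smooth by blast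
  obtain K where K: "compact K" "K \<subseteq> \<Omega>" "\<forall>x. x \<notin> K \<longrightarrow> \<phi> x = 0 \<and> grad \<phi> x = 0" using test_support[OF t] by blast
  have c: "continuous_on UNIV \<phi>" "continuous_on UNIV (\<lambda>x. grad \<phi> x \<bullet> b)" "continuous_on UNIV (\<lambda>x. grad f x \<bullet> b)"
    using s' s b smooth_continuous smooth_grad by blast+
  have 1: "(LINT x|lebesgue_on \<Omega>. f x * (grad \<phi> x \<bullet> b)) = (LINT x|lborel. f x * (grad \<phi> x \<bullet> b))"
    using loc_integrable_mult(3)[OF lf c(2) K(1,2) _ assms(1)] K(3) borel_of_continuous[OF continuous_on_mult[OF cf c(2)]]
    by (simp add: integral_completion mult.commute)
  have 2: "(LINT x|lebesgue_on \<Omega>. (grad f x \<bullet> b) * \<phi> x) = (LINT x|lborel. (grad f x \<bullet> b) * \<phi> x)"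
    using loc_integrable_mult(3)[OF locally_integrable_continuous[OF c(3)] c(1) K(1,2) _ assms(1)] K(3)
      borel_of_continuous[OF continuous_on_mult[OF c(3,1)]]
    by (simp add: integral_completion mult.commute)
  have "(\<lambda>x. f x * \<phi> x) \<in> test_functions UNIV" using test_mono[OF test_mult[OF t s]] by auto
  from integral_grad_eq_0[OF this, of b]
  have "(LINT x|lborel. f x * (grad \<phi> x \<bullet> b) + (grad f x \<bullet> b) * \<phi> x) = 0"
    by (simp add: grad_mult[OF s s'] inner_add_left mult.commute[of "\<phi> _"])
  moreover have "integrable lborel (\<lambda>x. f x * (grad \<phi> x \<bullet> b))" "integrable lborel (\<lambda>x. (grad f x \<bullet> b) * \<phi> x)"
    by (rule compact_support_integrable[OF _ K(1)]; use K(3) c cf in \<open>auto intro!: continuous_on_mult\<close>)+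
  ultimately show "(LINT x|lebesgue_on \<Omega>. f x * partial_deriv b \<phi> x) = - (LINT x|lebesgue_on \<Omega>. (grad f x \<bullet> b) * \<phi> x)"
    using 1 2 b by (simp add: grad_inner_Basis)
qed


text \<open>Dynkin's argument: boxes are stable under intersection and generate the Borel sets, and
  the sets over which the integral vanishes are closed under complements and countable disjoint
  unions.\<close>

lemma boxes_determine_zero:
  fixes f :: "'a::euclidean_space \<Rightarrow> real"
  assumes f: "integrable lborel f" and z: "\<And>c d. (LINT x:box c d|lborel. f x) = 0"
  shows "AE x in lborel. f x = 0"
proof (rule sigma_finite_measure.density_zero[OF sigma_finite_lborel f])
  have UN: "(\<Union>n::nat. box (- (real n *\<^sub>R One)) (real n *\<^sub>R One) :: 'a set) = UNIV" by (rule UN_box_eq_UNIV)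
  have [simp]: "set_integrable lborel A f" if "A \<in> sets borel" for A
    unfolding set_integrable_def using that f by (intro integrable_mult_indicator) auto
  \<comment> \<open>The complement step needs a vanishing integral over the whole space, which is an
    increasing union of boxes.\<close>
  have tot: "(LINT x:UNIV|lborel. f x) = 0"
  proof -
    have "(\<lambda>n. LINT x:box (- (real n *\<^sub>R One)) (real n *\<^sub>R One)|lborel. f x) \<longlonglongrightarrow>
      (LINT x:(\<Union>n::nat. box (- (real n *\<^sub>R One)) (real n *\<^sub>R One))|lborel. f x)"
      by (rule set_integral_cont_up)
        (auto simp: UN incseq_def mem_box dest!: bspec)
    then show ?thesis by (simp add: z UN LIMSEQ_const_iff)
  qed
  fix A assume "A \<in> sets (lborel::'a measure)"
  then have A: "A \<in> sigma_sets UNIV (range (\<lambda>(a, b). box a b :: 'a set))"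
    by (simp add: borel_eq_box)
  have "Int_stable (range (\<lambda>(a, b). box a b :: 'a set))" "range (\<lambda>(a, b). box a b :: 'a set) \<subseteq> Pow UNIV"
    by (auto simp: Int_stable_def box_Int_box)
  from this A show "(LINT x:A|lborel. f x) = 0"
  proof (induct rule: sigma_sets_induct_disjoint)
    case (basic A)
    then show ?case using z by auto
  next
    case (compl A)
    then have [measurable]: "A \<in> sets borel" by (simp add: borel_eq_box)
    have "(LINT x:UNIV|lborel. f x) = (LINT x:A|lborel. f x) + (LINT x:UNIV - A|lborel. f x)"
      using set_integral_Un[of A "UNIV - A" lborel f] by simp
    then show ?case using compl tot by simp
  next
    case (union A)
    then have [measurable]: "A i \<in> sets borel" for i by (auto simp: borel_eq_box)
    have "(LINT x:(\<Union>i. A i)|lborel. f x) = (\<Sum>i. (LINT x:(A i)|lborel. f x))"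
      by (rule lebesgue_integral_countable_add) (use union(1) in \<open>auto simp: disjoint_family_on_def\<close>)
    then show ?case using union by simp
  qed (auto simp: set_lebesgue_integral_def)
qed

lemma smooth_inner_affine: "smooth (\<lambda>x::'a::euclidean_space. c * (x \<bullet> b) + d)"
  by (intro smooth_add smooth_mult smooth_const smooth_linear[OF smooth_id] bounded_linear_inner_left)

text \<open>Products of ramps, steepened by n in every coordinate, vanish off the open box and tend
  to its indicator, because exp(-1/(n s)) tends to 1 for each s > 0. They stay between 0 and 1 and
  are supported in one closed box, on which |w| is an integrable majorant.\<close>

lemma orthogonal_test_box:
  fixes w :: "'a::euclidean_space \<Rightarrow> real"
  assumes \<Omega>: "open \<Omega>" and w: "locally_integrable \<Omega> w"
    and 0: "\<And>\<phi>. \<phi> \<in> test_functions \<Omega> \<Longrightarrow> (LINT x|lebesgue_on \<Omega>. w x * \<phi> x) = 0"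
    and sub: "cbox c d \<subseteq> \<Omega>"
  shows "(LINT x|lebesgue. indicator (box c d) x * w x) = 0"
proof -
  define \<phi> where "\<phi> n x = (\<Prod>b\<in>Basis. ramp (real n * (x \<bullet> b) + - real n * (c \<bullet> b)) * ramp (- real n * (x \<bullet> b) + real n * (d \<bullet> b)))"
    for n :: nat and x :: 'a
  have sm: "smooth (\<phi> n)" for n unfolding \<phi>_def
    by (intro smooth_prod smooth_mult smooth_compose[OF ramp(1)] smooth_inner_affine)
  have off: "\<phi> n x = 0" if nb: "x \<notin> box c d" for n x
  proof -
    obtain b where b: "b \<in> Basis" "\<not> (c \<bullet> b < x \<bullet> b \<and> x \<bullet> b < d \<bullet> b)"
      using nb unfolding mem_box by blast
    from b(2) have "x \<bullet> b \<le> c \<bullet> b \<or> d \<bullet> b \<le> x \<bullet> b" by linarith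
    then have "real n * (x \<bullet> b) + - real n * (c \<bullet> b) \<le> 0 \<or> - real n * (x \<bullet> b) + real n * (d \<bullet> b) \<le> 0"
      by (auto simp: mult_left_mono)
    then have "ramp (real n * (x \<bullet> b) + - real n * (c \<bullet> b)) * ramp (- real n * (x \<bullet> b) + real n * (d \<bullet> b)) = 0"
      using ramp(2) by auto
    then show ?thesis unfolding \<phi>_def using b(1) by (intro prod_zero) auto
  qed
  have off': "\<phi> n x = 0" if nb: "x \<notin> cbox c d" for n x using off nb box_subset_cbox by blast
  have test: "\<phi> n \<in> test_functions \<Omega>" for n
    by (rule test_functionsI[OF sm compact_cbox sub off'])
  have bnd: "0 \<le> \<phi> n x \<and> \<phi> n x \<le> 1" for n x unfolding \<phi>_def
    by (auto intro!: prod_nonneg prod_le_1 mult_nonneg_nonneg mult_le_one ramp(4,5))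
  have lim: "(\<lambda>n. \<phi> n x) \<longlonglongrightarrow> indicator (box c d) x" for x
  proof (cases "x \<in> box c d")
    case False then show ?thesis using off by simp
  next
    case True
    have r: "(\<lambda>n. ramp (real n * t)) \<longlonglongrightarrow> 1" if "t > 0" for t
    proof -
      have "(\<lambda>n. exp (- (inverse t * inverse (real n)))) \<longlonglongrightarrow> exp (- (inverse t * 0))"
        by (intro tendsto_intros lim_inverse_n)
      moreover have "\<forall>\<^sub>F n in sequentially. exp (- (inverse t * inverse (real n))) = ramp (real n * t)"
        using eventually_gt_at_top[of 0] by eventually_elim (use that in \<open>simp add: ramp(3) mult.commute\<close>)
      ultimately show ?thesis by (simp add: tendsto_cong)
    qed
    have "(\<lambda>n. \<Prod>b\<in>Basis. ramp (real n * (x \<bullet> b - c \<bullet> b)) * ramp (real n * (d \<bullet> b - x \<bullet> b))) \<longlonglongrightarrow> (\<Prod>b\<in>(Basis::'a set). 1 * 1)"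
      by (intro tendsto_prod tendsto_mult r) (use True in \<open>auto simp: mem_box\<close>)
    then show ?thesis using True by (simp add: \<phi>_def algebra_simps)
  qed
  have "integrable (lebesgue_on (cbox c d)) w" using w sub by (auto simp: locally_integrable_def)
  then have i: "integrable lebesgue (\<lambda>x. indicator (cbox c d) x * w x)" by (simp add: integrable_restrict_space)
  have c: "continuous_on UNIV (\<phi> n)" for n using sm smooth_continuous by blast
  have "(\<lambda>n. LINT x|lebesgue. \<phi> n x * (indicator (cbox c d) x * w x)) \<longlonglongrightarrow> (LINT x|lebesgue. indicator (box c d) x * (indicator (cbox c d) x * w x))"
  proof (rule integral_dominated_convergence[where w="\<lambda>x. norm (indicator (cbox c d) x * w x)"])
    show "AE x in lebesgue. (\<lambda>n. \<phi> n x * (indicator (cbox c d) x * w x)) \<longlonglongrightarrow> indicator (box c d) x * (indicator (cbox c d) x * w x)"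
      by (intro AE_I2 tendsto_mult lim tendsto_const)
    show "AE x in lebesgue. norm (\<phi> n x * (indicator (cbox c d) x * w x)) \<le> norm (indicator (cbox c d) x * w x)" for n
    proof (rule AE_I2)
      fix x show "norm (\<phi> n x * (indicator (cbox c d) x * w x)) \<le> norm (indicator (cbox c d) x * w x)"
        unfolding norm_mult[of "\<phi> n x"] by (rule mult_left_le_one_le) (use bnd[of n x] in auto)
    qed
    show "integrable lebesgue (\<lambda>x. norm (indicator (cbox c d) x * w x))" using i by (rule integrable_norm)
    have im: "(\<lambda>x. indicator (cbox c d) x * w x) \<in> borel_measurable lebesgue" using i by auto
    have "(\<lambda>x. indicator (box c d) x::real) \<in> borel_measurable lebesgue" by (intro measurable_completion) auto
    then show "(\<lambda>x. indicator (box c d) x * (indicator (cbox c d) x * w x)) \<in> borel_measurable lebesgue"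
      using im by (rule borel_measurable_times)
    show "(\<lambda>x. \<phi> n x * (indicator (cbox c d) x * w x)) \<in> borel_measurable lebesgue" for n
      by (rule borel_measurable_times[OF _ im]) (use borel_of_continuous[OF c] in \<open>simp add: measurable_completion\<close>)
  qed
  moreover have "(LINT x|lebesgue. \<phi> n x * (indicator (cbox c d) x * w x)) = 0" for n
  proof -
    have "(\<lambda>x. \<phi> n x * (indicator (cbox c d) x * w x)) = (\<lambda>x. \<phi> n x * w x)"
      using off' by (auto simp: indicator_def fun_eq_iff)
    then show ?thesis using 0[OF test, of n] loc_integrable_mult(3)[OF w c compact_cbox sub off' \<Omega>, of n]
      by (simp add: mult.commute)
  qed
  moreover have "indicator (box c d) x * (indicator (cbox c d) x * w x) = indicator (box c d) x * w x" for x
    using box_subset_cbox by (auto simp: indicator_def)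
  ultimately show ?thesis by (simp add: LIMSEQ_const_iff)
qed

text \<open>Localisation to a closed box inside \<Omega> makes \<open>w\<close> integrable; there a
  Borel representative has vanishing integrals over all boxes and is zero. Countably many closed
  boxes exhaust \<Omega>.\<close>

lemma fundamental_lemma:
  fixes w :: "'a::euclidean_space \<Rightarrow> real"
  assumes \<Omega>: "open \<Omega>" and w: "locally_integrable \<Omega> w"
    and 0: "\<And>\<phi>. \<phi> \<in> test_functions \<Omega> \<Longrightarrow> (LINT x|lebesgue_on \<Omega>. w x * \<phi> x) = 0"
  shows "AE x in lebesgue_on \<Omega>. w x = 0"
proof -
  have box: "AE x in lebesgue. x \<in> cbox a b \<longrightarrow> w x = 0" if sub: "cbox a b \<subseteq> \<Omega>" for a b
  proof -
    have "integrable (lebesgue_on (cbox a b)) w" using w sub by (auto simp: locally_integrable_def)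
    then have "integrable lebesgue (\<lambda>x. indicator (cbox a b) x * w x)" by (simp add: integrable_restrict_space)
    then have "integrable lebesgue (\<lambda>x. indicator (box a b) x *\<^sub>R (indicator (cbox a b) x * w x))"
      by (intro integrable_mult_indicator) auto
    moreover have "indicator (box a b) x *\<^sub>R (indicator (cbox a b) x * w x) = indicator (box a b) x * w x" for x
      using box_subset_cbox[of a b] by (auto simp: indicator_def)
    ultimately have i: "integrable lebesgue (\<lambda>x. indicator (box a b) x * w x)" by (simp only: simp_thms)
    then have m: "(\<lambda>x. indicator (box a b) x * w x) \<in> borel_measurable lebesgue" by auto
    then obtain f where f: "f \<in> borel_measurable lborel" "AE x in lborel. indicator (box a b) x * w x = f x"
      using completion_ex_borel_measurable_real by blast
    note [measurable] = m f(1)[unfolded measurable_lborel2]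
    have ae: "AE x in lebesgue. indicator (box a b) x * w x = f x" using f(2) by (rule AE_completion)
    have fm: "f \<in> borel_measurable lebesgue" using f(1) by (rule measurable_completion)
    have "integrable lebesgue f" using integrable_cong_AE[THEN iffD1, OF m fm ae i] .
    then have fi: "integrable lborel f" using f(1) by (simp add: integrable_completion)
    have "AE x in lborel. f x = 0"
    proof (rule boxes_determine_zero[OF fi])
      \<comment> \<open>Two boxes meet in a box, which still lies inside \<Omega>, so orthogonality
        on boxes in \<Omega> covers the integrals over arbitrary boxes.\<close>
      fix c d :: 'a
      define c' where "c' = (\<Sum>i\<in>Basis. max (a \<bullet> i) (c \<bullet> i) *\<^sub>R i)"
      define d' where "d' = (\<Sum>i\<in>Basis. min (b \<bullet> i) (d \<bullet> i) *\<^sub>R i)"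
      have eq: "box a b \<inter> box c d = box c' d'" by (simp add: box_Int_box c'_def d'_def)
      have "cbox c' d' \<subseteq> cbox a b" by (auto simp: mem_box c'_def d'_def)
      then have z: "(LINT x|lebesgue. indicator (box c' d') x * w x) = 0"
        using orthogonal_test_box[OF \<Omega> w 0] sub by blast
      have e2: "indicator (box c d) x * (indicator (box a b) x * w x) = indicator (box c' d') x * w x" for x
        unfolding eq[symmetric] by (auto simp: indicator_def)
      have "(LINT x|lborel. indicator (box c d) x * f x) = (LINT x|lebesgue. indicator (box c d) x * f x)"
        by (rule integral_completion[symmetric]) (use f(1) in measurable)
      also have "\<dots> = (LINT x|lebesgue. indicator (box c d) x * (indicator (box a b) x * w x))"
      proof (rule integral_cong_AE)
        show "AE x in lebesgue. indicator (box c d) x * f x = indicator (box c d) x * (indicator (box a b) x * w x)"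
          using ae by eventually_elim simp
        have "(\<lambda>x. indicator (box c d) x * f x) \<in> borel_measurable lborel" using f(1) by measurable
        then show "(\<lambda>x. indicator (box c d) x * f x) \<in> borel_measurable lebesgue" by (rule measurable_completion)
        have "(\<lambda>x. indicator (box c d) x::real) \<in> borel_measurable lebesgue" by (intro measurable_completion) auto
        then show "(\<lambda>x. indicator (box c d) x * (indicator (box a b) x * w x)) \<in> borel_measurable lebesgue"
          using m by (rule borel_measurable_times)
      qed
      also have "\<dots> = 0" using z by (simp add: e2)
      finally show "(LINT x:box c d|lborel. f x) = 0" by (simp add: set_lebesgue_integral_def)
    qed
    then have "AE x in lebesgue. f x = 0" by (rule AE_completion)
    \<comment> \<open>The representative only describes \<open>w\<close> on the open box; the faces
      form a null set.\<close>
    moreover have "AE x in lebesgue. x \<notin> cbox a b - box a b"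
      using negligible_frontier_interval[of a b] by (intro AE_not_in) (simp add: negligible_iff_null_sets)
    ultimately show ?thesis using ae by eventually_elim (auto split: split_indicator_asm)
  qed
  have "\<exists>\<D>. countable \<D> \<and> \<Union>\<D> = \<Omega> \<and> (\<forall>X\<in>\<D>. \<exists>a b. X = cbox a b)"
  proof (rule open_countable_Union_open_cbox[OF \<Omega>])
    fix \<D> assume "countable \<D>" "\<And>X. X \<in> \<D> \<Longrightarrow> \<exists>a b. X = cbox a b" "\<Union>\<D> = \<Omega>"
    then show ?thesis by (intro exI[of _ \<D>] conjI ballI)
  qed
  then obtain \<D> where D: "countable \<D>" "\<Union>\<D> = \<Omega>" "\<forall>X\<in>\<D>. \<exists>a b. X = cbox a b" by blast
  have Dz: "AE x in lebesgue. x \<in> X \<longrightarrow> w x = 0" if X: "X \<in> \<D>" for X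
  proof -
    obtain a b where ab: "X = cbox a b" using D(3) X by blast
    have "cbox a b \<subseteq> \<Omega>" using D(2) X ab by blast
    then show ?thesis unfolding ab by (rule box)
  qed
  have "AE x in lebesgue. \<forall>X\<in>\<D>. x \<in> X \<longrightarrow> w x = 0"
    by (rule AE_ball_countable'[OF Dz D(1)])
  then have "AE x in lebesgue. x \<in> \<Omega> \<longrightarrow> w x = 0" by eventually_elim (use D(2) in blast)
  then show ?thesis using \<Omega> by (simp add: AE_restrict_space_iff open_in_lebesgue)
qed

section \<open>Square-integrable convergence and closures of test functions\<close>

lemma locally_integrable_inner: "locally_integrable \<Omega> g \<Longrightarrow> locally_integrable \<Omega> (\<lambda>x. g x \<bullet> b)"
  by (auto simp: locally_integrable_def)

lemma locally_integrable_diff: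
  "locally_integrable \<Omega> f \<Longrightarrow> locally_integrable \<Omega> g \<Longrightarrow> locally_integrable \<Omega> (\<lambda>x. f x - g x)"
  by (auto simp: locally_integrable_def)

lemma integrable_mult_test:
  fixes u :: "'a::euclidean_space \<Rightarrow> real"
  assumes "open \<Omega>" "locally_integrable \<Omega> u" "\<phi> \<in> test_functions \<Omega>"
  shows "integrable (lebesgue_on \<Omega>) (\<lambda>x. u x * \<phi> x)"
    and "b \<in> Basis \<Longrightarrow> integrable (lebesgue_on \<Omega>) (\<lambda>x. u x * partial_deriv b \<phi> x)"
proof -
  have s: "smooth \<phi>" using assms(3) test_smooth by blast
  obtain K where K: "compact K" "K \<subseteq> \<Omega>" "\<forall>x. x \<notin> K \<longrightarrow> \<phi> x = 0 \<and> grad \<phi> x = 0"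
    using test_support[OF assms(3)] by blast
  show "integrable (lebesgue_on \<Omega>) (\<lambda>x. u x * \<phi> x)"
    using loc_integrable_mult(2)[OF assms(2) smooth_continuous[OF s] K(1,2) _ assms(1)] K(3) by (simp add: mult.commute)
  assume b: "b \<in> Basis"
  show "integrable (lebesgue_on \<Omega>) (\<lambda>x. u x * partial_deriv b \<phi> x)"
    using loc_integrable_mult(2)[OF assms(2) smooth_continuous[OF smooth_grad[OF s b]] K(1,2) _ assms(1)] K(3)
    by (simp add: mult.commute grad_inner_Basis[OF b])
qed

section \<open>Differences and uniqueness of weak gradients\<close>

lemma has_weak_gradient_diff:
  assumes \<Omega>: "open \<Omega>" and 1: "has_weak_gradient \<Omega> u g" and 2: "has_weak_gradient \<Omega> v h"
  shows "has_weak_gradient \<Omega> (\<lambda>x. u x - v x) (\<lambda>x. g x - h x)"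
  unfolding has_weak_gradient_def
proof (intro conjI ballI)
  have l: "locally_integrable \<Omega> u" "locally_integrable \<Omega> v" "locally_integrable \<Omega> g" "locally_integrable \<Omega> h"
    using 1 2 by (auto simp: has_weak_gradient_def)
  then show "locally_integrable \<Omega> (\<lambda>x. u x - v x)" "locally_integrable \<Omega> (\<lambda>x. g x - h x)"
    by (auto intro: locally_integrable_diff)
  fix \<phi> b assume t: "\<phi> \<in> test_functions \<Omega>" and b: "(b::'a) \<in> Basis"
  note i = integrable_mult_test(2)[OF \<Omega> l(1) t b] integrable_mult_test(2)[OF \<Omega> l(2) t b]
    integrable_mult_test(1)[OF \<Omega> locally_integrable_inner[OF l(3)] t, of b]
    integrable_mult_test(1)[OF \<Omega> locally_integrable_inner[OF l(4)] t, of b]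
  have "(LINT x|lebesgue_on \<Omega>. u x * partial_deriv b \<phi> x) = - (LINT x|lebesgue_on \<Omega>. (g x \<bullet> b) * \<phi> x)"
    "(LINT x|lebesgue_on \<Omega>. v x * partial_deriv b \<phi> x) = - (LINT x|lebesgue_on \<Omega>. (h x \<bullet> b) * \<phi> x)"
    using 1 2 t b by (auto simp: has_weak_gradient_def)
  then show "(LINT x|lebesgue_on \<Omega>. (u x - v x) * partial_deriv b \<phi> x) = - (LINT x|lebesgue_on \<Omega>. ((g x - h x) \<bullet> b) * \<phi> x)"
    using i by (simp add: left_diff_distrib inner_diff_left)
qed

lemma weak_gradient_unique:
  assumes \<Omega>: "open \<Omega>" and 1: "has_weak_gradient \<Omega> u g" and 2: "has_weak_gradient \<Omega> u h"
  shows "AE x in lebesgue_on \<Omega>. g x = h x"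
proof -
  have l: "locally_integrable \<Omega> g" "locally_integrable \<Omega> h" using 1 2 by (auto simp: has_weak_gradient_def)
  have "AE x in lebesgue_on \<Omega>. (g x - h x) \<bullet> b = 0" if b: "b \<in> Basis" for b
  proof (rule fundamental_lemma[OF \<Omega>])
    show "locally_integrable \<Omega> (\<lambda>x. (g x - h x) \<bullet> b)" by (intro locally_integrable_inner locally_integrable_diff l)
    fix \<phi> assume t: "\<phi> \<in> test_functions \<Omega>"
    note i = integrable_mult_test(1)[OF \<Omega> locally_integrable_inner[OF l(1)] t, of b]
      integrable_mult_test(1)[OF \<Omega> locally_integrable_inner[OF l(2)] t, of b]
    have "(LINT x|lebesgue_on \<Omega>. u x * partial_deriv b \<phi> x) = - (LINT x|lebesgue_on \<Omega>. (g x \<bullet> b) * \<phi> x)"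
      "(LINT x|lebesgue_on \<Omega>. u x * partial_deriv b \<phi> x) = - (LINT x|lebesgue_on \<Omega>. (h x \<bullet> b) * \<phi> x)"
      using 1 2 t b by (auto simp: has_weak_gradient_def)
    then have "(LINT x|lebesgue_on \<Omega>. (g x \<bullet> b) * \<phi> x) = (LINT x|lebesgue_on \<Omega>. (h x \<bullet> b) * \<phi> x)"
      by simp
    then show "(LINT x|lebesgue_on \<Omega>. ((g x - h x) \<bullet> b) * \<phi> x) = 0"
      using i by (simp add: left_diff_distrib inner_diff_left)
  qed
  then have "AE x in lebesgue_on \<Omega>. \<forall>b\<in>Basis. (g x - h x) \<bullet> b = 0"
    by (intro AE_finite_allI) auto
  then show ?thesis
  proof eventually_elim
    case (elim x)
    then have "g x - h x = 0" by (simp only: euclidean_all_zero_iff)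
    then show ?case by simp
  qed
qed

text \<open>Makes the choice operator in \<open>weak_gradient\<close> harmless: under an integral,
  any explicitly known weak gradient may take its place.\<close>

lemma weak_gradient_AE:
  assumes "open \<Omega>" "has_weak_gradient \<Omega> u g"
  shows "AE x in lebesgue_on \<Omega>. weak_gradient \<Omega> u x = g x"
    and "has_weak_gradient \<Omega> u (weak_gradient \<Omega> u)"
proof -
  show 1: "has_weak_gradient \<Omega> u (weak_gradient \<Omega> u)"
    unfolding weak_gradient_def by (rule someI[where P="has_weak_gradient \<Omega> u", OF assms(2)])
  show "AE x in lebesgue_on \<Omega>. weak_gradient \<Omega> u x = g x"
    by (rule weak_gradient_unique[OF assms(1) 1 assms(2)])
qed

text \<open>Rests on completeness of Lebesgue measure: the preimages of a set under the two
  functions differ by a null set.\<close>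

lemma measurable_lebesgue_on_AE:
  assumes \<Omega>: "\<Omega> \<in> sets lebesgue" and f: "f \<in> borel_measurable (lebesgue_on \<Omega>)"
    and ae: "AE x in lebesgue_on \<Omega>. f x = g x"
  shows "g \<in> borel_measurable (lebesgue_on \<Omega>)"
proof (rule measurableI)
  fix A :: "'b set" assume A: "A \<in> sets borel"
  have s: "f -` A \<inter> \<Omega> \<in> sets lebesgue"
    using measurable_sets[OF f A] \<Omega> by (simp add: space_restrict_space sets_restrict_space_iff)
  have "AE x in lebesgue. x \<in> \<Omega> \<longrightarrow> f x = g x" using ae \<Omega> by (simp add: AE_restrict_space_iff)
  then have "AE x in lebesgue. x \<in> f -` A \<inter> \<Omega> \<longleftrightarrow> x \<in> g -` A \<inter> \<Omega>" by eventually_elim auto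
  from completion.in_sets_AE[OF this s] have "g -` A \<inter> \<Omega> \<in> sets lebesgue" by simp
  then show "g -` A \<inter> space (lebesgue_on \<Omega>) \<in> sets (lebesgue_on \<Omega>)"
    using \<Omega> by (simp add: space_restrict_space sets_restrict_space_iff)
qed simp

section \<open>Limits of bilinear integrals under L2 convergence\<close>

definition sqint :: "'a measure \<Rightarrow> ('a \<Rightarrow> 'b::euclidean_space) \<Rightarrow> bool" where
  "sqint M f \<longleftrightarrow> f \<in> borel_measurable M \<and> integrable M (\<lambda>x. (norm (f x))\<^sup>2)"

lemma L2_sqint: "L2 \<Omega> = {f. sqint (lebesgue_on \<Omega>) f}"
  by (simp add: L2_def sqint_def)

lemma sqint_diff:
  assumes f: "sqint M f" and g: "sqint M g"
  shows "sqint M (\<lambda>x. f x - g x)"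
proof -
  have [measurable]: "f \<in> borel_measurable M" "g \<in> borel_measurable M" using f g by (auto simp: sqint_def)
  have "integrable M (\<lambda>x. (norm (f x - g x))\<^sup>2)"
  proof (rule Bochner_Integration.integrable_bound)
    show "integrable M (\<lambda>x. 2 * (norm (f x))\<^sup>2 + 2 * (norm (g x))\<^sup>2)" using f g by (auto simp: sqint_def)
    have "(norm (f x - g x))\<^sup>2 \<le> 2 * (norm (f x))\<^sup>2 + 2 * (norm (g x))\<^sup>2" for x
    proof -
      have "(norm (f x - g x))\<^sup>2 \<le> (norm (f x) + norm (g x))\<^sup>2" by (intro power_mono norm_triangle_ineq4) auto
      also have "\<dots> \<le> 2 * (norm (f x))\<^sup>2 + 2 * (norm (g x))\<^sup>2"
        using sum_squares_bound[of "norm (f x)" "norm (g x)"] by (simp add: power2_sum)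
      finally show ?thesis .
    qed
    then show "AE x in M. norm ((norm (f x - g x))\<^sup>2) \<le> norm (2 * (norm (f x))\<^sup>2 + 2 * (norm (g x))\<^sup>2)" by simp
  qed measurable
  then show ?thesis by (simp add: sqint_def)
qed

lemma sqint_prod_integrable:
  assumes f: "sqint M f" and g: "sqint M g"
  shows "integrable M (\<lambda>x. norm (f x) * norm (g x))"
proof -
  have [measurable]: "f \<in> borel_measurable M" "g \<in> borel_measurable M" using f g by (auto simp: sqint_def)
  show ?thesis
  proof (rule Bochner_Integration.integrable_bound)
    show "integrable M (\<lambda>x. (norm (f x))\<^sup>2 + (norm (g x))\<^sup>2)" using f g by (auto simp: sqint_def)
    have "norm (f x) * norm (g x) \<le> (norm (f x))\<^sup>2 + (norm (g x))\<^sup>2" for x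
      using sum_squares_bound[of "norm (f x)" "norm (g x)"] mult_nonneg_nonneg[OF norm_ge_zero[of "f x"] norm_ge_zero[of "g x"]] by linarith
    then show "AE x in M. norm (norm (f x) * norm (g x)) \<le> norm ((norm (f x))\<^sup>2 + (norm (g x))\<^sup>2)" by simp
  qed measurable
qed

text \<open>Instead of the Cauchy-Schwarz inequality, the weighted estimate uv <= e u^2 + v^2/e is
  used with a weight \<open>e k\<close> comparable to the L2 norm of \<open>g k\<close>.\<close>

lemma L2_prod_tendsto_0:
  assumes f: "sqint M f" and g: "\<And>k. sqint M (g k)" and 0: "(\<lambda>k. LINT x|M. (norm (g k x))\<^sup>2) \<longlonglongrightarrow> 0"
  shows "(\<lambda>k. LINT x|M. norm (f x) * norm (g k x)) \<longlonglongrightarrow> 0"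
proof -
  define A where "A = (LINT x|M. (norm (f x))\<^sup>2)"
  define B where "B k = (LINT x|M. (norm (g k x))\<^sup>2)" for k
  \<comment> \<open>The summand 1/(k+1) keeps the weight positive when the norm of
    \<open>g k\<close> is zero and does not disturb the limit.\<close>
  define e where "e k = sqrt (B k) + inverse (real (Suc k))" for k
  have B0: "B k \<ge> 0" for k by (simp add: B_def)
  then have e: "e k > 0" for k by (auto simp: e_def intro!: add_nonneg_pos)
  have A: "A \<ge> 0" by (simp add: A_def)
  have le: "(LINT x|M. norm (f x) * norm (g k x)) \<le> e k * A + sqrt (B k)" for k
  proof -
    have i: "integrable M (\<lambda>x. (norm (f x))\<^sup>2)" "integrable M (\<lambda>x. (norm (g k x))\<^sup>2)" using f g by (auto simp: sqint_def)
    have "(LINT x|M. norm (f x) * norm (g k x)) \<le> (LINT x|M. e k * (norm (f x))\<^sup>2 + (norm (g k x))\<^sup>2 / e k)"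
    proof (rule integral_mono[OF sqint_prod_integrable[OF f g]])
      show "integrable M (\<lambda>x. e k * (norm (f x))\<^sup>2 + (norm (g k x))\<^sup>2 / e k)" using i by auto
      fix x
      let ?a = "norm (f x)" and ?b = "norm (g k x)"
      have "0 \<le> (e k * ?a - ?b)\<^sup>2" by simp
      also have "\<dots> = e k * e k * ?a\<^sup>2 + ?b\<^sup>2 - 2 * (e k * ?a * ?b)" by (simp add: power2_eq_square algebra_simps)
      finally have "2 * (e k * (?a * ?b)) \<le> e k * e k * ?a\<^sup>2 + ?b\<^sup>2" by (simp add: mult.assoc)
      moreover have "0 \<le> e k * (?a * ?b)" using e[of k] by simp
      ultimately have "e k * (?a * ?b) \<le> e k * e k * ?a\<^sup>2 + ?b\<^sup>2" by linarith
      then show "?a * ?b \<le> e k * ?a\<^sup>2 + ?b\<^sup>2 / e k"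
        using e[of k] by (simp add: field_simps)
    qed
    also have "\<dots> = e k * A + B k / e k" using i by (simp add: A_def B_def)
    also have "B k / e k \<le> sqrt (B k)"
    proof -
      have "B k = sqrt (B k) * sqrt (B k)" using B0 by simp
      also have "\<dots> \<le> sqrt (B k) * e k" by (intro mult_left_mono) (auto simp: e_def B0)
      finally show ?thesis using e[of k] by (simp add: field_simps)
    qed
    finally show ?thesis by simp
  qed
  have sB: "(\<lambda>k. sqrt (B k)) \<longlonglongrightarrow> 0" using tendsto_real_sqrt[OF 0] by (simp add: B_def)
  have "(\<lambda>k. e k * A + sqrt (B k)) \<longlonglongrightarrow> (0 + 0) * A + 0"
    unfolding e_def by (intro tendsto_intros sB LIMSEQ_inverse_real_of_nat)
  then have "(\<lambda>k. e k * A + sqrt (B k)) \<longlonglongrightarrow> 0" by simp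
  then show ?thesis
    by (rule tendsto_sandwich[OF _ _ tendsto_const, rotated 2])
      (simp_all add: le always_eventually integral_nonneg_AE)
qed

definition L2conv :: "'a measure \<Rightarrow> (nat \<Rightarrow> 'a \<Rightarrow> 'b::euclidean_space) \<Rightarrow> ('a \<Rightarrow> 'b) \<Rightarrow> bool" where
  "L2conv M F f \<longleftrightarrow> (\<forall>k. sqint M (F k)) \<and> sqint M f \<and> (\<lambda>k. LINT x|M. (norm (F k x - f x))\<^sup>2) \<longlonglongrightarrow> 0"

lemma L2conv_const: "sqint M f \<Longrightarrow> L2conv M (\<lambda>_. f) f" by (simp add: L2conv_def)

lemma bilinear_integrable:
  fixes B :: "'a \<Rightarrow> 'b::euclidean_space \<Rightarrow> 'c::euclidean_space \<Rightarrow> real"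
  assumes bound: "\<And>x u v. \<bar>B x u v\<bar> \<le> C * (norm u * norm v)"
    and meas: "(\<lambda>x. B x (f x) (g x)) \<in> borel_measurable M"
    and f: "sqint M f" and g: "sqint M g"
  shows "integrable M (\<lambda>x. B x (f x) (g x))"
proof (rule Bochner_Integration.integrable_bound[of _ "\<lambda>x. C * (norm (f x) * norm (g x))"])
  show "integrable M (\<lambda>x. C * (norm (f x) * norm (g x)))" using sqint_prod_integrable[OF f g] by auto
  show "AE x in M. norm (B x (f x) (g x)) \<le> norm (C * (norm (f x) * norm (g x)))"
    using bound by (auto intro!: AE_I2 order_trans[OF _ abs_ge_self])
qed (rule meas)

text \<open>Expanding around (f, g) leaves a product of two increments and two products of one
  increment with a fixed function; each integral tends to 0. Letting the form depend on x covers
  energies, norms and all blocks of the matrix at once.\<close>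

lemma L2conv_bilinear:
  fixes B :: "'a \<Rightarrow> 'b::euclidean_space \<Rightarrow> 'c::euclidean_space \<Rightarrow> real"
  assumes bil: "\<And>x. bounded_bilinear (B x)"
    and bound: "\<And>x u v. \<bar>B x u v\<bar> \<le> C * (norm u * norm v)"
    and meas: "\<And>f g. f \<in> borel_measurable M \<Longrightarrow> g \<in> borel_measurable M \<Longrightarrow> (\<lambda>x. B x (f x) (g x)) \<in> borel_measurable M"
    and F: "L2conv M F f" and G: "L2conv M G g"
  shows "(\<lambda>k. LINT x|M. B x (F k x) (G k x)) \<longlonglongrightarrow> (LINT x|M. B x (f x) (g x))"
proof -
  have sq: "sqint M (F k)" "sqint M (G k)" "sqint M f" "sqint M g" for k using F G by (auto simp: L2conv_def)
  have sqd: "sqint M (\<lambda>x. F k x - f x)" "sqint M (\<lambda>x. G k x - g x)" for k by (intro sqint_diff sq)+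
  have int: "integrable M (\<lambda>x. B x (u x) (v x))" if "sqint M u" "sqint M v" for u v
    by (rule bilinear_integrable[OF bound meas that]) (use that in \<open>auto simp: sqint_def\<close>)
  have C: "0 \<le> C * (norm u * norm v)" for u :: 'b and v :: 'c using order_trans[OF abs_ge_zero bound] .
  define d where "d k = (LINT x|M. norm (F k x - f x) * norm (G k x - g x)) + (LINT x|M. norm (f x) * norm (G k x - g x))
      + (LINT x|M. norm (g x) * norm (F k x - f x))" for k
  have bd: "norm ((LINT x|M. B x (F k x) (G k x)) - (LINT x|M. B x (f x) (g x))) \<le> C * d k" for k
  proof -
    have e: "B x (F k x) (G k x) - B x (f x) (g x)
       = B x (F k x - f x) (G k x - g x) + B x (f x) (G k x - g x) + B x (F k x - f x) (g x)" for x
      using bil[of x] by (simp add: bounded_bilinear.diff_left bounded_bilinear.diff_right)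
    have i: "integrable M (\<lambda>x. norm (F k x - f x) * norm (G k x - g x))" "integrable M (\<lambda>x. norm (f x) * norm (G k x - g x))"
      "integrable M (\<lambda>x. norm (g x) * norm (F k x - f x))" by (intro sqint_prod_integrable sq sqd)+
    have "(LINT x|M. B x (F k x) (G k x)) - (LINT x|M. B x (f x) (g x)) = (LINT x|M. B x (F k x) (G k x) - B x (f x) (g x))"
      by (rule Bochner_Integration.integral_diff[symmetric]) (intro int sq)+
    also have "norm \<dots> \<le> (LINT x|M. C * (norm (F k x - f x) * norm (G k x - g x) + norm (f x) * norm (G k x - g x)
        + norm (g x) * norm (F k x - f x)))"
    proof (rule order_trans[OF integral_norm_bound integral_mono[OF integrable_norm]])
      show "integrable M (\<lambda>x. B x (F k x) (G k x) - B x (f x) (g x))" by (intro Bochner_Integration.integrable_diff int sq)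
      show "integrable M (\<lambda>x. C * (norm (F k x - f x) * norm (G k x - g x) + norm (f x) * norm (G k x - g x)
        + norm (g x) * norm (F k x - f x)))" using i by auto
      fix x
      show "norm (B x (F k x) (G k x) - B x (f x) (g x)) \<le> C * (norm (F k x - f x) * norm (G k x - g x) + norm (f x) * norm (G k x - g x)
        + norm (g x) * norm (F k x - f x))"
        unfolding e using bound[of x "F k x - f x" "G k x - g x"] bound[of x "f x" "G k x - g x"] bound[of x "F k x - f x" "g x"]
        by (simp add: distrib_left mult.commute[of "norm (g x)"])
    qed
    also have "\<dots> = C * d k" using i by (simp add: d_def)
    finally show ?thesis .
  qed
  have "(\<lambda>k. C * d k) \<longlonglongrightarrow> C * (0 + 0 + 0)"
  proof -
    have "(\<lambda>k. LINT x|M. norm (F k x - f x) * norm (G k x - g x)) \<longlonglongrightarrow> 0"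
    proof (rule tendsto_sandwich[OF _ _ tendsto_const])
      show "(\<lambda>k. (LINT x|M. (norm (F k x - f x))\<^sup>2) + (LINT x|M. (norm (G k x - g x))\<^sup>2)) \<longlonglongrightarrow> 0"
        using F G by (auto simp: L2conv_def intro: tendsto_add_zero)
      have "(LINT x|M. norm (F k x - f x) * norm (G k x - g x)) \<le> (LINT x|M. (norm (F k x - f x))\<^sup>2 + (norm (G k x - g x))\<^sup>2)" for k
      proof (rule integral_mono[OF sqint_prod_integrable[OF sqd]])
        show "integrable M (\<lambda>x. (norm (F k x - f x))\<^sup>2 + (norm (G k x - g x))\<^sup>2)" using sqd by (auto simp: sqint_def)
        fix x show "norm (F k x - f x) * norm (G k x - g x) \<le> (norm (F k x - f x))\<^sup>2 + (norm (G k x - g x))\<^sup>2"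
          using sum_squares_bound[of "norm (F k x - f x)" "norm (G k x - g x)"]
            mult_nonneg_nonneg[OF norm_ge_zero[of "F k x - f x"] norm_ge_zero[of "G k x - g x"]] by linarith
      qed
      then show "\<forall>\<^sub>F k in sequentially. (LINT x|M. norm (F k x - f x) * norm (G k x - g x)) \<le> (LINT x|M. (norm (F k x - f x))\<^sup>2) + (LINT x|M. (norm (G k x - g x))\<^sup>2)"
        using sqd by (simp add: sqint_def)
    qed (auto intro!: always_eventually integral_nonneg_AE)
    then show ?thesis unfolding d_def using F G
      by (intro tendsto_mult tendsto_add tendsto_const L2_prod_tendsto_0 sq sqd) (auto simp: L2conv_def)
  qed
  then have "(\<lambda>k. C * d k) \<longlonglongrightarrow> 0" by simp
  then have "(\<lambda>k. (LINT x|M. B x (F k x) (G k x)) - (LINT x|M. B x (f x) (g x))) \<longlonglongrightarrow> 0"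
    by (rule Lim_null_comparison[rotated]) (intro always_eventually allI bd)
  then show ?thesis by (rule LIM_zero_cancel)
qed

lemma test_sqint:
  assumes "open \<Omega>" "\<phi> \<in> test_functions UNIV"
  shows "sqint (lebesgue_on \<Omega>) \<phi>" "sqint (lebesgue_on \<Omega>) (grad \<phi>)"
proof -
  have s: "smooth \<phi>" using assms(2) test_smooth by blast
  obtain K where K: "compact K" "\<forall>x. x \<notin> K \<longrightarrow> \<phi> x = 0 \<and> grad \<phi> x = 0" using test_support[OF assms(2)] by blast
  have [measurable]: "\<Omega> \<in> sets borel" using assms by simp
  have *: "sqint (lebesgue_on \<Omega>) f" if c: "continuous_on UNIV f" and z: "\<And>x. x \<notin> K \<Longrightarrow> f x = 0" for f :: "'a \<Rightarrow> 'c::euclidean_space"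
  proof -
    have c2: "continuous_on UNIV (\<lambda>x. (norm (f x))\<^sup>2)" by (intro continuous_intros c)
    have "integrable lborel (\<lambda>x. (norm (f x))\<^sup>2)" by (rule compact_support_integrable[OF c2 K(1)]) (simp add: z)
    then have "integrable lborel (\<lambda>x. indicator \<Omega> x *\<^sub>R (norm (f x))\<^sup>2)" by (intro integrable_mult_indicator) auto
    then have "integrable (lebesgue_on \<Omega>) (\<lambda>x. (norm (f x))\<^sup>2)"
      by (subst lebesgue_on_lborel(2)[OF assms(1) borel_of_continuous[OF c2]])
    then show ?thesis using borel_of_continuous[OF c] by (simp add: sqint_def measurable_restrict_space1 measurable_completion)
  qed
  show "sqint (lebesgue_on \<Omega>) \<phi>" "sqint (lebesgue_on \<Omega>) (grad \<phi>)"
    using K s by (auto intro!: * smooth_continuous continuous_grad)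
qed

lemma weak_gradient_sqint:
  assumes "open \<Omega>" "has_weak_gradient \<Omega> u g" "sqint (lebesgue_on \<Omega>) g"
  shows "sqint (lebesgue_on \<Omega>) (weak_gradient \<Omega> u)"
proof -
  have ae: "AE x in lebesgue_on \<Omega>. weak_gradient \<Omega> u x = g x" by (rule weak_gradient_AE[OF assms(1,2)])
  have m: "weak_gradient \<Omega> u \<in> borel_measurable (lebesgue_on \<Omega>)"
    by (rule measurable_lebesgue_on_AE[of _ g])
      (use assms(1,3) ae in \<open>auto simp: sqint_def open_in_lebesgue elim!: eventually_mono\<close>)
  have mg: "g \<in> borel_measurable (lebesgue_on \<Omega>)" using assms(3) by (simp add: sqint_def)
  have "integrable (lebesgue_on \<Omega>) (\<lambda>x. (norm (weak_gradient \<Omega> u x))\<^sup>2) \<longleftrightarrow> integrable (lebesgue_on \<Omega>) (\<lambda>x. (norm (g x))\<^sup>2)"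
    by (rule integrable_cong_AE) (use m mg ae in \<open>auto elim!: eventually_mono\<close>)
  then show ?thesis using m assms(3) by (simp add: sqint_def)
qed

text \<open>The norm in the closure involves the chosen weak gradient of u - phi; by uniqueness it
  equals the weak gradient of u minus the classical gradient of phi almost everywhere, so
  convergence in norm splits into two L2 convergences.\<close>

lemma H1_closure_approx:
  assumes \<Omega>: "open \<Omega>" and S: "S \<subseteq> test_functions UNIV" and u: "u \<in> H1_closure \<Omega> S"
  shows "\<exists>\<phi>. (\<forall>k. \<phi> k \<in> S) \<and> L2conv (lebesgue_on \<Omega>) \<phi> u \<and> L2conv (lebesgue_on \<Omega>) (\<lambda>k. grad (\<phi> k)) (weak_gradient \<Omega> u)"
proof -
  let ?M = "lebesgue_on \<Omega>"
  obtain g where g: "sqint ?M u" "sqint ?M g" "has_weak_gradient \<Omega> u g"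
    using u by (auto simp: H1_closure_def H1_def L2_sqint)
  obtain \<phi> where \<phi>: "\<And>k. \<phi> k \<in> S" and lim: "(\<lambda>k. H1_norm \<Omega> (\<lambda>x. u x - \<phi> k x)) \<longlonglongrightarrow> 0"
    using u by (auto simp: H1_closure_def)
  have w: "sqint ?M (weak_gradient \<Omega> u)" by (rule weak_gradient_sqint[OF \<Omega> g(3,2)])
  have t: "\<phi> k \<in> test_functions UNIV" for k using \<phi> S by auto
  have ts: "sqint ?M (\<phi> k)" "sqint ?M (grad (\<phi> k))" for k using test_sqint[OF \<Omega> t] by auto
  define a where "a k = (LINT x|?M. (norm (\<phi> k x - u x))\<^sup>2)" for k
  define b where "b k = (LINT x|?M. (norm (grad (\<phi> k) x - weak_gradient \<Omega> u x))\<^sup>2)" for k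
  have "H1_norm \<Omega> (\<lambda>x. u x - \<phi> k x) = sqrt (a k + b k)" for k
  proof -
    have hw: "has_weak_gradient \<Omega> (\<lambda>x. u x - \<phi> k x) (\<lambda>x. weak_gradient \<Omega> u x - grad (\<phi> k) x)"
      by (rule has_weak_gradient_diff[OF \<Omega> weak_gradient_AE(2)[OF \<Omega> g(3)] smooth_has_weak_gradient[OF \<Omega> test_smooth[OF t]]])
    have sd: "sqint ?M (\<lambda>x. weak_gradient \<Omega> u x - grad (\<phi> k) x)" by (rule sqint_diff[OF w ts(2)])
    have "(LINT x|?M. (norm (weak_gradient \<Omega> (\<lambda>x. u x - \<phi> k x) x))\<^sup>2) = (LINT x|?M. (norm (weak_gradient \<Omega> u x - grad (\<phi> k) x))\<^sup>2)"
      by (rule integral_cong_AE)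
        (use weak_gradient_AE(1)[OF \<Omega> hw] sd weak_gradient_sqint[OF \<Omega> hw sd] in \<open>auto simp: sqint_def elim!: eventually_mono\<close>)
    then show ?thesis by (simp add: H1_norm_def a_def b_def norm_minus_commute power2_commute)
  qed
  then have "(\<lambda>k. (sqrt (a k + b k))\<^sup>2) \<longlonglongrightarrow> 0\<^sup>2" using lim by (intro tendsto_power) simp
  moreover have nn: "a k \<ge> 0" "b k \<ge> 0" for k by (auto simp: a_def b_def)
  ultimately have s: "(\<lambda>k. a k + b k) \<longlonglongrightarrow> 0" by simp
  have "a \<longlonglongrightarrow> 0" "b \<longlonglongrightarrow> 0"
    by (rule tendsto_sandwich[OF _ _ tendsto_const s]; simp add: nn)+
  then show ?thesis using g(1) w ts \<phi> by (intro exI[of _ \<phi>]) (auto simp: L2conv_def a_def[abs_def] b_def[abs_def])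
qed

text \<open>Linearity and the bound are imposed at every point, so that each (u, v) \<mapsto>
  \<open>A x u \<bullet> v\<close> is a bounded bilinear form. Measurability is phrased as
  preservation of measurable fields, which is exactly what the integrands of energies
  require.\<close>

definition bounded_op :: "'a::euclidean_space set \<Rightarrow> real \<Rightarrow> ('a \<Rightarrow> 'a \<Rightarrow> 'a) \<Rightarrow> bool" where
  "bounded_op \<Omega> C A \<longleftrightarrow> (\<forall>x. linear (A x)) \<and> (\<forall>x \<xi>. norm (A x \<xi>) \<le> C * norm \<xi>) \<and>
     (\<forall>f\<in>borel_measurable (lebesgue_on \<Omega>). (\<lambda>x. A x (f x)) \<in> borel_measurable (lebesgue_on \<Omega>))"

lemma bounded_op_bilinear:
  assumes "bounded_op \<Omega> C A"
  shows "bounded_bilinear (\<lambda>u v. A x u \<bullet> v)" "\<bar>A x u \<bullet> v\<bar> \<le> C * (norm u * norm v)"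
    "f \<in> borel_measurable (lebesgue_on \<Omega>) \<Longrightarrow> g \<in> borel_measurable (lebesgue_on \<Omega>) \<Longrightarrow>
      (\<lambda>x. A x (f x) \<bullet> g x) \<in> borel_measurable (lebesgue_on \<Omega>)"
proof -
  interpret linear "A x" using assms by (simp add: bounded_op_def)
  show b: "\<bar>A x u \<bullet> v\<bar> \<le> C * (norm u * norm v)" for u v
  proof -
    have "\<bar>A x u \<bullet> v\<bar> \<le> norm (A x u) * norm v" by (rule Cauchy_Schwarz_ineq2)
    also have "\<dots> \<le> (C * norm u) * norm v" using assms by (intro mult_right_mono) (auto simp: bounded_op_def)
    finally show ?thesis by (simp add: mult.assoc)
  qed
  show "bounded_bilinear (\<lambda>u v. A x u \<bullet> v)"
    by standard (use b in \<open>auto simp: add scale inner_add_left inner_add_right mult_ac intro!: exI[of _ C]\<close>)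
  show "f \<in> borel_measurable (lebesgue_on \<Omega>) \<Longrightarrow> g \<in> borel_measurable (lebesgue_on \<Omega>) \<Longrightarrow>
      (\<lambda>x. A x (f x) \<bullet> g x) \<in> borel_measurable (lebesgue_on \<Omega>)"
    using assms by (auto simp: bounded_op_def)
qed

section \<open>Energies on closures of test functions\<close>

lemma energy_eqI:
  assumes "open \<Omega>" "bounded_op \<Omega> C A" "has_weak_gradient \<Omega> u g" "sqint (lebesgue_on \<Omega>) g"
  shows "energy \<Omega> A u = (LINT x|lebesgue_on \<Omega>. A x (g x) \<bullet> g x)"
  unfolding energy_def
proof (rule integral_cong_AE)
  show "AE x in lebesgue_on \<Omega>. A x (weak_gradient \<Omega> u x) \<bullet> weak_gradient \<Omega> u x = A x (g x) \<bullet> g x"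
    using weak_gradient_AE(1)[OF assms(1,3)] by eventually_elim simp
qed (use weak_gradient_sqint[OF assms(1,3,4)] assms in \<open>auto simp: sqint_def intro!: bounded_op_bilinear(3)[OF assms(2)]\<close>)

lemma energy_smooth:
  assumes "open \<Omega>" "bounded_op \<Omega> C A" "\<phi> \<in> test_functions UNIV"
  shows "energy \<Omega> A \<phi> = (LINT x|lebesgue_on \<Omega>. A x (grad \<phi> x) \<bullet> grad \<phi> x)"
  by (rule energy_eqI[OF assms(1,2) smooth_has_weak_gradient[OF assms(1) test_smooth[OF assms(3)]] test_sqint(2)[OF assms(1,3)]])

lemma test_in_closure:
  assumes \<Omega>: "open \<Omega>" and S: "S \<subseteq> test_functions UNIV" and \<phi>: "\<phi> \<in> S"
  shows "\<phi> \<in> H1_closure \<Omega> S"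
proof -
  have t: "\<phi> \<in> test_functions UNIV" using S \<phi> by auto
  note s = test_sqint[OF \<Omega> t] smooth_has_weak_gradient[OF \<Omega> test_smooth[OF t]]
  have 0: "(\<lambda>x::'a. 0::real) \<in> test_functions UNIV" by (rule test_zero)
  have hw: "has_weak_gradient \<Omega> (\<lambda>x. 0) (grad (\<lambda>x::'a. 0))"
    by (rule smooth_has_weak_gradient[OF \<Omega> test_smooth[OF 0]])
  have "(LINT x|lebesgue_on \<Omega>. (norm (weak_gradient \<Omega> (\<lambda>x. 0) x))\<^sup>2) = (LINT x|lebesgue_on \<Omega>. (norm (grad (\<lambda>x::'a. 0) x))\<^sup>2)"
    by (rule integral_cong_AE)
      (use weak_gradient_AE(1)[OF \<Omega> hw] test_sqint[OF \<Omega> 0] weak_gradient_sqint[OF \<Omega> hw test_sqint(2)[OF \<Omega> 0]] in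
        \<open>auto simp: sqint_def elim!: eventually_mono\<close>)
  then have "H1_norm \<Omega> (\<lambda>x. 0) = 0" by (simp add: H1_norm_def)
  then show ?thesis using s \<phi> by (auto simp: H1_closure_def H1_def L2_sqint intro!: exI[of _ "\<lambda>_. \<phi>"])
qed

lemma closure_lower_bound:
  assumes \<Omega>: "open \<Omega>" and S: "S \<subseteq> test_functions UNIV" and A: "bounded_op \<Omega> C A"
    and le: "\<And>\<phi>. \<phi> \<in> S \<Longrightarrow> c * (LINT x|lebesgue_on \<Omega>. (\<phi> x)\<^sup>2) \<le> (LINT x|lebesgue_on \<Omega>. A x (grad \<phi> x) \<bullet> grad \<phi> x)"
    and u: "u \<in> H1_closure \<Omega> S"
  shows "c * (LINT x|lebesgue_on \<Omega>. (u x)\<^sup>2) \<le> energy \<Omega> A u"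
proof -
  obtain \<phi> where \<phi>: "\<forall>k. \<phi> k \<in> S" "L2conv (lebesgue_on \<Omega>) \<phi> u"
    "L2conv (lebesgue_on \<Omega>) (\<lambda>k. grad (\<phi> k)) (weak_gradient \<Omega> u)"
    using H1_closure_approx[OF \<Omega> S u] by blast
  have 1: "(\<lambda>k. LINT x|lebesgue_on \<Omega>. A x (grad (\<phi> k) x) \<bullet> grad (\<phi> k) x) \<longlonglongrightarrow> energy \<Omega> A u"
    unfolding energy_def by (rule L2conv_bilinear[OF bounded_op_bilinear[OF A] \<phi>(3,3)])
  have "(\<lambda>k. LINT x|lebesgue_on \<Omega>. \<phi> k x * \<phi> k x) \<longlonglongrightarrow> (LINT x|lebesgue_on \<Omega>. u x * u x)"
    by (rule L2conv_bilinear[where C=1, OF bounded_bilinear_mult _ _ \<phi>(2,2)]) (auto simp: abs_mult)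
  then have 2: "(\<lambda>k. c * (LINT x|lebesgue_on \<Omega>. (\<phi> k x)\<^sup>2)) \<longlonglongrightarrow> c * (LINT x|lebesgue_on \<Omega>. (u x)\<^sup>2)"
    by (intro tendsto_mult tendsto_const) (simp add: power2_eq_square)
  show ?thesis by (rule LIMSEQ_le[OF 2 1]) (use le \<phi>(1) in blast)
qed

section \<open>Rayleigh quotients on the cylinder\<close>

text \<open>If every test function vanished almost everywhere, the constant 1 would be orthogonal to
  all of them, and the fundamental lemma would make \<Omega> a null set.\<close>

lemma exists_test_nonzero:
  fixes \<Omega> :: "'a::euclidean_space set"
  assumes \<Omega>: "open \<Omega>" "\<Omega> \<noteq> {}"
  shows "\<exists>\<phi>\<in>test_functions \<Omega>. (LINT x|lebesgue_on \<Omega>. (\<phi> x)\<^sup>2) > 0"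
proof (rule ccontr)
  assume neg: "\<not> ?thesis"
  have "AE x in lebesgue_on \<Omega>. (1::real) = 0"
  proof (rule fundamental_lemma[OF \<Omega>(1)])
    show "locally_integrable \<Omega> (\<lambda>x. 1::real)" by (rule locally_integrable_continuous) auto
    fix \<phi> assume t: "\<phi> \<in> test_functions \<Omega>"
    have s: "sqint (lebesgue_on \<Omega>) \<phi>" by (rule test_sqint(1)[OF \<Omega>(1) test_mono[OF t]]) simp
    have "(LINT x|lebesgue_on \<Omega>. (\<phi> x)\<^sup>2) \<ge> 0" by simp
    moreover have "\<not> (LINT x|lebesgue_on \<Omega>. (\<phi> x)\<^sup>2) > 0" using neg t by blast
    ultimately have "(LINT x|lebesgue_on \<Omega>. (\<phi> x)\<^sup>2) = 0" by linarith
    then have "AE x in lebesgue_on \<Omega>. (\<phi> x)\<^sup>2 = 0"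
      using s by (subst (asm) integral_nonneg_eq_0_iff_AE) (simp_all add: sqint_def)
    then have "AE x in lebesgue_on \<Omega>. 1 * \<phi> x = 0" by eventually_elim simp
    then show "(LINT x|lebesgue_on \<Omega>. 1 * \<phi> x) = 0" by (rule integral_eq_zero_AE)
  qed
  then have "AE x in lebesgue. x \<notin> \<Omega>" using \<Omega> by (simp add: AE_restrict_space_iff open_in_lebesgue)
  then have "\<Omega> \<in> null_sets lebesgue" using \<Omega> by (simp add: completion.null_sets_iff_AE)
  then show False using open_not_negligible[OF \<Omega>] negligible_iff_null_sets by blast
qed

lemma form_scale:
  fixes \<phi> :: "'a::euclidean_space \<Rightarrow> real"
  assumes "bounded_op \<Omega> C A" "smooth \<phi>"
  shows "(LINT x|lebesgue_on \<Omega>. A x (grad (\<lambda>x. c * \<phi> x) x) \<bullet> grad (\<lambda>x. c * \<phi> x) x)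
    = c\<^sup>2 * (LINT x|lebesgue_on \<Omega>. A x (grad \<phi> x) \<bullet> grad \<phi> x)"
proof -
  have "A x (c *\<^sub>R v) = c *\<^sub>R A x v" for x v using assms(1) by (simp add: bounded_op_def linear_scale)
  then show ?thesis using assms(2) by (simp add: grad_scale power2_eq_square mult.assoc)
qed

text \<open>The two halves identify the infimum with the best constant for test functions. The first
  normalises a test function to unit norm, hence the closure of \<open>S\<close> under scaling; if
  its norm is zero, nonnegativity of the form suffices. The second transfers an inequality from
  \<open>S\<close> to its closure.\<close>

lemma rayleigh_inf:
  fixes A :: "'a::euclidean_space \<Rightarrow> 'a \<Rightarrow> 'a"
  assumes \<Omega>: "open \<Omega>" and A: "bounded_op \<Omega> C A" and pos: "\<And>x \<xi>. A x \<xi> \<bullet> \<xi> \<ge> 0"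
    and S: "S \<subseteq> test_functions UNIV" and sc: "\<And>c \<phi>. \<phi> \<in> S \<Longrightarrow> (\<lambda>x. c * \<phi> x) \<in> S"
    and ex: "\<exists>\<phi>\<in>S. (LINT x|lebesgue_on \<Omega>. (\<phi> x)\<^sup>2) > 0"
    and m: "m = Inf {energy \<Omega> A u | u. u \<in> H1_closure \<Omega> S \<and> (LINT x|lebesgue_on \<Omega>. (u x)\<^sup>2) = 1}"
  shows "\<phi> \<in> S \<Longrightarrow> m * (LINT x|lebesgue_on \<Omega>. (\<phi> x)\<^sup>2) \<le> (LINT x|lebesgue_on \<Omega>. A x (grad \<phi> x) \<bullet> grad \<phi> x)"
    and "(\<And>\<phi>. \<phi> \<in> S \<Longrightarrow> c * (LINT x|lebesgue_on \<Omega>. (\<phi> x)\<^sup>2) \<le> (LINT x|lebesgue_on \<Omega>. A x (grad \<phi> x) \<bullet> grad \<phi> x)) \<Longrightarrow> c \<le> m"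
proof -
  let ?E = "{energy \<Omega> A u | u. u \<in> H1_closure \<Omega> S \<and> (LINT x|lebesgue_on \<Omega>. (u x)\<^sup>2) = 1}"
  have bdd: "bdd_below ?E" by (rule bdd_belowI[of _ 0]) (auto simp: energy_def pos intro!: integral_nonneg_AE)
  have norm: "\<exists>d. (\<lambda>x. d * \<phi> x) \<in> S \<and> (LINT x|lebesgue_on \<Omega>. (d * \<phi> x)\<^sup>2) = 1 \<and>
      energy \<Omega> A (\<lambda>x. d * \<phi> x) \<in> ?E \<and>
      energy \<Omega> A (\<lambda>x. d * \<phi> x) = (LINT x|lebesgue_on \<Omega>. A x (grad \<phi> x) \<bullet> grad \<phi> x) / (LINT x|lebesgue_on \<Omega>. (\<phi> x)\<^sup>2)"
    if "\<phi> \<in> S" "(LINT x|lebesgue_on \<Omega>. (\<phi> x)\<^sup>2) > 0" for \<phi>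
  proof -
    define I where "I = (LINT x|lebesgue_on \<Omega>. (\<phi> x)\<^sup>2)"
    define d where "d = 1 / sqrt I"
    have d2: "d\<^sup>2 = 1 / I" using that(2) by (simp add: d_def I_def power_divide)
    have dS: "(\<lambda>x. d * \<phi> x) \<in> S" by (rule sc[OF that(1)])
    have n1: "(LINT x|lebesgue_on \<Omega>. (d * \<phi> x)\<^sup>2) = 1"
      using that(2) by (simp add: power_mult_distrib d2) (simp add: I_def)
    have cl: "(\<lambda>x. d * \<phi> x) \<in> H1_closure \<Omega> S" by (rule test_in_closure[OF \<Omega> S dS])
    have "energy \<Omega> A (\<lambda>x. d * \<phi> x) = d\<^sup>2 * (LINT x|lebesgue_on \<Omega>. A x (grad \<phi> x) \<bullet> grad \<phi> x)"
      unfolding energy_smooth[OF \<Omega> A subsetD[OF S dS]] by (rule form_scale[OF A test_smooth[OF subsetD[OF S that(1)]]])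
    moreover have "energy \<Omega> A (\<lambda>x. d * \<phi> x) \<in> ?E" using cl n1 by blast
    ultimately show ?thesis using dS n1 by (intro exI[of _ d] conjI) (auto simp: d2 I_def)
  qed
  show "m * (LINT x|lebesgue_on \<Omega>. (\<phi> x)\<^sup>2) \<le> (LINT x|lebesgue_on \<Omega>. A x (grad \<phi> x) \<bullet> grad \<phi> x)" if \<phi>: "\<phi> \<in> S"
  proof (cases "(LINT x|lebesgue_on \<Omega>. (\<phi> x)\<^sup>2) > 0")
    case True
    obtain d where d: "energy \<Omega> A (\<lambda>x. d * \<phi> x) \<in> ?E"
      "energy \<Omega> A (\<lambda>x. d * \<phi> x) = (LINT x|lebesgue_on \<Omega>. A x (grad \<phi> x) \<bullet> grad \<phi> x) / (LINT x|lebesgue_on \<Omega>. (\<phi> x)\<^sup>2)"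
      using norm[OF \<phi> True] by blast
    have "m \<le> energy \<Omega> A (\<lambda>x. d * \<phi> x)" unfolding m by (rule cInf_lower[OF d(1) bdd])
    then show ?thesis using True d(2) by (simp add: field_simps)
  next
    case False
    moreover have "(LINT x|lebesgue_on \<Omega>. (\<phi> x)\<^sup>2) \<ge> 0" by simp
    ultimately have "(LINT x|lebesgue_on \<Omega>. (\<phi> x)\<^sup>2) = 0" by linarith
    moreover have "(LINT x|lebesgue_on \<Omega>. A x (grad \<phi> x) \<bullet> grad \<phi> x) \<ge> 0" by (simp add: pos)
    ultimately show ?thesis by simp
  qed
  show "c \<le> m" if le: "\<And>\<phi>. \<phi> \<in> S \<Longrightarrow> c * (LINT x|lebesgue_on \<Omega>. (\<phi> x)\<^sup>2) \<le> (LINT x|lebesgue_on \<Omega>. A x (grad \<phi> x) \<bullet> grad \<phi> x)"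
    unfolding m
  proof (rule cInf_greatest)
    obtain \<phi> where "\<phi> \<in> S" "(LINT x|lebesgue_on \<Omega>. (\<phi> x)\<^sup>2) > 0" using ex by blast
    then show "?E \<noteq> {}" using norm by blast
    fix e assume "e \<in> ?E"
    then obtain u where u: "e = energy \<Omega> A u" "u \<in> H1_closure \<Omega> S" "(LINT x|lebesgue_on \<Omega>. (u x)\<^sup>2) = 1" by blast
    show "c \<le> e" using closure_lower_bound[OF \<Omega> S A le u(2)] u by simp
  qed
qed

text \<open>The counterpart for quotients, as in \<open>nu\<close>. For a square-integrable
  function, not vanishing almost everywhere means that the denominator is positive.\<close>

lemma rayleigh_quotient_inf:
  fixes A :: "'a::euclidean_space \<Rightarrow> 'a \<Rightarrow> 'a"
  assumes \<Omega>: "open \<Omega>" and A: "bounded_op \<Omega> C A" and pos: "\<And>x \<xi>. A x \<xi> \<bullet> \<xi> \<ge> 0"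
    and S: "S \<subseteq> test_functions UNIV"
    and ex: "\<exists>\<phi>\<in>S. (LINT x|lebesgue_on \<Omega>. (\<phi> x)\<^sup>2) > 0"
    and m: "m = Inf {energy \<Omega> A u / (LINT x|lebesgue_on \<Omega>. (u x)\<^sup>2) | u. u \<in> H1_closure \<Omega> S \<and> \<not> (AE x in lebesgue_on \<Omega>. u x = 0)}"
  shows "\<phi> \<in> S \<Longrightarrow> m * (LINT x|lebesgue_on \<Omega>. (\<phi> x)\<^sup>2) \<le> (LINT x|lebesgue_on \<Omega>. A x (grad \<phi> x) \<bullet> grad \<phi> x)"
    and "(\<And>\<phi>. \<phi> \<in> S \<Longrightarrow> c * (LINT x|lebesgue_on \<Omega>. (\<phi> x)\<^sup>2) \<le> (LINT x|lebesgue_on \<Omega>. A x (grad \<phi> x) \<bullet> grad \<phi> x)) \<Longrightarrow> c \<le> m"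
proof -
  let ?E = "{energy \<Omega> A u / (LINT x|lebesgue_on \<Omega>. (u x)\<^sup>2) | u. u \<in> H1_closure \<Omega> S \<and> \<not> (AE x in lebesgue_on \<Omega>. u x = 0)}"
  have bdd: "bdd_below ?E" by (rule bdd_belowI[of _ 0]) (auto simp: energy_def pos intro!: integral_nonneg_AE divide_nonneg_nonneg)
  have el: "energy \<Omega> A \<phi> / (LINT x|lebesgue_on \<Omega>. (\<phi> x)\<^sup>2) \<in> ?E"
    if "\<phi> \<in> S" "(LINT x|lebesgue_on \<Omega>. (\<phi> x)\<^sup>2) > 0" for \<phi>
  proof -
    have "\<not> (AE x in lebesgue_on \<Omega>. \<phi> x = 0)"
    proof
      assume "AE x in lebesgue_on \<Omega>. \<phi> x = 0"
      then have "AE x in lebesgue_on \<Omega>. (\<phi> x)\<^sup>2 = 0" by eventually_elim simp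
      then have "(LINT x|lebesgue_on \<Omega>. (\<phi> x)\<^sup>2) = 0" by (rule integral_eq_zero_AE)
      then show False using that(2) by simp
    qed
    then show ?thesis using test_in_closure[OF \<Omega> S that(1)] by blast
  qed
  show "m * (LINT x|lebesgue_on \<Omega>. (\<phi> x)\<^sup>2) \<le> (LINT x|lebesgue_on \<Omega>. A x (grad \<phi> x) \<bullet> grad \<phi> x)" if \<phi>: "\<phi> \<in> S"
  proof (cases "(LINT x|lebesgue_on \<Omega>. (\<phi> x)\<^sup>2) > 0")
    case True
    have "m \<le> energy \<Omega> A \<phi> / (LINT x|lebesgue_on \<Omega>. (\<phi> x)\<^sup>2)" unfolding m by (rule cInf_lower[OF el[OF \<phi> True] bdd])
    moreover have "energy \<Omega> A \<phi> = (LINT x|lebesgue_on \<Omega>. A x (grad \<phi> x) \<bullet> grad \<phi> x)"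
      by (rule energy_smooth[OF \<Omega> A]) (use \<phi> S in blast)
    ultimately show ?thesis using True by (simp add: field_simps)
  next
    case False
    moreover have "(LINT x|lebesgue_on \<Omega>. (\<phi> x)\<^sup>2) \<ge> 0" by simp
    ultimately have "(LINT x|lebesgue_on \<Omega>. (\<phi> x)\<^sup>2) = 0" by linarith
    moreover have "(LINT x|lebesgue_on \<Omega>. A x (grad \<phi> x) \<bullet> grad \<phi> x) \<ge> 0" by (simp add: pos)
    ultimately show ?thesis by simp
  qed
  show "c \<le> m" if le: "\<And>\<phi>. \<phi> \<in> S \<Longrightarrow> c * (LINT x|lebesgue_on \<Omega>. (\<phi> x)\<^sup>2) \<le> (LINT x|lebesgue_on \<Omega>. A x (grad \<phi> x) \<bullet> grad \<phi> x)"
    unfolding m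
  proof (rule cInf_greatest)
    obtain \<phi> where "\<phi> \<in> S" "(LINT x|lebesgue_on \<Omega>. (\<phi> x)\<^sup>2) > 0" using ex by blast
    then show "?E \<noteq> {}" using el by blast
    fix e assume "e \<in> ?E"
    then obtain u where u: "e = energy \<Omega> A u / (LINT x|lebesgue_on \<Omega>. (u x)\<^sup>2)" "u \<in> H1_closure \<Omega> S"
      "\<not> (AE x in lebesgue_on \<Omega>. u x = 0)" by blast
    have s: "sqint (lebesgue_on \<Omega>) u" using u(2) by (auto simp: H1_closure_def H1_def L2_sqint)
    have "(LINT x|lebesgue_on \<Omega>. (u x)\<^sup>2) \<noteq> 0"
    proof
      assume "(LINT x|lebesgue_on \<Omega>. (u x)\<^sup>2) = 0"
      then have "AE x in lebesgue_on \<Omega>. (u x)\<^sup>2 = 0"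
        using s by (subst (asm) integral_nonneg_eq_0_iff_AE) (simp_all add: sqint_def)
      then have "AE x in lebesgue_on \<Omega>. u x = 0" by eventually_elim simp
      then show False using u(3) by blast
    qed
    moreover have "(LINT x|lebesgue_on \<Omega>. (u x)\<^sup>2) \<ge> 0" by simp
    ultimately have "(LINT x|lebesgue_on \<Omega>. (u x)\<^sup>2) > 0" by linarith
    then show "c \<le> e" unfolding u(1) using closure_lower_bound[OF \<Omega> S A le u(2)] by (simp add: pos_le_divide_eq)
  qed
qed

section \<open>The cylinder with Borel coefficients\<close>

lemma borel_measurable_matrix_vector:
  fixes M :: "'a \<Rightarrow> real^'n^'m" and v :: "'a \<Rightarrow> real^'n"
  assumes "M \<in> borel_measurable N" "v \<in> borel_measurable N"
  shows "(\<lambda>x. M x *v v x) \<in> borel_measurable N"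
proof (rule borel_measurable_continuous_Pair[OF assms])
  show "continuous_on UNIV (\<lambda>x::(real^'n^'m) \<times> (real^'n). fst x *v snd x)"
    unfolding matrix_vector_mult_def by (intro continuous_intros)
qed

text \<open>The coefficients are Borel on the whole space and satisfy the bound and ellipticity at
  every point; the general case is brought into this form at the end by a change on a null set.
  Pointwise inequalities between integrands then hold without exceptions, also on every single
  slice.\<close>

locale cylinder =
  fixes \<omega> :: "(real^'n) set" and a :: "real^'n \<Rightarrow> real" and b :: "real^'n \<Rightarrow> real^'n"
    and M :: "real^'n \<Rightarrow> real^'n^'n" and C lam :: real
  assumes open_\<omega>: "open \<omega>" and ne: "\<omega> \<noteq> {}" and bdd: "bounded \<omega>"
    and meas: "a \<in> borel_measurable borel" "b \<in> borel_measurable borel" "M \<in> borel_measurable borel"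
    and sym: "\<And>X. transpose (M X) = M X"
    and bound: "\<And>X \<xi>. norm (block_op (a X) (b X) (M X) \<xi>) \<le> C * norm \<xi>"
    and ell: "\<And>X \<xi>. lam * (norm \<xi>)\<^sup>2 \<le> block_op (a X) (b X) (M X) \<xi> \<bullet> \<xi>"
    and lam: "lam > 0"
begin

abbreviation T where "T \<equiv> test_functions (UNIV \<times> \<omega> :: (real \<times> (real^'n)) set)"
abbreviation op where "op \<equiv> coeff_op a b M"

text \<open>The forms are written with an indicator over the Borel measure of the whole space, the
  setting in which translation and Fubini apply; \<open>form_cyl\<close> identifies them with the
  integrals over the open cylinder.\<close>

definition Q :: "real set \<Rightarrow> (real \<times> (real^'n) \<Rightarrow> real) \<Rightarrow> real" where
  "Q I \<phi> = (LINT x|lborel. indicator (I \<times> \<omega>) x * (op x (grad \<phi> x) \<bullet> grad \<phi> x))"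

definition N :: "real set \<Rightarrow> (real \<times> (real^'n) \<Rightarrow> real) \<Rightarrow> real" where
  "N I \<phi> = (LINT x|lborel. indicator (I \<times> \<omega>) x * (\<phi> x)\<^sup>2)"

lemma linear_op: "linear (op x)"
  by (auto simp: linear_iff coeff_op_def block_op_def inner_add_right algebra_simps matrix_vector_right_distrib matrix_vector_mult_scaleR)

lemma op_pos: "0 \<le> op x \<xi> \<bullet> \<xi>"
  using ell[of \<xi> "snd x"] lam by (auto simp: coeff_op_def intro: order_trans[rotated])

lemma op_inner: "op x \<xi> \<bullet> \<eta> = a (snd x) * (fst \<xi> * fst \<eta>) + (b (snd x) \<bullet> snd \<xi>) * fst \<eta>
    + fst \<xi> * (b (snd x) \<bullet> snd \<eta>) + (M (snd x) *v snd \<xi>) \<bullet> snd \<eta>"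
  by (simp add: coeff_op_def block_op_def inner_prod_def inner_add_left algebra_simps)

lemma M_sym: "(M X *v u) \<bullet> v = (M X *v v) \<bullet> u"
  using dot_lmul_matrix[of u "M X" v] sym[of X] by (metis inner_commute transpose_matrix_vector)

lemma op_sym: "op x \<xi> \<bullet> \<eta> = op x \<eta> \<bullet> \<xi>"
  unfolding op_inner using M_sym[of "snd x" "snd \<xi>" "snd \<eta>"] by (simp add: algebra_simps)

lemma open_cyl: "open I \<Longrightarrow> open (I \<times> \<omega>)" by (intro open_Times open_\<omega>)

lemma borel_snd:
  fixes f :: "real^'n \<Rightarrow> 'b::euclidean_space"
  shows "f \<in> borel_measurable borel \<Longrightarrow> (\<lambda>x::real \<times> (real^'n). f (snd x)) \<in> borel_measurable borel"
  by (rule measurable_compose[OF borel_measurable_continuous_onI]) (auto intro: continuous_intros)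

lemma borel_op:
  assumes f: "f \<in> borel_measurable L" and s: "(\<lambda>x. x) \<in> L \<rightarrow>\<^sub>M borel"
  shows "(\<lambda>x. op x (f x)) \<in> borel_measurable L"
proof -
  have 1: "(\<lambda>x. fst (f x)) \<in> borel_measurable L" "(\<lambda>x. snd (f x)) \<in> borel_measurable L"
    using f by (auto intro!: measurable_compose[OF f] borel_measurable_continuous_onI continuous_intros)
  have 2: "(\<lambda>x. a (snd x)) \<in> borel_measurable L" "(\<lambda>x. b (snd x)) \<in> borel_measurable L" "(\<lambda>x. M (snd x)) \<in> borel_measurable L"
    by (rule measurable_compose[OF s borel_snd[OF meas(1)]] measurable_compose[OF s borel_snd[OF meas(2)]]
        measurable_compose[OF s borel_snd[OF meas(3)]])+
  show ?thesis unfolding coeff_op_def block_op_def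
    by (intro borel_measurable_Pair borel_measurable_add borel_measurable_times borel_measurable_inner borel_measurable_scaleR
        borel_measurable_matrix_vector 1 2)
qed

lemma bounded_op_cyl: "bounded_op \<Omega> C op"
  unfolding bounded_op_def
proof (intro conjI allI ballI)
  show "norm (op x \<xi>) \<le> C * norm \<xi>" for x \<xi> by (simp add: coeff_op_def bound)
  fix f :: "real \<times> (real^'n) \<Rightarrow> real \<times> (real^'n)" assume "f \<in> borel_measurable (lebesgue_on \<Omega>)"
  then show "(\<lambda>x. op x (f x)) \<in> borel_measurable (lebesgue_on \<Omega>)"
    by (rule borel_op) (intro measurable_restrict_space1 measurable_completion, simp)
qed (rule linear_op)

lemma bounded_op_base: "bounded_op \<Omega> C (\<lambda>X. (*v) (M X))"
  unfolding bounded_op_def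
proof (intro conjI allI ballI)
  show "linear ((*v) (M x))" for x by (rule matrix_vector_mul_linear)
  show "norm (M x *v \<xi>) \<le> C * norm \<xi>" for x \<xi>
    using order_trans[OF norm_snd_le bound[of x "(0, \<xi>)", unfolded block_op_def]] by (simp add: norm_Pair)
  fix f :: "real^'n \<Rightarrow> real^'n" assume "f \<in> borel_measurable (lebesgue_on \<Omega>)"
  moreover have "M \<in> borel_measurable (lebesgue_on \<Omega>)"
    by (intro measurable_restrict_space1 measurable_completion) (simp add: meas)
  ultimately show "(\<lambda>x. M x *v f x) \<in> borel_measurable (lebesgue_on \<Omega>)"
    by (intro borel_measurable_matrix_vector)
qed

lemma M_pos: "0 \<le> (M X *v \<xi>) \<bullet> \<xi>"
  using op_pos[of "(0, X)" "(0, \<xi>)"] by (simp add: op_inner)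

lemma T_UNIV: "\<phi> \<in> T \<Longrightarrow> \<phi> \<in> test_functions UNIV" by (erule test_mono) simp

lemma form_cyl:
  assumes "open I" "\<phi> \<in> T"
  shows "(LINT x|lebesgue_on (I \<times> \<omega>). op x (grad \<phi> x) \<bullet> grad \<phi> x) = Q I \<phi>"
    "(LINT x|lebesgue_on (I \<times> \<omega>). (\<phi> x)\<^sup>2) = N I \<phi>"
proof -
  have s: "smooth \<phi>" using assms(2) test_smooth by blast
  have g: "grad \<phi> \<in> borel_measurable borel" "\<phi> \<in> borel_measurable borel"
    using borel_of_continuous continuous_grad smooth_continuous s by blast+
  have "(\<lambda>x. op x (grad \<phi> x) \<bullet> grad \<phi> x) \<in> borel_measurable borel"
    by (intro borel_measurable_inner borel_op g) simp
  then show "(LINT x|lebesgue_on (I \<times> \<omega>). op x (grad \<phi> x) \<bullet> grad \<phi> x) = Q I \<phi>"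
    unfolding Q_def by (subst lebesgue_on_lborel(1)[OF open_cyl[OF assms(1)]]) simp_all
  have "(\<lambda>x. (\<phi> x)\<^sup>2) \<in> borel_measurable borel" by (intro borel_measurable_power g)
  then show "(LINT x|lebesgue_on (I \<times> \<omega>). (\<phi> x)\<^sup>2) = N I \<phi>"
    unfolding N_def by (subst lebesgue_on_lborel(1)[OF open_cyl[OF assms(1)]]) simp_all
qed

lemma exists_T:
  assumes "open I" "I \<noteq> {}"
  shows "\<exists>\<phi>\<in>T. (LINT x|lebesgue_on (I \<times> \<omega>). (\<phi> x)\<^sup>2) > 0"
  using exists_test_nonzero[OF open_cyl[OF assms(1)]] assms(2) ne test_mono[of _ "I \<times> \<omega>" "UNIV \<times> \<omega>"] by blast

lemma lambda1_le: "l > 0 \<Longrightarrow> \<phi> \<in> T \<Longrightarrow> lambda1 \<omega> a b M l * N {-l<..<l} \<phi> \<le> Q {-l<..<l} \<phi>"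
  and le_lambda1: "l > 0 \<Longrightarrow> (\<And>\<phi>. \<phi> \<in> T \<Longrightarrow> c * N {-l<..<l} \<phi> \<le> Q {-l<..<l} \<phi>) \<Longrightarrow> c \<le> lambda1 \<omega> a b M l"
proof -
  assume l: "l > 0"
  then have "{-l<..<l} \<noteq> {}" by auto
  note R = rayleigh_inf[OF open_cyl bounded_op_cyl op_pos, of "{-l<..<l}" T "lambda1 \<omega> a b M l",
      OF open_greaterThanLessThan _ test_scale exists_T[OF open_greaterThanLessThan this]]
  have S: "T \<subseteq> test_functions UNIV" using T_UNIV by blast
  have e: "lambda1 \<omega> a b M l = Inf {energy ({-l<..<l} \<times> \<omega>) op u |u. u \<in> H1_closure ({-l<..<l} \<times> \<omega>) T \<and> (LINT x|lebesgue_on ({-l<..<l} \<times> \<omega>). (u x)\<^sup>2) = 1}"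
    by (simp add: lambda1_def V_def)
  show "lambda1 \<omega> a b M l * N {-l<..<l} \<phi> \<le> Q {-l<..<l} \<phi>" if "\<phi> \<in> T"
    using R(1)[OF S _ e that] form_cyl[OF open_greaterThanLessThan that] by simp
  show "c \<le> lambda1 \<omega> a b M l" if "\<And>\<phi>. \<phi> \<in> T \<Longrightarrow> c * N {-l<..<l} \<phi> \<le> Q {-l<..<l} \<phi>"
    by (rule R(2)[OF S _ e]) (use that form_cyl[OF open_greaterThanLessThan] in auto)
qed

lemma nu_le: "open I \<Longrightarrow> I \<noteq> {} \<Longrightarrow> \<phi> \<in> T \<Longrightarrow> nu I \<omega> a b M * N I \<phi> \<le> Q I \<phi>"
  and le_nu: "open I \<Longrightarrow> I \<noteq> {} \<Longrightarrow> (\<And>\<phi>. \<phi> \<in> T \<Longrightarrow> c * N I \<phi> \<le> Q I \<phi>) \<Longrightarrow> c \<le> nu I \<omega> a b M"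
proof -
  assume I: "open I" "I \<noteq> {}"
  have S: "T \<subseteq> test_functions UNIV" using T_UNIV by blast
  have e: "nu I \<omega> a b M = Inf {energy (I \<times> \<omega>) op u / (LINT x|lebesgue_on (I \<times> \<omega>). (u x)\<^sup>2) |u. u \<in> H1_closure (I \<times> \<omega>) T \<and> \<not> (AE x in lebesgue_on (I \<times> \<omega>). u x = 0)}"
    by (simp add: nu_def V_def)
  note R = rayleigh_quotient_inf[OF open_cyl[OF I(1)] bounded_op_cyl op_pos S exists_T[OF I] e]
  show "nu I \<omega> a b M * N I \<phi> \<le> Q I \<phi>" if "\<phi> \<in> T"
    using R(1)[OF that] form_cyl[OF I(1) that] by simp
  show "c \<le> nu I \<omega> a b M" if "\<And>\<phi>. \<phi> \<in> T \<Longrightarrow> c * N I \<phi> \<le> Q I \<phi>"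
    by (rule R(2)) (use that form_cyl[OF I(1)] in auto)
qed

lemma mu1_le:
  assumes "p \<in> test_functions \<omega>"
  shows "mu1 \<omega> M * (LINT X|lebesgue_on \<omega>. (p X)\<^sup>2) \<le> (LINT X|lebesgue_on \<omega>. (M X *v grad p X) \<bullet> grad p X)"
  by (rule rayleigh_inf(1)[OF open_\<omega> bounded_op_base M_pos _ test_scale exists_test_nonzero[OF open_\<omega> ne] _ assms])
    (auto simp: mu1_def H10_def intro: test_mono)

lemma le_mu1:
  assumes "\<And>p. p \<in> test_functions \<omega> \<Longrightarrow> c * (LINT X|lebesgue_on \<omega>. (p X)\<^sup>2) \<le> (LINT X|lebesgue_on \<omega>. (M X *v grad p X) \<bullet> grad p X)"
  shows "c \<le> mu1 \<omega> M"
  by (rule rayleigh_inf(2)[OF open_\<omega> bounded_op_base M_pos _ test_scale exists_test_nonzero[OF open_\<omega> ne] _ assms])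
    (auto simp: mu1_def H10_def intro: test_mono)

end

section \<open>The limit of the first eigenvalue\<close>

context cylinder begin

lemma T_smooth: "\<phi> \<in> T \<Longrightarrow> smooth \<phi>" by (rule test_smooth)

lemma grad_measurable: "smooth \<phi> \<Longrightarrow> grad \<phi> \<in> borel_measurable borel" "smooth \<phi> \<Longrightarrow> \<phi> \<in> borel_measurable borel"
  using borel_of_continuous continuous_grad smooth_continuous by blast+

lemma op_bound: "\<bar>op x \<xi> \<bullet> \<eta>\<bar> \<le> C * (norm \<xi> * norm \<eta>)"
  by (rule bounded_op_bilinear(2)[OF bounded_op_cyl])

lemma Q_measurable:
  assumes "smooth \<phi>" "smooth \<psi>"
  shows "(\<lambda>x. op x (grad \<phi> x) \<bullet> grad \<psi> x) \<in> borel_measurable borel"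
  by (intro borel_measurable_inner borel_op grad_measurable assms) simp

lemma indicator_cyl_measurable:
  fixes f :: "real \<times> (real^'n) \<Rightarrow> real"
  assumes "open I" "f \<in> borel_measurable borel"
  shows "(\<lambda>x. indicator (I \<times> \<omega>) x * f x) \<in> borel_measurable borel"
proof -
  have "I \<times> \<omega> \<in> sets borel" using open_cyl[OF assms(1)] by simp
  then show ?thesis using assms(2) by (intro borel_measurable_times borel_measurable_indicator)
qed

lemma indicator_integrable:
  fixes f :: "real \<times> (real^'n) \<Rightarrow> real"
  assumes "open I" "integrable lborel f"
  shows "integrable lborel (\<lambda>x. indicator (I \<times> \<omega>) x * f x)"
proof -
  have "I \<times> \<omega> \<in> sets lborel" using open_cyl[OF assms(1)] by simp
  from integrable_mult_indicator[OF this assms(2)] show ?thesis by simp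
qed

lemma T_integrable:
  assumes "\<phi> \<in> T"
  shows "integrable lborel (\<lambda>x. op x (grad \<phi> x) \<bullet> grad \<phi> x)" "integrable lborel (\<lambda>x. (\<phi> x)\<^sup>2)"
proof -
  note s = T_smooth[OF assms]
  obtain K where K: "compact K" "\<forall>x. x \<notin> K \<longrightarrow> \<phi> x = 0 \<and> grad \<phi> x = 0" using test_support[OF assms] by blast
  show "integrable lborel (\<lambda>x. (\<phi> x)\<^sup>2)"
    by (rule compact_support_integrable[OF continuous_on_power[OF smooth_continuous[OF s]] K(1)]) (use K(2) in auto)
  have i: "integrable lborel (\<lambda>x. (norm (grad \<phi> x))\<^sup>2)"
    by (rule compact_support_integrable[OF continuous_on_power[OF continuous_on_norm[OF continuous_grad[OF s]]] K(1)])
      (use K(2) in auto)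
  show "integrable lborel (\<lambda>x. op x (grad \<phi> x) \<bullet> grad \<phi> x)"
  proof (rule Bochner_Integration.integrable_bound[of _ "\<lambda>x. C * (norm (grad \<phi> x))\<^sup>2"])
    show "integrable lborel (\<lambda>x. C * (norm (grad \<phi> x))\<^sup>2)" using i by simp
    show "(\<lambda>x. op x (grad \<phi> x) \<bullet> grad \<phi> x) \<in> borel_measurable lborel" using Q_measurable[OF s s] by simp
    show "AE x in lborel. norm (op x (grad \<phi> x) \<bullet> grad \<phi> x) \<le> norm (C * (norm (grad \<phi> x))\<^sup>2)"
      unfolding power2_eq_square real_norm_def by (intro AE_I2 order_trans[OF op_bound abs_ge_self])
  qed
qed

lemma Q_nonneg: "0 \<le> Q I \<phi>" and N_nonneg: "0 \<le> N I \<phi>"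
  unfolding Q_def N_def by (intro integral_nonneg_AE AE_I2; simp add: op_pos)+

text \<open>Replaces extension by zero: the cylinder may be lengthened or shortened wherever the
  function and its gradient vanish.\<close>

lemma QN_cong:
  assumes "\<And>t X. (t \<in> I) \<noteq> (t \<in> J) \<Longrightarrow> \<phi> (t, X) = 0 \<and> grad \<phi> (t, X) = 0"
  shows "Q I \<phi> = Q J \<phi>" "N I \<phi> = N J \<phi>"
proof -
  have z: "op x 0 = 0" for x using linear_op by (rule linear_0)
  have *: "indicator (I \<times> \<omega>) x * f x = indicator (J \<times> \<omega>) x * f x"
    if "\<And>x. \<phi> x = 0 \<and> grad \<phi> x = 0 \<Longrightarrow> f x = 0" for x and f :: "_ \<Rightarrow> real"
  proof (cases "(fst x \<in> I) = (fst x \<in> J)")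
    case True then show ?thesis by (simp add: indicator_def mem_Times_iff)
  next
    case False
    then have "f x = 0" using assms[of "fst x" "snd x"] by (intro that) simp
    then show ?thesis by simp
  qed
  show "Q I \<phi> = Q J \<phi>" "N I \<phi> = N J \<phi>" unfolding Q_def N_def
    by (intro Bochner_Integration.integral_cong refl *; simp add: z)+
qed

definition shift :: "real \<Rightarrow> (real \<times> (real^'n) \<Rightarrow> real) \<Rightarrow> real \<times> (real^'n) \<Rightarrow> real" where
  "shift s \<phi> = (\<lambda>x. \<phi> ((s, 0) + x))"

lemma shift_T:
  assumes "\<phi> \<in> T"
  shows "shift s \<phi> \<in> T"
proof -
  obtain K where K: "compact K" "K \<subseteq> UNIV \<times> \<omega>" "\<forall>x. x \<notin> K \<longrightarrow> \<phi> x = 0 \<and> grad \<phi> x = 0"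
    using test_support[OF assms] by blast
  show ?thesis unfolding shift_def
  proof (rule test_functionsI[of _ "(+) (- (s, 0)) ` K"])
    show "smooth (\<lambda>x. \<phi> ((s, 0) + x))" by (rule smooth_affine[OF T_smooth[OF assms] bounded_linear_ident])
    show "compact ((+) (- (s, 0)) ` K)" by (rule compact_translation[OF K(1)])
    show "(+) (- (s, 0)) ` K \<subseteq> UNIV \<times> \<omega>" using K(2) by (auto simp: mem_Times_iff)
    fix x assume nx: "x \<notin> (+) (- (s, 0)) ` K"
    have "(s, 0) + x \<notin> K"
    proof
      assume "(s, 0) + x \<in> K"
      then have "- (s, 0) + ((s, 0) + x) \<in> (+) (- (s, 0)) ` K" by (rule imageI)
      then show False using nx by (simp add: add.assoc[symmetric] del: uminus_Pair)
    qed
    then show "\<phi> ((s, 0) + x) = 0" using K(3) by blast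
  qed
qed

text \<open>The coefficients depend on the cross-section variable only, so both forms are invariant
  under translation along the axis.\<close>

lemma QN_shift:
  assumes "open J" "\<phi> \<in> T" and IJ: "\<And>t. t \<in> I \<longleftrightarrow> s + t \<in> J"
  shows "Q I (shift s \<phi>) = Q J \<phi>" "N I (shift s \<phi>) = N J \<phi>"
proof -
  note sm = T_smooth[OF assms(2)]
  have ind: "indicator (I \<times> \<omega>) x = (indicator (J \<times> \<omega>) ((s, 0) + x) :: real)" for x
    by (simp add: indicator_def mem_Times_iff IJ)
  have op: "op ((s, 0) + x) = op x" for x by (simp add: coeff_op_def fun_eq_iff)
  have "(\<lambda>x. indicator (J \<times> \<omega>) x * (op x (grad \<phi> x) \<bullet> grad \<phi> x)) \<in> borel_measurable borel"
    by (rule indicator_cyl_measurable[OF assms(1) Q_measurable[OF sm sm]])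
  from integral_lborel_translate[OF this, of "(s, 0)"]
  show "Q I (shift s \<phi>) = Q J \<phi>"
    unfolding Q_def shift_def ind by (simp only: op grad_translate[OF sm])
  have "(\<lambda>x. indicator (J \<times> \<omega>) x * (\<phi> x)\<^sup>2) \<in> borel_measurable borel"
    by (rule indicator_cyl_measurable[OF assms(1)]) (intro borel_measurable_power grad_measurable sm)
  from integral_lborel_translate[OF this, of "(s, 0)"]
  show "N I (shift s \<phi>) = N J \<phi>"
    unfolding N_def shift_def ind .
qed

lemma T_bounded_support:
  assumes "\<phi> \<in> T"
  shows "\<exists>R>0. \<forall>t X. R \<le> \<bar>t\<bar> \<longrightarrow> \<phi> (t, X) = 0 \<and> grad \<phi> (t, X) = 0"
proof -
  obtain K where K: "compact K" "\<forall>x. x \<notin> K \<longrightarrow> \<phi> x = 0 \<and> grad \<phi> x = 0" using test_support[OF assms] by blast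
  then obtain B where B: "\<forall>x\<in>K. norm x \<le> B" using compact_imp_bounded bounded_iff by blast
  have "(t, X) \<notin> K" if "\<bar>B\<bar> + 1 \<le> \<bar>t\<bar>" for t X
  proof
    assume "(t, X) \<in> K"
    then have "norm (t, X) \<le> B" using B by blast
    moreover have "\<bar>t\<bar> \<le> norm (t, X)" using norm_fst_le[of t X] by simp
    ultimately show False using that by linarith
  qed
  then show ?thesis using K(2) by (intro exI[of _ "\<bar>B\<bar> + 1"]) auto
qed

text \<open>Any \<open>c\<close> above \<open>nu\<close> fails to be a lower constant for some test
  function; that one function serves as competitor for all sufficiently long cylinders.\<close>

lemma lambda1_less_nu:
  assumes I: "I = {0<..} \<or> I = {..<0}" and less: "nu I \<omega> a b M < c"
  shows "eventually (\<lambda>l. lambda1 \<omega> a b M l < c) at_top"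
proof -
  have "(1::real) \<in> {0<..}" "(-1::real) \<in> {..<0}" by auto
  then have oI: "open I" "I \<noteq> {}" using I by (blast intro: open_greaterThan open_lessThan, blast)
  have "\<exists>\<phi>\<in>T. Q I \<phi> < c * N I \<phi>"
  proof (rule ccontr)
    assume "\<not> ?thesis"
    then have "c * N I \<phi> \<le> Q I \<phi>" if "\<phi> \<in> T" for \<phi> using that by (meson not_less)
    from le_nu[OF oI this] show False using less by simp
  qed
  then obtain \<phi> where \<phi>: "\<phi> \<in> T" "Q I \<phi> < c * N I \<phi>" by blast
  have "N I \<phi> \<noteq> 0" using \<phi>(2) Q_nonneg[of I \<phi>] by auto
  then have N: "N I \<phi> > 0" using N_nonneg[of I \<phi>] by simp
  obtain R where R: "R > 0" "\<And>t X. R \<le> \<bar>t\<bar> \<Longrightarrow> \<phi> (t, X) = 0 \<and> grad \<phi> (t, X) = 0"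
    using T_bounded_support[OF \<phi>(1)] by blast
  show ?thesis
    using eventually_gt_at_top[of R]
  proof eventually_elim
    case (elim l)
    then have l: "l > 0" using R(1) by simp
    \<comment> \<open>Translating by \<plusminus>\<open>l\<close> moves one end of the cylinder to
      0. The moved interval \<open>J\<close> differs from the half-line only at points of absolute
      value at least 2l > R, beyond the support.\<close>
    obtain s J where sJ: "open J" "\<And>t. t \<in> {-l<..<l} \<longleftrightarrow> s + t \<in> J" "\<And>t. (t \<in> J) \<noteq> (t \<in> I) \<Longrightarrow> R \<le> \<bar>t\<bar>"
    proof (cases "I = {0<..}")
      case True
      show ?thesis by (rule that[of "{0<..<2*l}" l]) (use elim l True in auto)
    next
      case False
      then have "I = {..<0}" using I by blast
      then show ?thesis by (intro that[of "{-2*l<..<0}" "-l"]) (use elim l in auto)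
    qed
    have e: "Q {-l<..<l} (shift s \<phi>) = Q I \<phi>" "N {-l<..<l} (shift s \<phi>) = N I \<phi>"
      using QN_shift[OF sJ(1) \<phi>(1) sJ(2)] QN_cong[of J I \<phi>, OF R(2)[OF sJ(3)]] by auto
    have "lambda1 \<omega> a b M l * N I \<phi> \<le> Q I \<phi>"
      using lambda1_le[OF l shift_T[OF \<phi>(1), of s]] unfolding e .
    then have "lambda1 \<omega> a b M l * N I \<phi> < c * N I \<phi>" using \<phi>(2) by linarith
    then show ?case using N by simp
  qed
qed

lemma nu_le_shift:
  assumes "\<phi> \<in> T"
  shows "nu_plus \<omega> a b M * N {s<..} \<phi> \<le> Q {s<..} \<phi>" "nu_minus \<omega> a b M * N {..<s} \<phi> \<le> Q {..<s} \<phi>"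
proof -
  have 1: "Q {0<..} (shift s \<phi>) = Q {s<..} \<phi>" "N {0<..} (shift s \<phi>) = N {s<..} \<phi>"
    by (rule QN_shift[OF _ assms]; auto)+
  have 2: "Q {..<0} (shift s \<phi>) = Q {..<s} \<phi>" "N {..<0} (shift s \<phi>) = N {..<s} \<phi>"
    by (rule QN_shift[OF _ assms]; auto)+
  show "nu_plus \<omega> a b M * N {s<..} \<phi> \<le> Q {s<..} \<phi>"
    using nu_le[of "{0<..}", OF _ _ shift_T[OF assms, of s]] gt_ex unfolding 1 by auto
  show "nu_minus \<omega> a b M * N {..<s} \<phi> \<le> Q {..<s} \<phi>"
    using nu_le[of "{..<0}", OF _ _ shift_T[OF assms, of s]] lt_ex unfolding 2 by auto
qed

end

text \<open>The transition occupies [-1/2, 1/2], so that after scaling by \<open>l\<close> it stays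
  in the middle half of (-l, l), and each of the two pieces vanishes near one end.\<close>

definition angle :: "real \<Rightarrow> real" where "angle t = (pi / 2) * step (1/2 + t)"

lemma angle: "smooth angle" "t \<le> -1/2 \<Longrightarrow> angle t = 0" "t \<ge> 1/2 \<Longrightarrow> angle t = pi / 2"
proof -
  have "smooth (\<lambda>t. step (1/2 + t))" by (rule smooth_affine[OF step(1) bounded_linear_ident])
  then show "smooth angle" unfolding angle_def[abs_def] by (rule smooth_mult[OF smooth_const])
  show "t \<le> -1/2 \<Longrightarrow> angle t = 0" "t \<ge> 1/2 \<Longrightarrow> angle t = pi / 2" by (simp_all add: angle_def step)
qed

lemma angle_deriv_bounded: "\<exists>B\<ge>0. \<forall>t. \<bar>grad angle t\<bar> \<le> B"
proof -
  have z: "grad angle t = 0" if "t \<notin> {-1/2..1/2}" for t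
  proof (cases "t < -1/2")
    case True
    have "(angle has_real_derivative 0) (at t)"
      by (rule has_field_derivative_transform_within_open[of "\<lambda>_. 0" _ _ "{..<-1/2}"]) (use True angle(2) in auto)
    then show ?thesis by (rule grad_real)
  next
    case False
    then have t: "t > 1/2" using that by simp
    have "(angle has_real_derivative 0) (at t)"
      by (rule has_field_derivative_transform_within_open[of "\<lambda>_. pi/2" _ _ "{1/2<..}"]) (use t angle(3) in auto)
    then show ?thesis by (rule grad_real)
  qed
  obtain B where "B \<ge> 0" "\<And>t. norm (grad angle t) \<le> B"
    using compact_support_bounded[OF continuous_grad[OF angle(1)] compact_Icc z] by blast
  then show ?thesis by auto
qed

context cylinder begin

text \<open>The IMS localisation formula. One piece is compared with the right half-cylinder
  starting at -l, the other with the left one ending at l; the price is the square of the derivative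
  of the rotation angle, of size B/l.\<close>

lemma ims_lower_bound:
  assumes B: "\<And>t. \<bar>grad angle t\<bar> \<le> B" and l: "l > 0"
  shows "min (nu_plus \<omega> a b M) (nu_minus \<omega> a b M) - C * (B / l)\<^sup>2 \<le> lambda1 \<omega> a b M l"
proof (rule le_lambda1[OF l])
  fix \<phi> assume \<phi>: "\<phi> \<in> T"
  note s = T_smooth[OF \<phi>]
  define \<Theta> where "\<Theta> x = angle (fst x * (1 / l))" for x :: "real \<times> (real^'n)"
  have s1: "smooth (\<lambda>t. angle (t * (1 / l)))" by (rule smooth_linear[OF angle(1) bounded_linear_mult_left])
  then have sT: "smooth \<Theta>" unfolding \<Theta>_def by (rule smooth_fst)
  define k where "k x = grad angle (fst x * (1 / l)) * (1 / l)" for x :: "real \<times> (real^'n)"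
  have "((\<lambda>t. angle (t * (1 / l))) has_real_derivative grad angle (t * (1 / l)) * (1 / l)) (at t)" for t
    by (rule DERIV_chain2[OF smooth_has_real_derivative[OF angle(1)]]) (use l in \<open>auto intro!: derivative_eq_intros\<close>)
  then have gT: "grad \<Theta> x = (k x, 0)" for x
    unfolding \<Theta>_def grad_fst[OF s1] k_def by (simp add: grad_real)
  have kB: "(k x)\<^sup>2 \<le> (B / l)\<^sup>2" for x
    unfolding k_def abs_le_square_iff[symmetric] using B[of "fst x * (1 / l)"] l
    by (simp add: abs_mult divide_right_mono)
  define \<phi>1 where "\<phi>1 x = cos (\<Theta> x) * \<phi> x" for x
  define \<phi>2 where "\<phi>2 x = sin (\<Theta> x) * \<phi> x" for x
  have sc: "smooth (\<lambda>x. cos (\<Theta> x))" "smooth (\<lambda>x. sin (\<Theta> x))"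
    by (rule smooth_compose[OF smooth_sin_cos(2) sT] smooth_compose[OF smooth_sin_cos(1) sT])+
  have gsc: "grad (\<lambda>x. cos (\<Theta> x)) x = - sin (\<Theta> x) *\<^sub>R (k x, 0)" "grad (\<lambda>x. sin (\<Theta> x)) x = cos (\<Theta> x) *\<^sub>R (k x, 0)" for x
    unfolding grad_compose[OF smooth_sin_cos(2) sT] grad_compose[OF smooth_sin_cos(1) sT] gT
      grad_real[OF DERIV_cos] grad_real[OF DERIV_sin] by simp_all
  have T1: "\<phi>1 \<in> T" and T2: "\<phi>2 \<in> T" unfolding \<phi>1_def[abs_def] \<phi>2_def[abs_def]
    by (rule test_mult[OF \<phi> sc(1)], rule test_mult[OF \<phi> sc(2)])
  have g: "grad \<phi>1 x = cos (\<Theta> x) *\<^sub>R grad \<phi> x - (sin (\<Theta> x) * (\<phi> x * k x)) *\<^sub>R (1, 0)"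
    "grad \<phi>2 x = sin (\<Theta> x) *\<^sub>R grad \<phi> x + (cos (\<Theta> x) * (\<phi> x * k x)) *\<^sub>R (1, 0)" for x
    unfolding \<phi>1_def[abs_def] \<phi>2_def[abs_def] grad_mult[OF sc(1) s] grad_mult[OF sc(2) s] gsc
    by (simp_all add: scaleR_prod_def mult_ac)
  have pt: "op x (grad \<phi>1 x) \<bullet> grad \<phi>1 x + op x (grad \<phi>2 x) \<bullet> grad \<phi>2 x
      \<le> op x (grad \<phi> x) \<bullet> grad \<phi> x + C * (B / l)\<^sup>2 * (\<phi> x)\<^sup>2" for x
  proof -
    interpret linear "op x" by (rule linear_op)
    let ?e = "(1, 0) :: real \<times> (real^'n)"
    define c where "c = cos (\<Theta> x)"
    define s where "s = sin (\<Theta> x)"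
    define K where "K = \<phi> x * k x"
    define G where "G = grad \<phi> x"
    have cs: "c\<^sup>2 + s\<^sup>2 = 1" by (simp add: c_def s_def)
    \<comment> \<open>The mixed terms are - c s K from the first square and + s c K from the second,
      each twice, and cancel; what remains carries the factor c^2 + s^2 = 1. No symmetry of the form
      is needed for this.\<close>
    have "op x (c *\<^sub>R G - (s * K) *\<^sub>R e) \<bullet> (c *\<^sub>R G - (s * K) *\<^sub>R e) + op x (s *\<^sub>R G + (c * K) *\<^sub>R e) \<bullet> (s *\<^sub>R G + (c * K) *\<^sub>R e)
       = (c\<^sup>2 + s\<^sup>2) * (op x G \<bullet> G) + (c\<^sup>2 + s\<^sup>2) * (K\<^sup>2 * (op x e \<bullet> e))" for e
      by (simp add: add diff scale inner_add_left inner_add_right inner_diff_left inner_diff_right)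
        (simp add: power2_eq_square algebra_simps)
    from this[of ?e] have "op x (c *\<^sub>R G - (s * K) *\<^sub>R ?e) \<bullet> (c *\<^sub>R G - (s * K) *\<^sub>R ?e) + op x (s *\<^sub>R G + (c * K) *\<^sub>R ?e) \<bullet> (s *\<^sub>R G + (c * K) *\<^sub>R ?e)
       = op x G \<bullet> G + K\<^sup>2 * (op x ?e \<bullet> ?e)" unfolding cs by (simp only: mult_1)
    also have "K\<^sup>2 * (op x ?e \<bullet> ?e) \<le> ((\<phi> x)\<^sup>2 * (B / l)\<^sup>2) * C"
    proof (rule mult_mono)
      show "K\<^sup>2 \<le> (\<phi> x)\<^sup>2 * (B / l)\<^sup>2" unfolding K_def power_mult_distrib by (rule mult_left_mono[OF kB]) simp
      show "op x ?e \<bullet> ?e \<le> C" using op_bound[of x ?e ?e] by (simp add: norm_Pair)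
    qed (simp_all add: op_pos)
    finally show ?thesis unfolding g c_def[symmetric] s_def[symmetric] K_def[symmetric] G_def[symmetric]
      by (simp add: mult_ac)
  qed
  let ?I = "{-l<..<l}"
  have oI: "open ?I" by simp
  note ii = indicator_integrable[OF oI]
  have q: "Q ?I \<phi>1 + Q ?I \<phi>2 \<le> Q ?I \<phi> + C * (B / l)\<^sup>2 * N ?I \<phi>"
  proof -
    have "Q ?I \<phi>1 + Q ?I \<phi>2 = (LINT x|lborel. indicator (?I \<times> \<omega>) x * (op x (grad \<phi>1 x) \<bullet> grad \<phi>1 x) + indicator (?I \<times> \<omega>) x * (op x (grad \<phi>2 x) \<bullet> grad \<phi>2 x))"
      unfolding Q_def by (rule Bochner_Integration.integral_add[symmetric]; rule ii; rule T_integrable) (rule T1, rule T2)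
    also have "\<dots> \<le> (LINT x|lborel. indicator (?I \<times> \<omega>) x * (op x (grad \<phi> x) \<bullet> grad \<phi> x) + C * (B / l)\<^sup>2 * (indicator (?I \<times> \<omega>) x * (\<phi> x)\<^sup>2))"
    proof (rule integral_mono)
      show "integrable lborel (\<lambda>x. indicator (?I \<times> \<omega>) x * (op x (grad \<phi>1 x) \<bullet> grad \<phi>1 x) + indicator (?I \<times> \<omega>) x * (op x (grad \<phi>2 x) \<bullet> grad \<phi>2 x))"
        by (intro Bochner_Integration.integrable_add ii T_integrable T1 T2)
      show "integrable lborel (\<lambda>x. indicator (?I \<times> \<omega>) x * (op x (grad \<phi> x) \<bullet> grad \<phi> x) + C * (B / l)\<^sup>2 * (indicator (?I \<times> \<omega>) x * (\<phi> x)\<^sup>2))"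
        by (intro Bochner_Integration.integrable_add integrable_mult_right ii T_integrable \<phi>)
      fix x
      show "indicator (?I \<times> \<omega>) x * (op x (grad \<phi>1 x) \<bullet> grad \<phi>1 x) + indicator (?I \<times> \<omega>) x * (op x (grad \<phi>2 x) \<bullet> grad \<phi>2 x)
        \<le> indicator (?I \<times> \<omega>) x * (op x (grad \<phi> x) \<bullet> grad \<phi> x) + C * (B / l)\<^sup>2 * (indicator (?I \<times> \<omega>) x * (\<phi> x)\<^sup>2)"
        using pt[of x] by (cases "x \<in> ?I \<times> \<omega>") (simp_all del: mem_Times_iff)
    qed
    also have "\<dots> = Q ?I \<phi> + C * (B / l)\<^sup>2 * N ?I \<phi>"
      unfolding Q_def N_def using ii[OF T_integrable(1)[OF \<phi>]] ii[OF T_integrable(2)[OF \<phi>]] by simp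
    finally show ?thesis .
  qed
  have n: "N ?I \<phi>1 + N ?I \<phi>2 = N ?I \<phi>"
  proof -
    have "N ?I \<phi>1 + N ?I \<phi>2 = (LINT x|lborel. indicator (?I \<times> \<omega>) x * (\<phi>1 x)\<^sup>2 + indicator (?I \<times> \<omega>) x * (\<phi>2 x)\<^sup>2)"
      unfolding N_def by (rule Bochner_Integration.integral_add[symmetric]; rule ii; rule T_integrable) (rule T1, rule T2)
    also have "\<dots> = N ?I \<phi>" unfolding N_def
    proof (rule Bochner_Integration.integral_cong[OF refl])
      fix x
      have "(\<phi>1 x)\<^sup>2 + (\<phi>2 x)\<^sup>2 = ((cos (\<Theta> x))\<^sup>2 + (sin (\<Theta> x))\<^sup>2) * (\<phi> x)\<^sup>2"
        by (simp only: \<phi>1_def \<phi>2_def power_mult_distrib distrib_right)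
      also have "\<dots> = (\<phi> x)\<^sup>2" by simp
      finally show "indicator (?I \<times> \<omega>) x * (\<phi>1 x)\<^sup>2 + indicator (?I \<times> \<omega>) x * (\<phi>2 x)\<^sup>2 = indicator (?I \<times> \<omega>) x * (\<phi> x)\<^sup>2"
        by (simp only: distrib_left[symmetric])
    qed
    finally show ?thesis .
  qed
  \<comment> \<open>The piece vanishes already beyond l/2. This margin makes its gradient vanish at
    and beyond the end l too, as the passage to the half-line requires.\<close>
  have v1: "\<phi>1 x = 0 \<and> grad \<phi>1 x = 0" if "fst x \<ge> l" for x
  proof -
    have z: "\<phi>1 y = 0" if "y \<notin> {y. fst y \<le> l / 2}" for y
    proof -
      have "fst y * (1 / l) \<ge> 1/2" using that l by (simp add: field_simps)
      then show ?thesis by (simp add: \<phi>1_def \<Theta>_def angle(3))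
    qed
    have c: "closed {y::real \<times> (real^'n). fst y \<le> l / 2}" by (intro closed_Collect_le continuous_intros)
    have nx: "x \<notin> {y. fst y \<le> l / 2}" using that l by simp
    show ?thesis using z[OF nx] grad_eq_0_off[of _ \<phi>1, OF c z nx] by blast
  qed
  have v2: "\<phi>2 x = 0 \<and> grad \<phi>2 x = 0" if "fst x \<le> - l" for x
  proof -
    have z: "\<phi>2 y = 0" if "y \<notin> {y. - l / 2 \<le> fst y}" for y
    proof -
      have "fst y * (1 / l) \<le> -1/2" using that l by (simp add: field_simps)
      then show ?thesis by (simp add: \<phi>2_def \<Theta>_def angle(2))
    qed
    have c: "closed {y::real \<times> (real^'n). - l / 2 \<le> fst y}" by (intro closed_Collect_le continuous_intros)
    have nx: "x \<notin> {y. - l / 2 \<le> fst y}" using that l by simp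
    show ?thesis using z[OF nx] grad_eq_0_off[of _ \<phi>2, OF c z nx] by blast
  qed
  have e1: "Q ?I \<phi>1 = Q {-l<..} \<phi>1" "N ?I \<phi>1 = N {-l<..} \<phi>1"
    by (rule QN_cong[OF v1]; use l in auto)+
  have e2: "Q ?I \<phi>2 = Q {..<l} \<phi>2" "N ?I \<phi>2 = N {..<l} \<phi>2"
    by (rule QN_cong[OF v2]; use l in auto)+
  let ?m = "min (nu_plus \<omega> a b M) (nu_minus \<omega> a b M)"
  have "?m * N ?I \<phi>1 \<le> Q ?I \<phi>1"
    using nu_le_shift(1)[OF T1, of "-l"] mult_right_mono[OF min.cobounded1[of "nu_plus \<omega> a b M" "nu_minus \<omega> a b M"] N_nonneg[of "{-l<..}" \<phi>1]] unfolding e1 by linarith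
  moreover have "?m * N ?I \<phi>2 \<le> Q ?I \<phi>2"
    using nu_le_shift(2)[OF T2, of l] mult_right_mono[OF min.cobounded2[of "nu_plus \<omega> a b M" "nu_minus \<omega> a b M"] N_nonneg[of "{..<l}" \<phi>2]] unfolding e2 by linarith
  ultimately have "?m * (N ?I \<phi>1 + N ?I \<phi>2) \<le> Q ?I \<phi>1 + Q ?I \<phi>2" by (simp add: distrib_left)
  then show "(?m - C * (B / l)\<^sup>2) * N ?I \<phi> \<le> Q ?I \<phi>"
    using q unfolding n by (simp add: left_diff_distrib)
qed

lemma lambda1_tendsto:
  "((\<lambda>l. lambda1 \<omega> a b M l) \<longlongrightarrow> min (nu_plus \<omega> a b M) (nu_minus \<omega> a b M)) at_top"
proof (rule order_tendstoI)
  let ?m = "min (nu_plus \<omega> a b M) (nu_minus \<omega> a b M)"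
  fix c assume "?m < c"
  then have "nu_plus \<omega> a b M < c \<or> nu_minus \<omega> a b M < c" by (simp add: min_less_iff_disj)
  then show "eventually (\<lambda>l. lambda1 \<omega> a b M l < c) at_top" using lambda1_less_nu by blast
next
  let ?m = "min (nu_plus \<omega> a b M) (nu_minus \<omega> a b M)"
  fix c assume c: "c < ?m"
  obtain B where B: "\<And>t. \<bar>grad angle t\<bar> \<le> B" using angle_deriv_bounded by blast
  have "((\<lambda>l. ?m - C * (B * inverse l)\<^sup>2) \<longlongrightarrow> ?m - C * (B * 0)\<^sup>2) at_top"
    by (intro tendsto_intros tendsto_inverse_0_at_top filterlim_ident)
  then have "eventually (\<lambda>l. c < ?m - C * (B * inverse l)\<^sup>2) at_top" using c by (intro order_tendstoD(1)) auto
  then show "eventually (\<lambda>l. c < lambda1 \<omega> a b M l) at_top"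
    using eventually_gt_at_top[of 0]
  proof eventually_elim
    case (elim l)
    then show ?case using ims_lower_bound[OF B elim(2)] by (simp add: divide_inverse)
  qed
qed

end

section \<open>Tensor products\<close>

lemma lborel_Fubini:
  fixes f :: "'a::euclidean_space \<times> 'b::euclidean_space \<Rightarrow> real"
  assumes "integrable lborel f"
  shows "(LINT x|lborel. f x) = (LINT s|lborel. LINT y|lborel. f (s, y))"
    and "integrable lborel (\<lambda>s. LINT y|lborel. f (s, y))"
    and "AE s in lborel. integrable lborel (\<lambda>y. f (s, y))"
proof -
  have i: "integrable (lborel \<Otimes>\<^sub>M lborel) f" using assms by (simp add: lborel_prod)
  show "(LINT x|lborel. f x) = (LINT s|lborel. LINT y|lborel. f (s, y))"
    using lborel_pair.integral_fst'[OF i] by (simp add: lborel_prod)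
  show "integrable lborel (\<lambda>s. LINT y|lborel. f (s, y))" by (rule lborel_pair.integrable_fst'[OF i])
  show "AE s in lborel. integrable lborel (\<lambda>y. f (s, y))" by (rule lborel_pair.AE_integrable_fst'[OF i])
qed

lemma lborel_tensor:
  fixes F :: "'a::euclidean_space \<Rightarrow> real" and G :: "'b::euclidean_space \<Rightarrow> real"
  assumes F: "integrable lborel F" and G: "integrable lborel G"
  shows "integrable lborel (\<lambda>x. F (fst x) * G (snd x))"
    and "(LINT x|lborel. F (fst x) * G (snd x)) = (LINT s|lborel. F s) * (LINT y|lborel. G y)"
proof -
  have [measurable]: "F \<in> borel_measurable lborel" "G \<in> borel_measurable lborel" using F G by auto
  have "integrable (lborel \<Otimes>\<^sub>M lborel) (\<lambda>x. F (fst x) * G (snd x))"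
    by (rule lborel_pair.Fubini_integrable) (use F G in \<open>auto simp: abs_mult\<close>)
  then show i: "integrable lborel (\<lambda>x. F (fst x) * G (snd x))" by (simp add: lborel_prod)
  show "(LINT x|lborel. F (fst x) * G (snd x)) = (LINT s|lborel. F s) * (LINT y|lborel. G y)"
    unfolding lborel_Fubini(1)[OF i] by simp
qed

text \<open>The arguments place the two transitions on [-1, -1/2] and [1/2, 1].\<close>

definition bump :: "real \<Rightarrow> real" where "bump t = step (2 + 2 * t) * step (2 + (-2) * t)"

lemma bump: "smooth bump" "\<bar>t\<bar> \<le> 1/2 \<Longrightarrow> bump t = 1" "\<bar>t\<bar> \<ge> 1 \<Longrightarrow> bump t = 0"
proof -
  show "smooth bump" unfolding bump_def[abs_def]
    by (intro smooth_mult smooth_affine[OF step(1) bounded_linear_mult_right])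
  show "\<bar>t\<bar> \<le> 1/2 \<Longrightarrow> bump t = 1" unfolding bump_def by (subst (1 2) step(3)) auto
  show "\<bar>t\<bar> \<ge> 1 \<Longrightarrow> bump t = 0" unfolding bump_def using step(2)[of "2 + 2 * t"] step(2)[of "2 + (-2) * t"] by (cases "t \<ge> 0") auto
qed

definition plateau :: "real \<Rightarrow> real \<Rightarrow> real" where "plateau R t = bump (t * (1 / R))"

lemma plateau:
  assumes R: "R > 0"
  shows "smooth (plateau R)" "\<bar>t\<bar> \<le> R / 2 \<Longrightarrow> plateau R t = 1" "\<bar>t\<bar> \<ge> R \<Longrightarrow> plateau R t = 0"
    "plateau R \<in> test_functions UNIV" "\<bar>t\<bar> < R / 2 \<Longrightarrow> grad (plateau R) t = 0" "\<bar>t\<bar> > R \<Longrightarrow> grad (plateau R) t = 0"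
    "grad (plateau R) t = grad bump (t * (1 / R)) * (1 / R)"
proof -
  show s: "smooth (plateau R)" unfolding plateau_def[abs_def]
    by (rule smooth_linear[OF bump(1) bounded_linear_mult_left])
  show one: "\<bar>t\<bar> \<le> R / 2 \<Longrightarrow> plateau R t = 1" for t unfolding plateau_def by (rule bump(2)) (use R in \<open>simp add: field_simps abs_mult\<close>)
  show z: "\<bar>t\<bar> \<ge> R \<Longrightarrow> plateau R t = 0" for t
    unfolding plateau_def by (rule bump(3)) (use R in \<open>simp add: field_simps abs_mult\<close>)
  show "plateau R \<in> test_functions UNIV"
    by (rule test_functionsI[OF s compact_Icc[of "-R" R]]) (use z in auto)
  show "grad (plateau R) t = grad bump (t * (1 / R)) * (1 / R)"
    unfolding plateau_def[abs_def]
    by (rule grad_real, rule DERIV_chain2[OF smooth_has_real_derivative[OF bump(1)]]) (use R in \<open>auto intro!: derivative_eq_intros\<close>)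
  show "grad (plateau R) t = 0" if "\<bar>t\<bar> < R / 2"
  proof -
    have "(plateau R has_real_derivative 0) (at t)"
      by (rule has_field_derivative_transform_within_open[of "\<lambda>_. 1" _ _ "{-R/2<..<R/2}"])
        (use that one in \<open>auto simp: abs_less_iff abs_le_iff\<close>)
    then show ?thesis by (rule grad_real)
  qed
  show "grad (plateau R) t = 0" if "\<bar>t\<bar> > R"
    by (rule grad_eq_0_off[of "{-R..R}"]) (use that z in auto)
qed

lemma test_integrable_on:
  fixes h :: "real \<Rightarrow> real"
  assumes "continuous_on UNIV h" "\<And>t. \<bar>t\<bar> > R \<Longrightarrow> h t = 0" "I \<in> sets borel"
  shows "integrable lborel (\<lambda>t. indicator I t * h t)"
proof -
  have "integrable lborel h" by (rule compact_support_integrable[OF assms(1) compact_Icc[of "-R" R]]) (use assms(2) in auto)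
  from integrable_mult_indicator[OF _ this, of I] assms(3) show ?thesis by simp
qed

text \<open>Source of the boundary terms at the finite end: with the same function, the two
  half-lines produce opposite signs.\<close>

lemma integral_derivative_half_line:
  assumes h: "smooth h" and R: "R > 0" "\<And>t. \<bar>t\<bar> \<ge> R \<Longrightarrow> h t = 0"
  shows "(LINT t|lborel. indicator {0<..} t * grad h t) = - h 0" "(LINT t|lborel. indicator {..<0} t * grad h t) = h 0"
proof -
  have d: "(h has_vector_derivative grad h t) (at t within S)" for t S
    using smooth_has_real_derivative[OF h] has_real_derivative_iff_has_vector_derivative has_vector_derivative_at_within by blast
  have z: "grad h t = 0" if "\<bar>t\<bar> > R" for t by (rule grad_eq_0_off[of "{-R..R}"]) (use that R in auto)
  have c: "continuous_on S (grad h)" for S using continuous_grad[OF h] continuous_on_subset by blast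
  have m: "grad h \<in> borel_measurable borel" by (rule borel_of_continuous[OF c])
  have "(LINT t|lborel. indicator {0..R} t *\<^sub>R grad h t) = h R - h 0"
    by (rule integral_FTC_atLeastAtMost[OF _ d c]) (use R in auto)
  moreover have "(LINT t|lborel. indicator {0<..} t * grad h t) = (LINT t|lborel. indicator {0..R} t *\<^sub>R grad h t)"
  proof (rule integral_cong_AE)
    show "AE t in lborel. indicator {0<..} t * grad h t = indicator {0..R} t *\<^sub>R grad h t"
      using AE_lborel_singleton[of 0] by eventually_elim (use z in \<open>auto simp: indicator_def\<close>)
  qed (use m in auto)
  ultimately show "(LINT t|lborel. indicator {0<..} t * grad h t) = - h 0" using R by simp
  have "(LINT t|lborel. indicator {-R..0} t *\<^sub>R grad h t) = h 0 - h (-R)"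
    by (rule integral_FTC_atLeastAtMost[OF _ d c]) (use R in auto)
  moreover have "(LINT t|lborel. indicator {..<0} t * grad h t) = (LINT t|lborel. indicator {-R..0} t *\<^sub>R grad h t)"
  proof (rule integral_cong_AE)
    show "AE t in lborel. indicator {..<0} t * grad h t = indicator {-R..0} t *\<^sub>R grad h t"
      using AE_lborel_singleton[of 0] by eventually_elim (use z in \<open>auto simp: indicator_def\<close>)
  qed (use m in auto)
  ultimately show "(LINT t|lborel. indicator {..<0} t * grad h t) = h 0" using R by simp
qed

lemma linear_coefficient_zero:
  fixes A B :: real
  assumes "\<And>s. 0 \<le> s * A + s\<^sup>2 * B"
  shows "A = 0"
proof (rule ccontr)
  assume "A \<noteq> 0"
  \<comment> \<open>The test value is s = - e A. The resulting factor e B - 1 has to be negative,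
    and this \<open>e\<close> gives e B <= 1/2 whatever the sign of B.\<close>
  define e where "e = 1 / (2 * (\<bar>B\<bar> + 1))"
  have e: "e > 0" by (simp add: e_def)
  have "0 \<le> (- e * A) * A + (- e * A)\<^sup>2 * B" by (rule assms)
  also have "\<dots> = e * A\<^sup>2 * (e * B - 1)" by (simp add: power2_eq_square algebra_simps)
  also have "\<dots> < 0"
  proof (rule mult_pos_neg)
    show "0 < e * A\<^sup>2" using e \<open>A \<noteq> 0\<close> by simp
    have "e * B \<le> e * (\<bar>B\<bar> + 1)" using e by (intro mult_left_mono) auto
    also have "\<dots> = 1/2" by (simp add: e_def field_simps)
    finally show "e * B - 1 < 0" by simp
  qed
  finally show False by simp
qed

section \<open>Forms on the cross-section and separation of variables\<close>

context cylinder begin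

abbreviation "L\<omega> \<equiv> lebesgue_on \<omega>"

text \<open>The block contributions of the matrix on the cross-section, and the L2 product. Gradient
  arguments are arbitrary vector fields, so that the L2 limit of the gradients of \<open>p k\<close>
  can be inserted as well as classical gradients.\<close>

definition fa :: "(real^'n \<Rightarrow> real) \<Rightarrow> (real^'n \<Rightarrow> real) \<Rightarrow> real" where "fa p z = (LINT X|L\<omega>. a X * (p X * z X))"
definition fb :: "(real^'n \<Rightarrow> real^'n) \<Rightarrow> (real^'n \<Rightarrow> real) \<Rightarrow> real" where "fb v z = (LINT X|L\<omega>. (b X \<bullet> v X) * z X)"
definition fm :: "(real^'n \<Rightarrow> real^'n) \<Rightarrow> (real^'n \<Rightarrow> real^'n) \<Rightarrow> real" where "fm v w = (LINT X|L\<omega>. (M X *v v X) \<bullet> w X)"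
definition f0 :: "(real^'n \<Rightarrow> real) \<Rightarrow> (real^'n \<Rightarrow> real) \<Rightarrow> real" where "f0 p z = (LINT X|L\<omega>. p X * z X)"

lemma a_bound: "\<bar>a X * (u * v)\<bar> \<le> C * (norm u * norm v)" for u v :: real
  using op_bound[of "(0, X)" "(u, 0)" "(v, 0)"] by (simp add: op_inner norm_Pair)
lemma b_bound: "\<bar>(b X \<bullet> u) * v\<bar> \<le> C * (norm u * norm v)" for v :: real
  using op_bound[of "(0, X)" "(0, u)" "(v, 0)"] by (simp add: op_inner norm_Pair)
lemma M_bound: "\<bar>(M X *v u) \<bullet> v\<bar> \<le> C * (norm u * norm v)"
  using op_bound[of "(0, X)" "(0, u)" "(0, v)"] by (simp add: op_inner norm_Pair)

lemma meas_on: "a \<in> borel_measurable L\<omega>" "b \<in> borel_measurable L\<omega>" "M \<in> borel_measurable L\<omega>"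
  by (intro measurable_restrict_space1 measurable_completion, simp add: meas)+

lemma a_bilinear: "bounded_bilinear (\<lambda>u v::real. a X * (u * v))"
proof
  show "\<exists>K. \<forall>u v. norm (a X * (u * v)) \<le> norm u * norm v * K"
  proof (intro exI allI)
    fix u v show "norm (a X * (u * v)) \<le> norm u * norm v * C"
      using a_bound[of X u v] by (simp only: real_norm_def mult.commute[of _ C])
  qed
qed (simp_all add: algebra_simps)

lemma conv_a: "L2conv L\<omega> F f \<Longrightarrow> L2conv L\<omega> G g \<Longrightarrow> (\<lambda>k. fa (F k) (G k)) \<longlonglongrightarrow> fa f g"
  unfolding fa_def
  by (rule L2conv_bilinear[OF a_bilinear a_bound]) (intro borel_measurable_times meas_on)

lemma conv_b: "L2conv L\<omega> F f \<Longrightarrow> L2conv L\<omega> G g \<Longrightarrow> (\<lambda>k. fb (F k) (G k)) \<longlonglongrightarrow> fb f g"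
  unfolding fb_def
  by (rule L2conv_bilinear[OF _ b_bound])
    (auto intro!: bounded_bilinear.comp1[OF bounded_bilinear_mult] bounded_linear_inner_right borel_measurable_times borel_measurable_inner meas_on)

lemma conv_m: "L2conv L\<omega> F f \<Longrightarrow> L2conv L\<omega> G g \<Longrightarrow> (\<lambda>k. fm (F k) (G k)) \<longlonglongrightarrow> fm f g"
  unfolding fm_def
  by (rule L2conv_bilinear[OF bounded_op_bilinear[OF bounded_op_base]])

lemma conv_0: "L2conv L\<omega> F f \<Longrightarrow> L2conv L\<omega> G g \<Longrightarrow> (\<lambda>k. f0 (F k) (G k)) \<longlonglongrightarrow> f0 f g"
  unfolding f0_def
  by (rule L2conv_bilinear[where C=1, OF bounded_bilinear_mult]) (auto simp: abs_mult)

definition tens :: "(real \<Rightarrow> real) \<Rightarrow> (real^'n \<Rightarrow> real) \<Rightarrow> real \<times> (real^'n) \<Rightarrow> real" where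
  "tens f p x = f (fst x) * p (snd x)"

lemma tens_T:
  assumes f: "f \<in> test_functions UNIV" and p: "p \<in> test_functions \<omega>"
  shows "tens f p \<in> T"
proof -
  obtain K where K: "compact K" "\<forall>x. x \<notin> K \<longrightarrow> f x = 0 \<and> grad f x = 0" using test_support[OF f] by blast
  obtain L where L: "compact L" "L \<subseteq> \<omega>" "\<forall>x. x \<notin> L \<longrightarrow> p x = 0 \<and> grad p x = 0" using test_support[OF p] by blast
  show ?thesis unfolding tens_def[abs_def]
    by (rule test_functionsI[of _ "K \<times> L"])
      (use K L in \<open>auto intro!: smooth_mult smooth_fst smooth_snd test_smooth[OF f] test_smooth[OF p] compact_Times\<close>)
qed

lemma grad_tens:
  assumes f: "smooth f" and p: "smooth p"
  shows "grad (tens f p) x = (grad f (fst x) * p (snd x), f (fst x) *\<^sub>R grad p (snd x))"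
  unfolding tens_def[abs_def] grad_mult[OF smooth_fst[OF f] smooth_snd[OF p]] grad_fst[OF f] grad_snd[OF p]
  by (simp add: scaleR_prod_def mult.commute)

text \<open>Polarisations of \<open>Q\<close> and \<open>N\<close>, needed for the mixed terms of
  trial functions with two summands.\<close>

definition QB :: "real set \<Rightarrow> (real \<times> (real^'n) \<Rightarrow> real) \<Rightarrow> (real \<times> (real^'n) \<Rightarrow> real) \<Rightarrow> real" where
  "QB I \<phi> \<psi> = (LINT x|lborel. indicator (I \<times> \<omega>) x * (op x (grad \<phi> x) \<bullet> grad \<psi> x))"
definition NB :: "real set \<Rightarrow> (real \<times> (real^'n) \<Rightarrow> real) \<Rightarrow> (real \<times> (real^'n) \<Rightarrow> real) \<Rightarrow> real" where
  "NB I \<phi> \<psi> = (LINT x|lborel. indicator (I \<times> \<omega>) x * (\<phi> x * \<psi> x))"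

definition int_on :: "real set \<Rightarrow> (real \<Rightarrow> real) \<Rightarrow> real" where
  "int_on I h = (LINT t|lborel. indicator I t * h t)"

lemma base_integrals:
  assumes p: "p \<in> test_functions \<omega>" and z: "z \<in> test_functions \<omega>"
  shows "integrable lborel (\<lambda>X. indicator \<omega> X * (a X * (p X * z X)))"
    "fa p z = (LINT X|lborel. indicator \<omega> X * (a X * (p X * z X)))"
    "integrable lborel (\<lambda>X. indicator \<omega> X * ((b X \<bullet> grad p X) * z X))"
    "fb (grad p) z = (LINT X|lborel. indicator \<omega> X * ((b X \<bullet> grad p X) * z X))"
    "integrable lborel (\<lambda>X. indicator \<omega> X * ((M X *v grad p X) \<bullet> grad z X))"
    "fm (grad p) (grad z) = (LINT X|lborel. indicator \<omega> X * ((M X *v grad p X) \<bullet> grad z X))"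
    "integrable lborel (\<lambda>X. indicator \<omega> X * (p X * z X))"
    "f0 p z = (LINT X|lborel. indicator \<omega> X * (p X * z X))"
proof -
  have q: "sqint L\<omega> p" "sqint L\<omega> (grad p)" "sqint L\<omega> z" "sqint L\<omega> (grad z)"
    using test_sqint[OF open_\<omega> test_mono[OF p]] test_sqint[OF open_\<omega> test_mono[OF z]] by auto
  have m: "p \<in> borel_measurable borel" "grad p \<in> borel_measurable borel" "z \<in> borel_measurable borel" "grad z \<in> borel_measurable borel"
    using borel_of_continuous smooth_continuous continuous_grad test_smooth[OF p] test_smooth[OF z] by blast+
  have *: "integrable lborel (\<lambda>X. indicator \<omega> X * h X) \<and> (LINT X|L\<omega>. h X) = (LINT X|lborel. indicator \<omega> X * h X)"
    if "h \<in> borel_measurable borel" "integrable L\<omega> h" for h :: "real^'n \<Rightarrow> real"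
    using lebesgue_on_lborel[OF open_\<omega> that(1)] that(2) by simp
  have B: "h \<in> borel_measurable L\<omega>" if "h \<in> borel_measurable borel" for h :: "real^'n \<Rightarrow> real"
    using that by (intro measurable_restrict_space1 measurable_completion) simp
  have 1: "(\<lambda>X. a X * (p X * z X)) \<in> borel_measurable borel" "(\<lambda>X. (b X \<bullet> grad p X) * z X) \<in> borel_measurable borel"
    "(\<lambda>X. (M X *v grad p X) \<bullet> grad z X) \<in> borel_measurable borel" "(\<lambda>X. p X * z X) \<in> borel_measurable borel"
    by (intro borel_measurable_times borel_measurable_inner borel_measurable_matrix_vector m meas)+
  have 2: "integrable L\<omega> (\<lambda>X. a X * (p X * z X))" "integrable L\<omega> (\<lambda>X. (b X \<bullet> grad p X) * z X)"
    "integrable L\<omega> (\<lambda>X. (M X *v grad p X) \<bullet> grad z X)"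
    by (rule bilinear_integrable[OF a_bound B[OF 1(1)] q(1,3)] bilinear_integrable[OF b_bound B[OF 1(2)] q(2,3)]
        bilinear_integrable[OF M_bound B[OF 1(3)] q(2,4)])+
  have 3: "integrable L\<omega> (\<lambda>X. p X * z X)"
    by (rule bilinear_integrable[where B="\<lambda>x u v. u * v" and C=1, OF _ B[OF 1(4)] q(1,3)]) (simp add: abs_mult)
  show "integrable lborel (\<lambda>X. indicator \<omega> X * (a X * (p X * z X)))"
    "fa p z = (LINT X|lborel. indicator \<omega> X * (a X * (p X * z X)))"
    "integrable lborel (\<lambda>X. indicator \<omega> X * ((b X \<bullet> grad p X) * z X))"
    "fb (grad p) z = (LINT X|lborel. indicator \<omega> X * ((b X \<bullet> grad p X) * z X))"
    "integrable lborel (\<lambda>X. indicator \<omega> X * ((M X *v grad p X) \<bullet> grad z X))"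
    "fm (grad p) (grad z) = (LINT X|lborel. indicator \<omega> X * ((M X *v grad p X) \<bullet> grad z X))"
    "integrable lborel (\<lambda>X. indicator \<omega> X * (p X * z X))"
    "f0 p z = (LINT X|lborel. indicator \<omega> X * (p X * z X))"
    using *[OF 1(1) 2(1)] *[OF 1(2) 2(2)] *[OF 1(3) 2(3)] *[OF 1(4) 3] unfolding fa_def fb_def fm_def f0_def by blast+
qed

text \<open>Since the coefficients do not depend on the axial variable, each block of the matrix
  separates into an integral over \<open>I\<close> times an integral over \<omega>. The off-diagonal
  block occurs twice, with the axial derivative on either factor.\<close>

lemma tensor_forms:
  assumes I: "open I" and f: "f \<in> test_functions UNIV" and g: "g \<in> test_functions UNIV"
    and p: "p \<in> test_functions \<omega>" and z: "z \<in> test_functions \<omega>"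
  shows "QB I (tens f p) (tens g z) = int_on I (\<lambda>t. grad f t * grad g t) * fa p z + int_on I (\<lambda>t. f t * grad g t) * fb (grad p) z
      + int_on I (\<lambda>t. grad f t * g t) * fb (grad z) p + int_on I (\<lambda>t. f t * g t) * fm (grad p) (grad z)"
    "NB I (tens f p) (tens g z) = int_on I (\<lambda>t. f t * g t) * f0 p z"
proof -
  note sf = test_smooth[OF f] and sg = test_smooth[OF g] and sp = test_smooth[OF p] and sz = test_smooth[OF z]
  have c: "continuous_on UNIV f" "continuous_on UNIV (grad f)" "continuous_on UNIV g" "continuous_on UNIV (grad g)"
    using sf sg smooth_continuous continuous_grad by blast+
  obtain K where K: "compact K" "\<forall>x. x \<notin> K \<longrightarrow> f x = 0 \<and> grad f x = 0" using test_support[OF f] by blast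
  obtain B where B: "\<forall>x\<in>K. norm x \<le> B" using K(1) compact_imp_bounded bounded_iff by blast
  have z0: "f t = 0 \<and> grad f t = 0" if "\<bar>t\<bar> > B" for t using that B K(2) by (metis not_less real_norm_def)
  have Ib: "I \<in> sets borel" using I by simp
  have i: "integrable lborel (\<lambda>t. indicator I t * (grad f t * grad g t))" "integrable lborel (\<lambda>t. indicator I t * (f t * grad g t))"
    "integrable lborel (\<lambda>t. indicator I t * (grad f t * g t))" "integrable lborel (\<lambda>t. indicator I t * (f t * g t))"
    by (rule test_integrable_on[OF continuous_on_mult _ Ib, of _ _ B]; simp add: c z0)+
  note b1 = base_integrals[OF p z] and b2 = base_integrals[OF z p]
  let ?F1 = "\<lambda>x::real\<times>(real^'n). (indicator I (fst x) * (grad f (fst x) * grad g (fst x))) * (indicator \<omega> (snd x) * (a (snd x) * (p (snd x) * z (snd x))))"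
  let ?F2 = "\<lambda>x::real\<times>(real^'n). (indicator I (fst x) * (f (fst x) * grad g (fst x))) * (indicator \<omega> (snd x) * ((b (snd x) \<bullet> grad p (snd x)) * z (snd x)))"
  let ?F3 = "\<lambda>x::real\<times>(real^'n). (indicator I (fst x) * (grad f (fst x) * g (fst x))) * (indicator \<omega> (snd x) * ((b (snd x) \<bullet> grad z (snd x)) * p (snd x)))"
  let ?F4 = "\<lambda>x::real\<times>(real^'n). (indicator I (fst x) * (f (fst x) * g (fst x))) * (indicator \<omega> (snd x) * ((M (snd x) *v grad p (snd x)) \<bullet> grad z (snd x)))"
  note t1 = lborel_tensor[OF i(1) b1(1)] and t2 = lborel_tensor[OF i(2) b1(3)] and t3 = lborel_tensor[OF i(3) b2(3)]
    and t4 = lborel_tensor[OF i(4) b1(5)] and t5 = lborel_tensor[OF i(4) b1(7)]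
  have ind: "indicator (I \<times> \<omega>) x = (indicator I (fst x) * indicator \<omega> (snd x) :: real)" for x
    by (simp add: indicator_def mem_Times_iff)
  have "QB I (tens f p) (tens g z) = (LINT x|lborel. ?F1 x + ?F2 x + ?F3 x + ?F4 x)"
    unfolding QB_def
  proof (rule Bochner_Integration.integral_cong[OF refl])
    fix x
    show "indicator (I \<times> \<omega>) x * (op x (grad (tens f p) x) \<bullet> grad (tens g z) x) = ?F1 x + ?F2 x + ?F3 x + ?F4 x"
      unfolding grad_tens[OF sf sp] grad_tens[OF sg sz] op_inner ind
      by (simp add: matrix_vector_mult_scaleR algebra_simps)
  qed
  also have "\<dots> = (LINT x|lborel. ?F1 x) + (LINT x|lborel. ?F2 x) + (LINT x|lborel. ?F3 x) + (LINT x|lborel. ?F4 x)"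
    using t1(1) t2(1) t3(1) t4(1) by simp
  finally show "QB I (tens f p) (tens g z) = int_on I (\<lambda>t. grad f t * grad g t) * fa p z + int_on I (\<lambda>t. f t * grad g t) * fb (grad p) z
      + int_on I (\<lambda>t. grad f t * g t) * fb (grad z) p + int_on I (\<lambda>t. f t * g t) * fm (grad p) (grad z)"
    unfolding t1(2) t2(2) t3(2) t4(2) b1(2,4,6) b2(4) int_on_def .
  have "NB I (tens f p) (tens g z) = (LINT x|lborel. (indicator I (fst x) * (f (fst x) * g (fst x))) * (indicator \<omega> (snd x) * (p (snd x) * z (snd x))))"
    unfolding NB_def by (rule Bochner_Integration.integral_cong[OF refl]) (simp add: ind tens_def mult_ac)
  then show "NB I (tens f p) (tens g z) = int_on I (\<lambda>t. f t * g t) * f0 p z"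
    unfolding t5(2) b1(8) int_on_def .
qed

lemma QN_diag: "Q I \<phi> = QB I \<phi> \<phi>" "N I \<phi> = NB I \<phi> \<phi>"
  by (simp_all add: Q_def QB_def N_def NB_def power2_eq_square)

text \<open>Functions constant along the axis are admissible, because nothing is prescribed at the
  ends; their axial and mixed terms vanish and the common length factor cancels.\<close>

lemma lambda1_le_mu1:
  assumes l: "l > 0"
  shows "lambda1 \<omega> a b M l \<le> mu1 \<omega> M"
proof (rule le_mu1)
  fix p assume p: "p \<in> test_functions \<omega>"
  \<comment> \<open>This plateau equals 1 up to |t| = 2l, so on (-l, l) it is constant with zero
    derivative, yet it has compact support.\<close>
  let ?f = "plateau (4 * l)" and ?I = "{-l<..<l}"
  have R: "4 * l > 0" using l by simp
  note P = plateau[OF R]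
  have 1: "indicator ?I t * (?f t * ?f t) = indicator ?I t" "indicator ?I t * (grad ?f t * grad ?f t) = 0"
    "indicator ?I t * (?f t * grad ?f t) = 0" "indicator ?I t * (grad ?f t * ?f t) = 0" for t
    using P(2,5)[of t] l by (auto simp: indicator_def abs_le_iff)
  have "int_on ?I (\<lambda>t. ?f t * ?f t) = 2 * l" "int_on ?I (\<lambda>t. grad ?f t * grad ?f t) = 0"
    "int_on ?I (\<lambda>t. ?f t * grad ?f t) = 0" "int_on ?I (\<lambda>t. grad ?f t * ?f t) = 0"
    unfolding int_on_def 1 using l by auto
  then have "Q ?I (tens ?f p) = 2 * l * fm (grad p) (grad p)" "N ?I (tens ?f p) = 2 * l * f0 p p"
    unfolding QN_diag tensor_forms[OF open_greaterThanLessThan P(4) P(4) p p] by simp_all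
  then have "lambda1 \<omega> a b M l * (2 * l * f0 p p) \<le> 2 * l * fm (grad p) (grad p)"
    using lambda1_le[OF l tens_T[OF P(4) p]] by simp
  then have "(2 * l) * (lambda1 \<omega> a b M l * f0 p p) \<le> (2 * l) * fm (grad p) (grad p)" by (simp add: mult_ac)
  then have "lambda1 \<omega> a b M l * f0 p p \<le> fm (grad p) (grad p)" using l by (simp only: mult_le_cancel_left_pos)
  then show "lambda1 \<omega> a b M l * (LINT X|L\<omega>. (p X)\<^sup>2) \<le> (LINT X|L\<omega>. (M X *v grad p X) \<bullet> grad p X)"
    by (simp add: f0_def fm_def power2_eq_square)
qed

end

section \<open>Trial functions on the half-cylinders\<close>

context cylinder begin

lemma T_integrable2:
  assumes "\<phi> \<in> T" "\<psi> \<in> T"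
  shows "integrable lborel (\<lambda>x. op x (grad \<phi> x) \<bullet> grad \<psi> x)" "integrable lborel (\<lambda>x. \<phi> x * \<psi> x)"
proof -
  note s = T_smooth[OF assms(1)] T_smooth[OF assms(2)]
  obtain K where K: "compact K" "\<forall>x. x \<notin> K \<longrightarrow> \<phi> x = 0 \<and> grad \<phi> x = 0" using test_support[OF assms(1)] by blast
  show "integrable lborel (\<lambda>x. \<phi> x * \<psi> x)"
    by (rule compact_support_integrable[OF continuous_on_mult[OF smooth_continuous[OF s(1)] smooth_continuous[OF s(2)]] K(1)]) (use K(2) in auto)
  have i: "integrable lborel (\<lambda>x. norm (grad \<phi> x) * norm (grad \<psi> x))"
    by (rule compact_support_integrable[OF continuous_on_mult[OF continuous_on_norm[OF continuous_grad[OF s(1)]] continuous_on_norm[OF continuous_grad[OF s(2)]]] K(1)])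
      (use K(2) in auto)
  show "integrable lborel (\<lambda>x. op x (grad \<phi> x) \<bullet> grad \<psi> x)"
  proof (rule Bochner_Integration.integrable_bound[of _ "\<lambda>x. C * (norm (grad \<phi> x) * norm (grad \<psi> x))"])
    show "integrable lborel (\<lambda>x. C * (norm (grad \<phi> x) * norm (grad \<psi> x)))" using i by simp
    show "(\<lambda>x. op x (grad \<phi> x) \<bullet> grad \<psi> x) \<in> borel_measurable lborel" using Q_measurable[OF s] by simp
    show "AE x in lborel. norm (op x (grad \<phi> x) \<bullet> grad \<psi> x) \<le> norm (C * (norm (grad \<phi> x) * norm (grad \<psi> x)))"
      unfolding real_norm_def by (intro AE_I2 order_trans[OF op_bound abs_ge_self])
  qed
qed

lemma QN_add:
  assumes I: "open I" and \<phi>: "\<phi> \<in> T" and \<psi>: "\<psi> \<in> T"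
  shows "Q I (\<lambda>x. \<phi> x + s * \<psi> x) = Q I \<phi> + 2 * s * QB I \<phi> \<psi> + s\<^sup>2 * Q I \<psi>"
    "N I (\<lambda>x. \<phi> x + s * \<psi> x) = N I \<phi> + 2 * s * NB I \<phi> \<psi> + s\<^sup>2 * N I \<psi>"
proof -
  note sm = T_smooth[OF \<phi>] T_smooth[OF \<psi>]
  have g: "grad (\<lambda>x. \<phi> x + s * \<psi> x) x = grad \<phi> x + s *\<^sub>R grad \<psi> x" for x
    unfolding grad_add[OF sm(1) smooth_mult[OF smooth_const sm(2)]] grad_scale[OF sm(2)] ..
  let ?i = "\<lambda>x. indicator (I \<times> \<omega>) x :: real"
  note ii = indicator_integrable[OF I]
  have "Q I (\<lambda>x. \<phi> x + s * \<psi> x) = (LINT x|lborel. ?i x * (op x (grad \<phi> x) \<bullet> grad \<phi> x) + 2 * s * (?i x * (op x (grad \<phi> x) \<bullet> grad \<psi> x))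
      + s\<^sup>2 * (?i x * (op x (grad \<psi> x) \<bullet> grad \<psi> x)))"
    unfolding Q_def g
  proof (rule Bochner_Integration.integral_cong[OF refl])
    fix x
    interpret linear "op x" by (rule linear_op)
    have "op x (u + s *\<^sub>R v) \<bullet> (u + s *\<^sub>R v) = op x u \<bullet> u + 2 * s * (op x u \<bullet> v) + s\<^sup>2 * (op x v \<bullet> v)" for u v
      using op_sym[of x v u] by (simp add: add scale inner_add_left inner_add_right power2_eq_square algebra_simps)
    then show "?i x * (op x (grad \<phi> x + s *\<^sub>R grad \<psi> x) \<bullet> (grad \<phi> x + s *\<^sub>R grad \<psi> x)) =
      ?i x * (op x (grad \<phi> x) \<bullet> grad \<phi> x) + 2 * s * (?i x * (op x (grad \<phi> x) \<bullet> grad \<psi> x)) + s\<^sup>2 * (?i x * (op x (grad \<psi> x) \<bullet> grad \<psi> x))"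
      by (simp add: algebra_simps)
  qed
  also have "\<dots> = Q I \<phi> + 2 * s * QB I \<phi> \<psi> + s\<^sup>2 * Q I \<psi>"
    unfolding Q_def QB_def using ii[OF T_integrable2(1)[OF \<phi> \<phi>]] ii[OF T_integrable2(1)[OF \<phi> \<psi>]] ii[OF T_integrable2(1)[OF \<psi> \<psi>]]
    by simp
  finally show "Q I (\<lambda>x. \<phi> x + s * \<psi> x) = Q I \<phi> + 2 * s * QB I \<phi> \<psi> + s\<^sup>2 * Q I \<psi>" .
  have "N I (\<lambda>x. \<phi> x + s * \<psi> x) = (LINT x|lborel. ?i x * (\<phi> x)\<^sup>2 + 2 * s * (?i x * (\<phi> x * \<psi> x)) + s\<^sup>2 * (?i x * (\<psi> x)\<^sup>2))"
    unfolding N_def by (rule Bochner_Integration.integral_cong[OF refl]) (simp add: power2_eq_square algebra_simps)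
  also have "\<dots> = N I \<phi> + 2 * s * NB I \<phi> \<psi> + s\<^sup>2 * N I \<psi>"
    unfolding N_def NB_def using ii[OF T_integrable(2)[OF \<phi>]] ii[OF T_integrable2(2)[OF \<phi> \<psi>]] ii[OF T_integrable(2)[OF \<psi>]]
    by simp
  finally show "N I (\<lambda>x. \<phi> x + s * \<psi> x) = N I \<phi> + 2 * s * NB I \<phi> \<psi> + s\<^sup>2 * N I \<psi>" .
qed

lemma base_add:
  assumes p: "p \<in> test_functions \<omega>" and z: "z \<in> test_functions \<omega>"
  shows "fm (grad (\<lambda>x. p x + s * z x)) (grad (\<lambda>x. p x + s * z x)) = fm (grad p) (grad p) + 2 * s * fm (grad p) (grad z) + s\<^sup>2 * fm (grad z) (grad z)"
    "f0 (\<lambda>x. p x + s * z x) (\<lambda>x. p x + s * z x) = f0 p p + 2 * s * f0 p z + s\<^sup>2 * f0 z z"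
proof -
  note sm = test_smooth[OF p] test_smooth[OF z]
  have g: "grad (\<lambda>x. p x + s * z x) x = grad p x + s *\<^sub>R grad z x" for x
    unfolding grad_add[OF sm(1) smooth_mult[OF smooth_const sm(2)]] grad_scale[OF sm(2)] ..
  have pz: "(\<lambda>x. p x + s * z x) \<in> test_functions \<omega>" by (rule test_add[OF p test_scale[OF z]])
  let ?i = "\<lambda>x. indicator \<omega> x :: real"
  have "fm (grad (\<lambda>x. p x + s * z x)) (grad (\<lambda>x. p x + s * z x)) =
    (LINT X|lborel. ?i X * ((M X *v grad p X) \<bullet> grad p X) + 2 * s * (?i X * ((M X *v grad p X) \<bullet> grad z X)) + s\<^sup>2 * (?i X * ((M X *v grad z X) \<bullet> grad z X)))"
    unfolding base_integrals(6)[OF pz pz] g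
  proof (rule Bochner_Integration.integral_cong[OF refl])
    fix X
    show "?i X * ((M X *v (grad p X + s *\<^sub>R grad z X)) \<bullet> (grad p X + s *\<^sub>R grad z X)) =
      ?i X * ((M X *v grad p X) \<bullet> grad p X) + 2 * s * (?i X * ((M X *v grad p X) \<bullet> grad z X)) + s\<^sup>2 * (?i X * ((M X *v grad z X) \<bullet> grad z X))"
      using M_sym[of X "grad z X" "grad p X"]
      by (simp add: matrix_vector_right_distrib matrix_vector_mult_scaleR inner_add_left inner_add_right power2_eq_square algebra_simps)
  qed
  also have "\<dots> = fm (grad p) (grad p) + 2 * s * fm (grad p) (grad z) + s\<^sup>2 * fm (grad z) (grad z)"
    unfolding base_integrals(6)[OF p p] base_integrals(6)[OF p z] base_integrals(6)[OF z z]
    using base_integrals(5)[OF p p] base_integrals(5)[OF p z] base_integrals(5)[OF z z] by simp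
  finally show "fm (grad (\<lambda>x. p x + s * z x)) (grad (\<lambda>x. p x + s * z x)) = fm (grad p) (grad p) + 2 * s * fm (grad p) (grad z) + s\<^sup>2 * fm (grad z) (grad z)" .
  have "f0 (\<lambda>x. p x + s * z x) (\<lambda>x. p x + s * z x) =
    (LINT X|lborel. ?i X * (p X * p X) + 2 * s * (?i X * (p X * z X)) + s\<^sup>2 * (?i X * (z X * z X)))"
    unfolding base_integrals(8)[OF pz pz]
    by (rule Bochner_Integration.integral_cong[OF refl]) (simp add: power2_eq_square algebra_simps)
  also have "\<dots> = f0 p p + 2 * s * f0 p z + s\<^sup>2 * f0 z z"
    unfolding base_integrals(8)[OF p p] base_integrals(8)[OF p z] base_integrals(8)[OF z z]
    using base_integrals(7)[OF p p] base_integrals(7)[OF p z] base_integrals(7)[OF z z] by simp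
  finally show "f0 (\<lambda>x. p x + s * z x) (\<lambda>x. p x + s * z x) = f0 p p + 2 * s * f0 p z + s\<^sup>2 * f0 z z" .
qed

lemma mu1_le_forms: "p \<in> test_functions \<omega> \<Longrightarrow> mu1 \<omega> M * f0 p p \<le> fm (grad p) (grad p)"
  using mu1_le by (simp add: f0_def fm_def power2_eq_square)

lemma test_base_sqint: "z \<in> test_functions \<omega> \<Longrightarrow> sqint L\<omega> z" "z \<in> test_functions \<omega> \<Longrightarrow> sqint L\<omega> (grad z)"
  using test_sqint[OF open_\<omega> test_mono] by auto

end

locale eigen = cylinder \<omega> a b M C lam
  for \<omega> :: "(real^'n) set" and a b M C lam +
  fixes W :: "real^'n \<Rightarrow> real" and p :: "nat \<Rightarrow> real^'n \<Rightarrow> real" and G :: "real^'n \<Rightarrow> real^'n"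
  assumes p: "\<And>k. p k \<in> test_functions \<omega>" and pW: "L2conv L\<omega> p W" and pG: "L2conv L\<omega> (\<lambda>k. grad (p k)) G"
    and eig: "fm G G = mu1 \<omega> M * f0 W W"
begin

abbreviation "\<mu> \<equiv> mu1 \<omega> M"

text \<open>First variation at the minimum. The inequality defining \<mu> is applied to p k + s z;
  in the limit the term of order zero in s vanishes by \<open>eig\<close>, so the linear one must
  vanish too.\<close>

lemma euler_lagrange:
  assumes z: "z \<in> test_functions \<omega>"
  shows "fm G (grad z) = \<mu> * f0 W z"
proof -
  have "0 \<le> s * (2 * (fm G (grad z) - \<mu> * f0 W z)) + s\<^sup>2 * (fm (grad z) (grad z) - \<mu> * f0 z z)" for s
  proof -
    let ?e = "\<lambda>k. (fm (grad (p k)) (grad (p k)) - \<mu> * f0 (p k) (p k)) + s * (2 * (fm (grad (p k)) (grad z) - \<mu> * f0 (p k) z)) + s\<^sup>2 * (fm (grad z) (grad z) - \<mu> * f0 z z)"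
    have "0 \<le> ?e k" for k
      using mu1_le_forms[OF test_add[OF p[of k] test_scale[OF z, of s]]]
      unfolding base_add[OF p z] by (simp add: algebra_simps)
    moreover have "?e \<longlonglongrightarrow> (fm G G - \<mu> * f0 W W) + s * (2 * (fm G (grad z) - \<mu> * f0 W z)) + s\<^sup>2 * (fm (grad z) (grad z) - \<mu> * f0 z z)"
      by (intro tendsto_intros conv_m[OF pG pG] conv_0[OF pW pW]
          conv_m[OF pG L2conv_const[OF test_base_sqint(2)[OF z]]] conv_0[OF pW L2conv_const[OF test_base_sqint(1)[OF z]]])
    ultimately have "0 \<le> (fm G G - \<mu> * f0 W W) + s * (2 * (fm G (grad z) - \<mu> * f0 W z)) + s\<^sup>2 * (fm (grad z) (grad z) - \<mu> * f0 z z)"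
      by (intro LIMSEQ_le_const) auto
    then show ?thesis using eig by simp
  qed
  from linear_coefficient_zero[OF this] show ?thesis by simp
qed

text \<open>The essential point is that \<open>K\<close> is independent of \<delta>: the inequality
  then bounds a quadratic polynomial in \<delta> whose lower coefficients are explicit. The sign
  \<sigma> records on which side of 0 the half-cylinder lies.\<close>

lemma half_cylinder_inequality:
  assumes I: "I = {0<..} \<and> \<sigma> = 1 \<or> I = {..<0} \<and> \<sigma> = -1" and nu: "\<mu> \<le> nu I \<omega> a b M" and z: "z \<in> test_functions \<omega>"
  shows "\<exists>K. \<forall>\<delta>. 0 \<le> - \<sigma> * fb G W - 2 * \<delta> * \<sigma> * fb G z + \<delta>\<^sup>2 * K"
proof -
  have oI: "open I" "I \<noteq> {}" and Ib: "I \<in> sets borel"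
    using I gt_ex[of "0::real"] lt_ex[of "0::real"] by auto
  define g where "g = plateau 1"
  have one: "(1::real) > 0" by simp
  note Pg = plateau[OF one, folded g_def]
  define K where "K = Q I (tens g z) - \<mu> * N I (tens g z)"
  obtain L where L: "\<And>t. norm (grad bump t) \<le> L"
  proof -
    have zz: "grad bump t = 0" if "t \<notin> {-1..1}" for t
      by (rule grad_eq_0_off[of "{-1..1}"]) (use that bump(3) in auto)
    show ?thesis using compact_support_bounded[OF continuous_grad[OF bump(1)] compact_Icc zz] that by blast
  qed
  have half: "int_on I (grad h) = - \<sigma> * h 0" if "smooth h" "R > 0" "\<And>t. \<bar>t\<bar> \<ge> R \<Longrightarrow> h t = 0" for h R
    using I integral_derivative_half_line[OF that] unfolding int_on_def by auto
  have main: "0 \<le> (2 * L\<^sup>2 / R) * \<bar>fa W W\<bar> + (- \<sigma> * fb G W - 2 * \<delta> * \<sigma> * fb G z + \<delta>\<^sup>2 * K)" if R: "R > 2" for R \<delta>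
  proof -
    define f where "f = plateau R"
    have R0: "R > 0" using R by simp
    note Pf = plateau[OF R0, folded f_def]
    \<comment> \<open>For R > 2 the wide plateau equals 1 with zero derivative wherever g or its
      derivative is nonzero, so of the axial coefficients of the mixed term only the integrals of g'
      and of f g survive.\<close>
    have q: "grad f t * grad g t = 0" "f t * grad g t = grad g t" "grad f t * g t = 0" for t
      using Pf(2,5)[of t] Pg(3,6)[of t] R by (cases "\<bar>t\<bar> > 1"; force)+
    define \<alpha> where "\<alpha> = int_on I (\<lambda>t. grad f t * grad f t)"
    define \<beta> where "\<beta> = int_on I (\<lambda>t. f t * grad f t)"
    define \<gamma> where "\<gamma> = int_on I (\<lambda>t. f t * f t)"
    define \<eta> where "\<eta> = int_on I (\<lambda>t. f t * g t)"
    \<comment> \<open>Here f f' is half the derivative of f^2, and f(0) = 1: the boundary value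
      alone determines \<beta>, independently of R.\<close>
    have \<beta>: "2 * \<beta> = - \<sigma>"
    proof -
      have s2: "smooth (\<lambda>t. f t * f t)" by (intro smooth_mult Pf(1))
      have "int_on I (grad (\<lambda>t. f t * f t)) = - \<sigma> * (f 0 * f 0)"
        by (rule half[OF s2 R0]) (simp add: Pf(3))
      moreover have "int_on I (grad (\<lambda>t. f t * f t)) = 2 * \<beta>"
        unfolding \<beta>_def int_on_def grad_mult[OF Pf(1) Pf(1)]
        by (subst integral_mult_right_zero[symmetric]) (simp add: mult_ac)
      ultimately show ?thesis using Pf(2)[of 0] R0 by simp
    qed
    have g1: "int_on I (grad g) = - \<sigma>" using half[OF Pg(1) one Pg(3)] Pg(2)[of 0] by simp
    have \<beta>': "int_on I (\<lambda>t. grad f t * f t) = \<beta>" unfolding \<beta>_def by (simp add: mult.commute)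
    \<comment> \<open>The slope is at most L/R on an interval of length 2R, so the axial energy
      decays like 1/R.\<close>
    have \<alpha>_le: "\<alpha> \<le> 2 * L\<^sup>2 / R"
    proof -
      have "\<alpha> \<le> (LINT t|lborel. indicator {-R..R} t * (L / R)\<^sup>2)"
        unfolding \<alpha>_def int_on_def
      proof (rule integral_mono)
        show "integrable lborel (\<lambda>t. indicator I t * (grad f t * grad f t))"
          by (rule test_integrable_on[OF continuous_on_mult[OF continuous_grad continuous_grad] _ Ib, OF Pf(1) Pf(1), of R])
            (simp add: Pf(6))
        have "integrable lborel (\<lambda>t. indicator {-R..R} t :: real)"
          by (rule integrable_real_indicator) (simp_all add: emeasure_lborel_Icc_eq)
        then show "integrable lborel (\<lambda>t. indicator {-R..R} t * (L / R)\<^sup>2)" by (rule integrable_mult_left)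
        fix t
        have "(grad f t)\<^sup>2 \<le> (L / R)\<^sup>2"
          unfolding Pf(7) abs_le_square_iff[symmetric]
          using L[of "t * (1 / R)"] R0 by (simp add: abs_mult divide_right_mono)
        moreover have "grad f t = 0" if "t \<notin> {-R..R}" using Pf(6)[of t] that by auto
        ultimately show "indicator I t * (grad f t * grad f t) \<le> indicator {-R..R} t * (L / R)\<^sup>2"
          by (auto simp: indicator_def power2_eq_square)
      qed
      also have "\<dots> = 2 * L\<^sup>2 / R" using R0 by (simp add: power2_eq_square field_simps)
      finally show ?thesis .
    qed
    have \<alpha>0: "\<alpha> \<ge> 0" unfolding \<alpha>_def int_on_def by (intro integral_nonneg_AE AE_I2) (simp add: indicator_def)
    \<comment> \<open>The two brackets multiplied by \<gamma> and \<eta> become zero in the limit,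
      the first by the eigenvalue identity and the second by the Euler-Lagrange equation. Since
      \<gamma> grows with R, k has to tend to infinity before R.\<close>
    let ?E = "\<lambda>k. \<alpha> * fa (p k) (p k) + (- \<sigma>) * fb (grad (p k)) (p k) + \<gamma> * (fm (grad (p k)) (grad (p k)) - \<mu> * f0 (p k) (p k))
        + 2 * \<delta> * (- \<sigma> * fb (grad (p k)) z + \<eta> * (fm (grad (p k)) (grad z) - \<mu> * f0 (p k) z)) + \<delta>\<^sup>2 * K"
    have "0 \<le> ?E k" for k
    proof -
      have t: "tens f (p k) \<in> T" "tens g z \<in> T" by (intro tens_T Pf(4) Pg(4) p z)+
      have u: "(\<lambda>x. tens f (p k) x + \<delta> * tens g z x) \<in> T" by (rule test_add[OF t(1) test_scale[OF t(2)]])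
      have "\<mu> * N I (\<lambda>x. tens f (p k) x + \<delta> * tens g z x) \<le> nu I \<omega> a b M * N I (\<lambda>x. tens f (p k) x + \<delta> * tens g z x)"
        by (rule mult_right_mono[OF nu N_nonneg])
      also have "\<dots> \<le> Q I (\<lambda>x. tens f (p k) x + \<delta> * tens g z x)" by (rule nu_le[OF oI u])
      finally have le: "\<mu> * (N I (tens f (p k)) + 2 * \<delta> * NB I (tens f (p k)) (tens g z) + \<delta>\<^sup>2 * N I (tens g z))
         \<le> Q I (tens f (p k)) + 2 * \<delta> * QB I (tens f (p k)) (tens g z) + \<delta>\<^sup>2 * Q I (tens g z)"
        unfolding QN_add[OF oI(1) t] .
      have i0: "int_on I (\<lambda>t. 0) = 0" by (simp add: int_on_def)
      have e1: "Q I (tens f (p k)) = \<alpha> * fa (p k) (p k) + (- \<sigma>) * fb (grad (p k)) (p k) + \<gamma> * fm (grad (p k)) (grad (p k))"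
        unfolding QN_diag(1) tensor_forms(1)[OF oI(1) Pf(4) Pf(4) p p] \<beta>' \<alpha>_def[symmetric] \<beta>_def[symmetric] \<gamma>_def[symmetric] \<beta>[symmetric]
        by (simp add: algebra_simps)
      have e2: "N I (tens f (p k)) = \<gamma> * f0 (p k) (p k)"
        unfolding QN_diag(2) tensor_forms(2)[OF oI(1) Pf(4) Pf(4) p p] \<gamma>_def ..
      have e3: "QB I (tens f (p k)) (tens g z) = - \<sigma> * fb (grad (p k)) z + \<eta> * fm (grad (p k)) (grad z)"
        unfolding tensor_forms(1)[OF oI(1) Pf(4) Pg(4) p z] q i0 \<eta>_def[symmetric] using g1 by simp
      have e4: "NB I (tens f (p k)) (tens g z) = \<eta> * f0 (p k) z"
        unfolding tensor_forms(2)[OF oI(1) Pf(4) Pg(4) p z] \<eta>_def ..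
      show ?thesis using le unfolding e1 e2 e3 e4 K_def by (simp add: algebra_simps)
    qed
    moreover have "?E \<longlonglongrightarrow> \<alpha> * fa W W + (- \<sigma>) * fb G W + \<gamma> * (fm G G - \<mu> * f0 W W)
        + 2 * \<delta> * (- \<sigma> * fb G z + \<eta> * (fm G (grad z) - \<mu> * f0 W z)) + \<delta>\<^sup>2 * K"
      by (intro tendsto_intros conv_a[OF pW pW] conv_b[OF pG pW] conv_m[OF pG pG] conv_0[OF pW pW]
          conv_b[OF pG L2conv_const[OF test_base_sqint(1)[OF z]]]
          conv_m[OF pG L2conv_const[OF test_base_sqint(2)[OF z]]] conv_0[OF pW L2conv_const[OF test_base_sqint(1)[OF z]]])
    ultimately have "0 \<le> \<alpha> * fa W W + (- \<sigma>) * fb G W + \<gamma> * (fm G G - \<mu> * f0 W W)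
        + 2 * \<delta> * (- \<sigma> * fb G z + \<eta> * (fm G (grad z) - \<mu> * f0 W z)) + \<delta>\<^sup>2 * K"
      by (intro LIMSEQ_le_const) auto
    then have "0 \<le> \<alpha> * fa W W + (- \<sigma> * fb G W - 2 * \<delta> * \<sigma> * fb G z + \<delta>\<^sup>2 * K)"
      unfolding eig euler_lagrange[OF z] by (simp add: algebra_simps)
    moreover have "\<alpha> * fa W W \<le> (2 * L\<^sup>2 / R) * \<bar>fa W W\<bar>"
      using mult_right_mono[OF \<alpha>_le abs_ge_zero[of "fa W W"]] mult_left_mono[OF abs_ge_self[of "fa W W"] \<alpha>0] by linarith
    ultimately show ?thesis by linarith
  qed
  show ?thesis
  proof (intro exI allI)
    fix \<delta>
    let ?c = "- \<sigma> * fb G W - 2 * \<delta> * \<sigma> * fb G z + \<delta>\<^sup>2 * K"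
    have "((\<lambda>R. (2 * L\<^sup>2 * inverse R) * \<bar>fa W W\<bar> + ?c) \<longlongrightarrow> (2 * L\<^sup>2 * 0) * \<bar>fa W W\<bar> + ?c) at_top"
      by (intro tendsto_intros tendsto_inverse_0_at_top filterlim_ident)
    then have lim: "((\<lambda>R. (2 * L\<^sup>2 * inverse R) * \<bar>fa W W\<bar> + ?c) \<longlongrightarrow> ?c) at_top" by simp
    show "0 \<le> ?c"
    proof (rule tendsto_lowerbound[OF lim])
      show "\<forall>\<^sub>F R in at_top. 0 \<le> (2 * L\<^sup>2 * inverse R) * \<bar>fa W W\<bar> + ?c"
        using eventually_gt_at_top[of 2]
      proof eventually_elim
        case (elim R)
        then show ?case using main[of R \<delta>] by (simp add: divide_inverse)
      qed
    qed simp
  qed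
qed

lemma no_gap_imp_orthogonal:
  assumes "\<mu> \<le> nu_plus \<omega> a b M" "\<mu> \<le> nu_minus \<omega> a b M" and z: "z \<in> test_functions \<omega>"
  shows "fb G z = 0"
proof -
  have 1: "{0<..} = {0<..} \<and> (1::real) = 1 \<or> {0<..} = {..<(0::real)} \<and> (1::real) = -1"
    and 2: "{..<0} = {0<..} \<and> (-1::real) = 1 \<or> {..<0} = {..<(0::real)} \<and> (-1::real) = -1" by auto
  obtain K where K: "\<And>\<delta>. 0 \<le> - 1 * fb G W - 2 * \<delta> * 1 * fb G z + \<delta>\<^sup>2 * K"
    using half_cylinder_inequality[OF 1 assms(1) z] by blast
  obtain K' where K': "\<And>\<delta>. 0 \<le> - (-1) * fb G W - 2 * \<delta> * (-1) * fb G z + \<delta>\<^sup>2 * K'"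
    using half_cylinder_inequality[OF 2 assms(2) z] by blast
  \<comment> \<open>Opposite values of \<delta> on the two sides make the linear terms add up, while
    the term \<open>fb G W\<close>, whose sign is unknown, cancels.\<close>
  have "0 \<le> s * (-4 * fb G z) + s\<^sup>2 * (K + K')" for s
    using K[of s] K'[of "-s"] by (simp add: algebra_simps)
  from linear_coefficient_zero[OF this] show ?thesis by simp
qed

text \<open>On the bounded set \<omega> the constant 1 is square-integrable, so the
  square-integrable field \<open>G\<close> is integrable and dominates \<open>h\<close>.\<close>

lemma dominated_locally_integrable:
  assumes h: "h \<in> borel_measurable L\<omega>" and le: "\<And>X. \<bar>h X\<bar> \<le> C * norm (G X)"
  shows "locally_integrable \<omega> h"
  unfolding locally_integrable_def
proof safe
  fix K assume K: "compact K" "K \<subseteq> \<omega>"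
  have G: "sqint L\<omega> G" using pG by (simp add: L2conv_def)
  have Kl: "K \<in> sets lebesgue" using K(1) by (simp add: borel_compact)
  have m1: "emeasure L\<omega> \<omega> < \<infinity>"
    using emeasure_bounded_finite[OF bdd] open_\<omega> by (simp add: emeasure_restrict_space open_in_lebesgue)
  have c1: "integrable L\<omega> (\<lambda>X. 1::real)"
  proof -
    interpret finite_measure L\<omega> by (rule finite_measureI) (use m1 in \<open>simp add: space_restrict_space\<close>)
    show ?thesis by simp
  qed
  have "sqint L\<omega> (\<lambda>X. 1::real)" using c1 by (simp add: sqint_def)
  from sqint_prod_integrable[OF G this] have "integrable L\<omega> (\<lambda>X. C * norm (G X))" by simp
  then have "integrable L\<omega> h"
    by (rule Bochner_Integration.integrable_bound[OF _ h])
      (intro AE_I2, simp only: real_norm_def, rule order_trans[OF le abs_ge_self])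
  then have "integrable lebesgue (\<lambda>x. indicator \<omega> x * h x)" by (simp add: integrable_restrict_space open_in_lebesgue open_\<omega>)
  from integrable_mult_indicator[OF Kl this]
  have "integrable lebesgue (\<lambda>x. indicator K x *\<^sub>R (indicator \<omega> x * h x))" .
  moreover have "(\<lambda>x. indicator K x *\<^sub>R (indicator \<omega> x * h x)) = (\<lambda>x. indicator K x *\<^sub>R h x)"
    using K(2) by (auto simp: indicator_def fun_eq_iff)
  ultimately show "integrable (lebesgue_on K) h" using Kl by (simp add: integrable_restrict_space)
qed

lemma orthogonal_imp_AE_zero:
  assumes "\<And>z. z \<in> test_functions \<omega> \<Longrightarrow> fb G z = 0"
  shows "AE X in L\<omega>. b X \<bullet> G X = 0"
proof (rule fundamental_lemma[OF open_\<omega>])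
  have G: "G \<in> borel_measurable L\<omega>" using pG by (simp add: L2conv_def sqint_def)
  show "locally_integrable \<omega> (\<lambda>X. b X \<bullet> G X)"
    by (rule dominated_locally_integrable) (use G meas_on b_bound[of _ "G _" 1] in auto)
qed (use assms in \<open>simp add: fb_def\<close>)

end

section \<open>Picone's inequality\<close>

definition hypot1 :: "real \<Rightarrow> real" where "hypot1 t = sqrt (1 + t\<^sup>2)"

lemma hypot1_pos: "hypot1 t > 0" unfolding hypot1_def by (intro real_sqrt_gt_zero add_pos_nonneg) auto

lemma hypot1_sq: "(hypot1 t)\<^sup>2 = 1 + t\<^sup>2" unfolding hypot1_def by (intro real_sqrt_pow2 add_nonneg_nonneg) auto

lemma hypot1_ge: "\<bar>t\<bar> \<le> hypot1 t" unfolding hypot1_def by (rule real_le_rsqrt) simp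

lemma hypot1_deriv: "(hypot1 has_real_derivative t * inverse (hypot1 t)) (at t)"
proof -
  have "((\<lambda>t. 1 + t\<^sup>2) has_real_derivative 2 * t) (at t)" by (auto intro!: derivative_eq_intros)
  moreover have "1 + t\<^sup>2 > 0" by (intro add_pos_nonneg) auto
  ultimately have "((\<lambda>t. sqrt (1 + t\<^sup>2)) has_real_derivative (inverse (sqrt (1 + t\<^sup>2)) / 2) * (2 * t)) (at t)"
    by (intro DERIV_chain2[OF DERIV_real_sqrt])
  then show ?thesis by (simp add: hypot1_def[abs_def] mult.commute)
qed

text \<open>Bootstrapping: the derivative t / \<open>hypot1 t\<close> is as regular as
  \<open>hypot1\<close> itself.\<close>

lemma smooth_hypot1: "smooth hypot1"
  unfolding smooth_def
proof
  fix k show "C_k k hypot1"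
  proof (induction k)
    case 0
    show ?case by (simp add: continuous_at_imp_continuous_on DERIV_isCont[OF hypot1_deriv])
  next
    case (Suc k)
    show ?case
      by (rule C_k_realI[OF hypot1_deriv C_k_mult[OF C_k_id C_k_inverse[OF _ Suc]]]) (use hypot1_pos less_irrefl in metis)
  qed
qed

text \<open>A smooth substitute for \<open>t + 1\<close> that stays bounded away from zero on the whole line: on the
  half-line \<open>t \<ge> 0\<close> it still has slope at least \<open>1\<close>, and the excess over \<open>t\<close> is bounded.\<close>

definition soft :: "real \<Rightarrow> real" where "soft t = t / 2 + hypot1 t / 2 + arctan t / 2 + 2"

definition soft' :: "real \<Rightarrow> real" where "soft' t = 1 / 2 + t * inverse (hypot1 t) / 2 + inverse (1 + t\<^sup>2) / 2"

lemma soft_deriv: "(soft has_real_derivative soft' t) (at t)"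
  unfolding soft_def[abs_def] soft'_def
  by (rule derivative_eq_intros hypot1_deriv refl | simp)+

lemma smooth_soft: "smooth soft"
proof (rule smooth_realI[OF soft_deriv])
  have n: "hypot1 t \<noteq> 0" "1 + t * t \<noteq> 0" for t
    using hypot1_pos[of t] by (auto simp: add_nonneg_eq_0_iff)
  have "smooth (\<lambda>t. 1/2 + (t * inverse (hypot1 t)) * (1/2) + inverse (1 + t * t) * (1/2))"
    by (intro smooth_mult smooth_add smooth_const smooth_id smooth_inverse smooth_hypot1 n)
  then show "smooth soft'" by (simp add: soft'_def[abs_def] power2_eq_square)
qed

text \<open>The summand 2 compensates arctan t / 2 > - pi/4 > -1; the two algebraic terms together
  are nonnegative.\<close>

lemma soft_ge_1: "soft t \<ge> 1"
proof -
  have "- (pi / 2) < arctan t" by (rule arctan_lbound)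
  moreover have "pi < 4" by (rule pi_less_4)
  moreover have "0 \<le> t + hypot1 t" using hypot1_ge[of t] by linarith
  ultimately show ?thesis unfolding soft_def by linarith
qed

lemma soft_bounds: "t \<ge> 0 \<Longrightarrow> t \<le> soft t" "t \<ge> 0 \<Longrightarrow> soft t \<le> t + 4"
proof -
  assume t: "t \<ge> 0"
  then have "0 \<le> arctan t" by simp
  then show "t \<le> soft t" using hypot1_ge[of t] t unfolding soft_def by linarith
  have "hypot1 t \<le> t + 1" unfolding hypot1_def by (rule real_le_lsqrt) (use t in \<open>auto simp: power2_sum\<close>)
  moreover have "arctan t < pi / 2" by (rule arctan_ubound)
  moreover have "pi < 4" by (rule pi_less_4)
  ultimately show "soft t \<le> t + 4" unfolding soft_def by linarith
qed

text \<open>With r = \<open>hypot1 t\<close> one has t r + 1 >= t^2 + 1 = r^2, that is t/r + 1/r^2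
  >= 1. The second summand is the derivative of the arctangent, which is why that term is part of
  \<open>soft\<close>.\<close>

lemma soft'_ge_1: "t \<ge> 0 \<Longrightarrow> soft' t \<ge> 1"
proof -
  assume t: "t \<ge> 0"
  have r: "hypot1 t > 0" by (rule hypot1_pos)
  have "t * t \<le> t * hypot1 t" using hypot1_ge[of t] t by (intro mult_left_mono) auto
  then have "(hypot1 t)\<^sup>2 \<le> t * hypot1 t + 1" unfolding hypot1_sq by (simp add: power2_eq_square)
  then have "1 \<le> (t * hypot1 t + 1) / (hypot1 t)\<^sup>2" using r by (simp add: le_divide_eq)
  also have "\<dots> = t * inverse (hypot1 t) + inverse ((hypot1 t)\<^sup>2)" using r by (simp add: field_simps power2_eq_square)
  finally show ?thesis unfolding soft'_def hypot1_sq by linarith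
qed

lemma soft'_bound: "\<bar>soft' t\<bar> \<le> 2"
proof -
  have "\<bar>t * inverse (hypot1 t)\<bar> \<le> 1" using hypot1_ge[of t] hypot1_pos[of t] by (simp add: abs_mult field_simps)
  moreover have "0 \<le> inverse (1 + t\<^sup>2)" by (simp add: add_nonneg_nonneg)
  moreover have "inverse (1 + t\<^sup>2) \<le> 1" by (rule inverse_le_1_iff[THEN iffD2]) auto
  ultimately show ?thesis unfolding soft'_def by linarith
qed

text \<open>Approaches 1/t from below for t > 0 as n grows. It keeps the inequality r' <= - r^2 for
  t >= 0, an equality for 1/t and the property that Picone's inequality rests on. For fixed n, r and
  r' are bounded on the whole line, as needed for composition with the possibly negative
  \<open>p k\<close>.\<close>

definition recip :: "real \<Rightarrow> real \<Rightarrow> real" where "recip n t = n * inverse (soft (n * t))"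

lemma recip:
  assumes n: "n > 0"
  shows "smooth (recip n)" "0 \<le> recip n t" "recip n t \<le> n" "\<bar>grad (recip n) t\<bar> \<le> 2 * n\<^sup>2"
    "t \<ge> 0 \<Longrightarrow> grad (recip n) t \<le> - (recip n t)\<^sup>2" "t \<ge> 0 \<Longrightarrow> t * recip n t \<le> 1" "t > 0 \<Longrightarrow> 1 - 4 / (n * t) \<le> t * recip n t"
proof -
  have p: "soft t > 0" "soft t \<noteq> 0" for t using soft_ge_1[of t] by auto
  have s: "smooth (\<lambda>t. soft (n * t))" by (rule smooth_linear[OF smooth_soft bounded_linear_mult_right])
  show "smooth (recip n)" unfolding recip_def[abs_def]
    by (rule smooth_mult[OF smooth_const smooth_inverse[OF s p(2)]])
  show "0 \<le> recip n t" unfolding recip_def using n p(1)[of "n * t"] by simp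
  show "recip n t \<le> n" unfolding recip_def using n soft_ge_1[of "n * t"] by (simp add: field_simps)
  have "((\<lambda>t. soft (n * t)) has_real_derivative soft' (n * t) * n) (at t)"
    by (rule DERIV_chain2[OF soft_deriv]) (auto intro!: derivative_eq_intros)
  from DERIV_cmult[OF DERIV_inverse_fun[OF this p(2)], of n]
  have "(recip n has_real_derivative n * - (inverse (soft (n * t)) * (soft' (n * t) * n) * inverse (soft (n * t)))) (at t)"
    unfolding recip_def[abs_def] by (simp add: power2_eq_square mult_ac)
  then have g: "grad (recip n) t = - (soft' (n * t) * (recip n t)\<^sup>2)"
    by (simp add: grad_real recip_def power2_eq_square mult_ac)
  have "(recip n t)\<^sup>2 \<le> n\<^sup>2" using \<open>0 \<le> recip n t\<close> \<open>recip n t \<le> n\<close> by (rule power_mono[rotated])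
  then show "\<bar>grad (recip n) t\<bar> \<le> 2 * n\<^sup>2" unfolding g using soft'_bound[of "n * t"]
    by (simp add: abs_mult mult_mono)
  show "grad (recip n) t \<le> - (recip n t)\<^sup>2" if "t \<ge> 0" unfolding g
    using mult_right_mono[OF soft'_ge_1[of "n * t"] zero_le_power2[of "recip n t"]] n that by simp
  show "t * recip n t \<le> 1" if "t \<ge> 0"
    unfolding recip_def using soft_bounds(1)[of "n * t"] n that p(1)[of "n * t"] by (simp add: field_simps)
  \<comment> \<open>The 4 comes from \<open>soft t\<close> <= t + 4: the quantity is at least nt/(nt
    + 4).\<close>
  show "1 - 4 / (n * t) \<le> t * recip n t" if t: "t > 0"
  proof -
    have nt: "n * t > 0" using n t by simp
    have "1 - 4 / (n * t) \<le> (n * t) / (n * t + 4)"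
      using nt by (simp add: field_simps)
    also have "\<dots> \<le> (n * t) / soft (n * t)"
      by (rule divide_left_mono) (use soft_bounds(2)[of "n * t"] nt p(1)[of "n * t"] in auto)
    finally show ?thesis unfolding recip_def by (simp add: field_simps)
  qed
qed

text \<open>Almost everywhere convergence carries limits through nonlinear functions of
  \<open>p k\<close>; positivity gives psi^2/W a meaning; orthogonality removes the coupling between
  the axial derivative and \<open>G\<close>.\<close>

locale positive_eigen = eigen \<omega> a b M C lam W p G
  for \<omega> :: "(real^'n) set" and a b M C lam W p G +
  assumes ae_conv: "AE X in lebesgue_on \<omega>. (\<lambda>k. p k X) \<longlonglongrightarrow> W X"
    and pos: "AE X in lebesgue_on \<omega>. W X > 0"
    and orth: "AE X in lebesgue_on \<omega>. b X \<bullet> G X = 0"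
begin

lemma L2_facts: "sqint L\<omega> W" "sqint L\<omega> G" "W \<in> borel_measurable L\<omega>" "G \<in> borel_measurable L\<omega>"
  "sqint L\<omega> (p k)" "sqint L\<omega> (grad (p k))" "p k \<in> borel_measurable L\<omega>" "grad (p k) \<in> borel_measurable L\<omega>"
  using pW pG by (auto simp: L2conv_def sqint_def)

lemma on_measurable: "f \<in> borel_measurable borel \<Longrightarrow> f \<in> borel_measurable L\<omega>"
  by (intro measurable_restrict_space1 measurable_completion) simp

lemma compose_measurable:
  fixes g :: "real \<Rightarrow> real"
  shows "continuous_on UNIV g \<Longrightarrow> f \<in> borel_measurable L\<omega> \<Longrightarrow> (\<lambda>X. g (f X)) \<in> borel_measurable L\<omega>"
  using measurable_compose[OF _ borel_of_continuous] by blast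

text \<open>The equation of \<open>W\<close> tested with r(W) psi^2, where r is
  \<open>recip n\<close>. Since \<open>W\<close> is not smooth, the actual test function is r(p k)
  psi^2, and the product rule is applied before the limit in k.\<close>

lemma picone_weak:
  assumes \<psi>: "\<psi> \<in> test_functions \<omega>" and n: "n > 0"
  shows "(LINT X|L\<omega>. recip n (W X) * (2 * \<psi> X * ((M X *v G X) \<bullet> grad \<psi> X))) +
      (LINT X|L\<omega>. grad (recip n) (W X) * ((\<psi> X)\<^sup>2 * ((M X *v G X) \<bullet> G X)))
    = \<mu> * (LINT X|L\<omega>. recip n (W X) * (W X * (\<psi> X)\<^sup>2))"
    and "integrable L\<omega> (\<lambda>X. recip n (W X) * (2 * \<psi> X * ((M X *v G X) \<bullet> grad \<psi> X)))"
    and "integrable L\<omega> (\<lambda>X. grad (recip n) (W X) * ((\<psi> X)\<^sup>2 * ((M X *v G X) \<bullet> G X)))"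
    and "integrable L\<omega> (\<lambda>X. recip n (W X) * (W X * (\<psi> X)\<^sup>2))"
    and "integrable L\<omega> (\<lambda>X. W X * (\<psi> X)\<^sup>2)"
proof -
  note R = recip[OF n] and s\<psi> = test_smooth[OF \<psi>]
  have cg: "continuous_on UNIV (recip n)" "continuous_on UNIV (grad (recip n))"
    using smooth_continuous[OF R(1)] continuous_grad[OF R(1)] by auto
  obtain K where K: "compact K" "\<forall>x. x \<notin> K \<longrightarrow> \<psi> x = 0 \<and> grad \<psi> x = 0" using test_support[OF \<psi>] by blast
  obtain B where B: "B \<ge> 0" "\<And>x. norm (\<psi> x) \<le> B"
    using compact_support_bounded[OF smooth_continuous[OF s\<psi>] K(1)] K(2) by metis
  have B2: "(\<psi> x)\<^sup>2 \<le> B\<^sup>2" for x unfolding abs_le_square_iff[symmetric] using B(1) B(2)[of x] by simp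
  have m\<psi>: "\<psi> \<in> borel_measurable L\<omega>" "grad \<psi> \<in> borel_measurable L\<omega>"
    using on_measurable grad_measurable[of \<psi>] test_base_sqint[OF \<psi>] by (auto simp: sqint_def)
  have mg: "(\<lambda>X. recip n (f X)) \<in> borel_measurable L\<omega>" "(\<lambda>X. grad (recip n) (f X)) \<in> borel_measurable L\<omega>"
    if "f \<in> borel_measurable L\<omega>" for f
    using compose_measurable[OF cg(1) that] compose_measurable[OF cg(2) that] .
  have mM: "(\<lambda>X. (M X *v G X) \<bullet> f X) \<in> borel_measurable L\<omega>" if "f \<in> borel_measurable L\<omega>" for f
    by (intro borel_measurable_inner borel_measurable_matrix_vector meas_on L2_facts that)
  have iM: "integrable L\<omega> (\<lambda>X. (M X *v G X) \<bullet> f X)" if "sqint L\<omega> f" for f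
    by (rule bilinear_integrable[OF M_bound mM L2_facts(2) that]) (use that in \<open>simp add: sqint_def\<close>)
  have bdd_int: "integrable L\<omega> (\<lambda>X. c X * f X)"
    if "integrable L\<omega> f" "c \<in> borel_measurable L\<omega>" "\<And>X. \<bar>c X\<bar> \<le> D" for c f :: "real^'n \<Rightarrow> real" and D
  proof (rule Bochner_Integration.integrable_bound[of _ "\<lambda>X. D * f X"])
    show "integrable L\<omega> (\<lambda>X. D * f X)" using that(1) by simp
    show "(\<lambda>X. c X * f X) \<in> borel_measurable L\<omega>" using that(1,2) by (intro borel_measurable_times) auto
    show "AE X in L\<omega>. norm (c X * f X) \<le> norm (D * f X)"
    proof (rule AE_I2)
      fix X
      have "\<bar>c X\<bar> * \<bar>f X\<bar> \<le> \<bar>D\<bar> * \<bar>f X\<bar>" by (rule mult_right_mono) (use that(3)[of X] in auto)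
      then show "norm (c X * f X) \<le> norm (D * f X)" by (simp add: abs_mult)
    qed
  qed
  \<comment> \<open>L2 convergence handles bilinear expressions only; for r(p k) and r'(p k), almost
    everywhere convergence together with boundedness of r and r' gives convergence against any
    integrable weight.\<close>
  have dct: "(\<lambda>k. LINT X|L\<omega>. c (p k X) * f X) \<longlonglongrightarrow> (LINT X|L\<omega>. c (W X) * f X)"
    if f: "integrable L\<omega> f" and c: "continuous_on UNIV c" and D: "\<And>t. \<bar>c t\<bar> \<le> D" for c :: "real \<Rightarrow> real" and f D
  proof (rule integral_dominated_convergence[where w="\<lambda>X. D * norm (f X)"])
    show "integrable L\<omega> (\<lambda>X. D * norm (f X))" using f by simp
    show "(\<lambda>X. c (W X) * f X) \<in> borel_measurable L\<omega>" "\<And>k. (\<lambda>X. c (p k X) * f X) \<in> borel_measurable L\<omega>"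
      using f by (auto intro!: borel_measurable_times compose_measurable[OF c] L2_facts)
    show "AE X in L\<omega>. (\<lambda>k. c (p k X) * f X) \<longlonglongrightarrow> c (W X) * f X"
      using ae_conv
    proof eventually_elim
      case (elim X)
      have "isCont c (W X)" using c by (simp add: continuous_on_eq_continuous_at)
      from isCont_tendsto_compose[OF this elim] show ?case by (rule tendsto_mult_right)
    qed
    show "AE X in L\<omega>. norm (c (p k X) * f X) \<le> D * norm (f X)" for k
      by (rule AE_I2) (simp add: abs_mult mult_right_mono D)
  qed
  define A1 where "A1 X = 2 * \<psi> X * ((M X *v G X) \<bullet> grad \<psi> X)" for X
  define A2 where "A2 X = (\<psi> X)\<^sup>2 * ((M X *v G X) \<bullet> G X)" for X
  define A3 where "A3 X = W X * (\<psi> X)\<^sup>2" for X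
  have i1: "integrable L\<omega> A1" unfolding A1_def[abs_def]
  proof (rule bdd_int[OF iM[OF test_base_sqint(2)[OF \<psi>]]])
    show "(\<lambda>X. 2 * \<psi> X) \<in> borel_measurable L\<omega>" using m\<psi>(1) by simp
    show "\<bar>2 * \<psi> X\<bar> \<le> 2 * B" for X using B(2)[of X] by (simp add: abs_mult)
  qed
  have i2: "integrable L\<omega> A2" unfolding A2_def[abs_def]
    by (rule bdd_int[OF iM[OF L2_facts(2)], where D="B\<^sup>2"]) (use m\<psi>(1) B2 in auto)
  have i3: "integrable L\<omega> A3"
  proof -
    have "integrable L\<omega> (\<lambda>X. \<psi> X * W X)"
      by (rule bilinear_integrable[where B="\<lambda>x u v. u * v" and C=1, OF _ _ test_base_sqint(1)[OF \<psi>] L2_facts(1)])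
        (auto simp: abs_mult intro: borel_measurable_times m\<psi> L2_facts)
    from bdd_int[OF this m\<psi>(1), of B] B(2) show ?thesis unfolding A3_def[abs_def] by (simp add: power2_eq_square mult_ac)
  qed
  have rb: "\<bar>recip n t\<bar> \<le> n" for t using R(2)[of t] R(3)[of t] by simp
  note r4 = R(4)
  show "integrable L\<omega> (\<lambda>X. recip n (W X) * (2 * \<psi> X * ((M X *v G X) \<bullet> grad \<psi> X)))"
    using bdd_int[OF i1 mg(1)[OF L2_facts(3)] rb] by (simp add: A1_def)
  show "integrable L\<omega> (\<lambda>X. grad (recip n) (W X) * ((\<psi> X)\<^sup>2 * ((M X *v G X) \<bullet> G X)))"
    using bdd_int[OF i2 mg(2)[OF L2_facts(3)] r4] by (simp add: A2_def)
  show "integrable L\<omega> (\<lambda>X. recip n (W X) * (W X * (\<psi> X)\<^sup>2))"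
    using bdd_int[OF i3 mg(1)[OF L2_facts(3)] rb] by (simp add: A3_def)
  show "integrable L\<omega> (\<lambda>X. W X * (\<psi> X)\<^sup>2)" using i3 by (simp add: A3_def[abs_def])
  define v where "v k X = (recip n (p k X) * \<psi> X) * \<psi> X" for k X
  \<comment> \<open>The equation contains \<open>G\<close>, whereas the gradient of
    \<open>v k\<close> contains the gradient of \<open>p k\<close>. Replacing the latter by
    \<open>G\<close> costs this term.\<close>
  define err where "err k = (LINT X|L\<omega>. (grad (recip n) (p k X) * (\<psi> X)\<^sup>2) * ((M X *v G X) \<bullet> (grad (p k) X - G X)))" for k
  have sp: "smooth (\<lambda>X. recip n (p k X))" for k by (rule smooth_compose[OF R(1) test_smooth[OF p]])
  have vt: "v k \<in> test_functions \<omega>" for k unfolding v_def[abs_def]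
    by (rule test_mult[OF \<psi> smooth_mult[OF sp s\<psi>]])
  have double: "2 * (\<psi> X * r) = r * \<psi> X + \<psi> X * r" for r X by simp
  have gv: "grad (v k) X = (2 * \<psi> X * recip n (p k X)) *\<^sub>R grad \<psi> X + ((\<psi> X)\<^sup>2 * grad (recip n) (p k X)) *\<^sub>R grad (p k) X" for k X
    unfolding v_def[abs_def] grad_mult[OF smooth_mult[OF sp s\<psi>] s\<psi>] grad_mult[OF sp s\<psi>] grad_compose[OF R(1) test_smooth[OF p]]
    by (simp only: double scaleR_add_left scaleR_add_right scaleR_scaleR power2_eq_square mult.assoc add.assoc)
  have ie: "integrable L\<omega> (\<lambda>X. (grad (recip n) (p k X) * (\<psi> X)\<^sup>2) * ((M X *v G X) \<bullet> (grad (p k) X - G X)))" for k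
  proof (rule bdd_int[OF iM[OF sqint_diff[OF L2_facts(6) L2_facts(2)]]])
    show "(\<lambda>X. grad (recip n) (p k X) * (\<psi> X)\<^sup>2) \<in> borel_measurable L\<omega>"
      by (intro borel_measurable_times borel_measurable_power mg(2) L2_facts m\<psi>)
    show "\<bar>grad (recip n) (p k X) * (\<psi> X)\<^sup>2\<bar> \<le> 2 * n\<^sup>2 * B\<^sup>2" for X
      unfolding abs_mult using r4[of "p k X"] B2[of X] by (intro mult_mono) auto
  qed
  have el: "(LINT X|L\<omega>. recip n (p k X) * A1 X) + (LINT X|L\<omega>. grad (recip n) (p k X) * A2 X) + err k = \<mu> * (LINT X|L\<omega>. recip n (p k X) * A3 X)" for k
  proof -
    have "fm G (grad (v k)) = (LINT X|L\<omega>. recip n (p k X) * A1 X + grad (recip n) (p k X) * A2 X + (grad (recip n) (p k X) * (\<psi> X)\<^sup>2) * ((M X *v G X) \<bullet> (grad (p k) X - G X)))"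
      unfolding fm_def gv A1_def A2_def
      by (rule Bochner_Integration.integral_cong[OF refl]) (simp add: inner_add_right inner_diff_right algebra_simps)
    also have "\<dots> = (LINT X|L\<omega>. recip n (p k X) * A1 X) + (LINT X|L\<omega>. grad (recip n) (p k X) * A2 X) + err k"
      unfolding err_def
      using bdd_int[OF i1 mg(1)[OF L2_facts(7)] rb] bdd_int[OF i2 mg(2)[OF L2_facts(7)] r4] ie by simp
    finally have "(LINT X|L\<omega>. recip n (p k X) * A1 X) + (LINT X|L\<omega>. grad (recip n) (p k X) * A2 X) + err k = \<mu> * f0 W (v k)"
      using euler_lagrange[OF vt] by simp
    also have "f0 W (v k) = (LINT X|L\<omega>. recip n (p k X) * A3 X)"
      unfolding f0_def v_def A3_def
      by (rule Bochner_Integration.integral_cong[OF refl]) (simp add: power2_eq_square)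
    finally show ?thesis .
  qed
  \<comment> \<open>The scalar factor is bounded by 2 n^2 B^2 uniformly in k, so L2 convergence of
    the gradients suffices.\<close>
  have err0: "err \<longlonglongrightarrow> 0"
  proof (rule Lim_null_comparison)
    let ?D = "2 * n\<^sup>2 * B\<^sup>2 * C"
    have "norm (err k) \<le> ?D * (LINT X|L\<omega>. norm (G X) * norm (grad (p k) X - G X))" for k
    proof -
      have "norm (err k) \<le> (LINT X|L\<omega>. norm ((grad (recip n) (p k X) * (\<psi> X)\<^sup>2) * ((M X *v G X) \<bullet> (grad (p k) X - G X))))"
        unfolding err_def by (rule integral_norm_bound)
      also have "\<dots> \<le> (LINT X|L\<omega>. ?D * (norm (G X) * norm (grad (p k) X - G X)))"
      proof (rule integral_mono[OF integrable_norm[OF ie]])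
        show "integrable L\<omega> (\<lambda>X. ?D * (norm (G X) * norm (grad (p k) X - G X)))"
          using sqint_prod_integrable[OF L2_facts(2) sqint_diff[OF L2_facts(6) L2_facts(2)]] by simp
        fix X
        have "\<bar>grad (recip n) (p k X) * (\<psi> X)\<^sup>2\<bar> \<le> 2 * n\<^sup>2 * B\<^sup>2"
          unfolding abs_mult using r4[of "p k X"] B2[of X] by (intro mult_mono) auto
        from mult_mono[OF this M_bound[of X "G X" "grad (p k) X - G X"]]
        show "norm ((grad (recip n) (p k X) * (\<psi> X)\<^sup>2) * ((M X *v G X) \<bullet> (grad (p k) X - G X))) \<le> ?D * (norm (G X) * norm (grad (p k) X - G X))"
          by (simp add: abs_mult mult.assoc)
      qed
      finally show ?thesis by simp
    qed
    then show "\<forall>\<^sub>F k in sequentially. norm (err k) \<le> ?D * (LINT X|L\<omega>. norm (G X) * norm (grad (p k) X - G X))"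
      by (intro always_eventually allI)
    have "(\<lambda>k. LINT X|L\<omega>. norm (G X) * norm (grad (p k) X - G X)) \<longlonglongrightarrow> 0"
      by (rule L2_prod_tendsto_0[OF L2_facts(2) sqint_diff[OF L2_facts(6) L2_facts(2)]]) (use pG in \<open>simp add: L2conv_def\<close>)
    from tendsto_mult_right_zero[OF this] show "(\<lambda>k. ?D * (LINT X|L\<omega>. norm (G X) * norm (grad (p k) X - G X))) \<longlonglongrightarrow> 0" .
  qed
  have L: "(\<lambda>k. (LINT X|L\<omega>. recip n (p k X) * A1 X) + (LINT X|L\<omega>. grad (recip n) (p k X) * A2 X) + err k)
     \<longlonglongrightarrow> (LINT X|L\<omega>. recip n (W X) * A1 X) + (LINT X|L\<omega>. grad (recip n) (W X) * A2 X) + 0"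
    by (intro tendsto_add dct[OF i1 cg(1) rb] dct[OF i2 cg(2) r4] err0)
  moreover have "(\<lambda>k. \<mu> * (LINT X|L\<omega>. recip n (p k X) * A3 X)) \<longlonglongrightarrow> \<mu> * (LINT X|L\<omega>. recip n (W X) * A3 X)"
    by (intro tendsto_mult tendsto_const dct[OF i3 cg(1) rb])
  ultimately have "(LINT X|L\<omega>. recip n (W X) * A1 X) + (LINT X|L\<omega>. grad (recip n) (W X) * A2 X) + 0 = \<mu> * (LINT X|L\<omega>. recip n (W X) * A3 X)"
    unfolding el by (rule LIMSEQ_unique)
  then show "(LINT X|L\<omega>. recip n (W X) * (2 * \<psi> X * ((M X *v G X) \<bullet> grad \<psi> X))) +
      (LINT X|L\<omega>. grad (recip n) (W X) * ((\<psi> X)\<^sup>2 * ((M X *v G X) \<bullet> G X)))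
    = \<mu> * (LINT X|L\<omega>. recip n (W X) * (W X * (\<psi> X)\<^sup>2))"
    by (simp add: A1_def A2_def A3_def)
qed

text \<open>The axial component \<zeta> is arbitrary, so the bound already holds on a single slice
  with the full cylinder form. Completing the square with (0, G) would produce a term in \<zeta>
  only through b \<bullet> G, and this is zero.\<close>

lemma picone_slice:
  fixes \<zeta> :: "real^'n \<Rightarrow> real"
  assumes \<psi>: "\<psi> \<in> test_functions \<omega>" and int: "integrable L\<omega> (\<lambda>X. op (t, X) (\<zeta> X, grad \<psi> X) \<bullet> (\<zeta> X, grad \<psi> X))"
  shows "\<mu> * (LINT X|L\<omega>. (\<psi> X)\<^sup>2) \<le> (LINT X|L\<omega>. op (t, X) (\<zeta> X, grad \<psi> X) \<bullet> (\<zeta> X, grad \<psi> X))"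
proof -
  let ?q = "LINT X|L\<omega>. op (t, X) (\<zeta> X, grad \<psi> X) \<bullet> (\<zeta> X, grad \<psi> X)"
  have le: "\<mu> * (LINT X|L\<omega>. recip n (W X) * (W X * (\<psi> X)\<^sup>2)) \<le> ?q" if n: "n > 0" for n
  proof -
    note P = picone_weak[OF \<psi> n] and R = recip[OF n]
    have "\<mu> * (LINT X|L\<omega>. recip n (W X) * (W X * (\<psi> X)\<^sup>2))
      = (LINT X|L\<omega>. recip n (W X) * (2 * \<psi> X * ((M X *v G X) \<bullet> grad \<psi> X)) + grad (recip n) (W X) * ((\<psi> X)\<^sup>2 * ((M X *v G X) \<bullet> G X)))"
      unfolding P(1)[symmetric] by (rule Bochner_Integration.integral_add[OF P(2,3), symmetric])
    also have "\<dots> \<le> ?q"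
    proof (rule integral_mono_AE[OF Bochner_Integration.integrable_add[OF P(2,3)] int])
      show "AE X in L\<omega>. recip n (W X) * (2 * \<psi> X * ((M X *v G X) \<bullet> grad \<psi> X)) + grad (recip n) (W X) * ((\<psi> X)\<^sup>2 * ((M X *v G X) \<bullet> G X))
        \<le> op (t, X) (\<zeta> X, grad \<psi> X) \<bullet> (\<zeta> X, grad \<psi> X)"
        using pos orth
      proof eventually_elim
        case (elim X)
        \<comment> \<open>The regularised quotient psi/W. In the ideal case the square is that of
          grad phi - (phi/W) grad W, with grad W having no axial component.\<close>
        define s where "s = \<psi> X * recip n (W X)"
        define \<xi> where "\<xi> = (\<zeta> X, grad \<psi> X)"
        define \<eta> where "\<eta> = (0::real, G X)"
        interpret linear "op (t, X)" by (rule linear_op)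
        have "0 \<le> op (t, X) (\<xi> - s *\<^sub>R \<eta>) \<bullet> (\<xi> - s *\<^sub>R \<eta>)" by (rule op_pos)
        also have "\<dots> = op (t, X) \<xi> \<bullet> \<xi> - 2 * s * (op (t, X) \<eta> \<bullet> \<xi>) + s\<^sup>2 * (op (t, X) \<eta> \<bullet> \<eta>)"
          using op_sym[of "(t, X)" \<xi> \<eta>]
          by (simp add: diff scale inner_diff_left inner_diff_right power2_eq_square algebra_simps)
        also have "op (t, X) \<eta> \<bullet> \<xi> = (M X *v G X) \<bullet> grad \<psi> X" unfolding op_inner \<eta>_def \<xi>_def by (simp add: elim(2))
        also have "op (t, X) \<eta> \<bullet> \<eta> = (M X *v G X) \<bullet> G X" unfolding op_inner \<eta>_def by simp
        finally have 1: "2 * s * ((M X *v G X) \<bullet> grad \<psi> X) - s\<^sup>2 * ((M X *v G X) \<bullet> G X) \<le> op (t, X) \<xi> \<bullet> \<xi>" by linarith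
        \<comment> \<open>Here r' <= - r^2 enters, applicable because W > 0, and nonnegativity of
          the form of \<open>M\<close> preserves its direction.\<close>
        have "grad (recip n) (W X) * ((\<psi> X)\<^sup>2 * ((M X *v G X) \<bullet> G X)) \<le> - (recip n (W X))\<^sup>2 * ((\<psi> X)\<^sup>2 * ((M X *v G X) \<bullet> G X))"
          by (rule mult_right_mono[OF R(5)]) (use elim(1) M_pos in auto)
        also have "\<dots> = - (s\<^sup>2 * ((M X *v G X) \<bullet> G X))" by (simp add: s_def power_mult_distrib)
        finally show ?case using 1 unfolding \<xi>_def s_def by (simp add: mult_ac)
      qed
    qed
    finally show ?thesis .
  qed
  have sq: "integrable L\<omega> (\<lambda>X. (\<psi> X)\<^sup>2)" using test_base_sqint(1)[OF \<psi>] by (simp add: sqint_def)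
  \<comment> \<open>W r(W) lies in [0, 1] and tends to 1 wherever W > 0, so psi^2 is a
    majorant.\<close>
  have lim: "(\<lambda>n. LINT X|L\<omega>. recip (real (Suc n)) (W X) * (W X * (\<psi> X)\<^sup>2)) \<longlonglongrightarrow> (LINT X|L\<omega>. (\<psi> X)\<^sup>2)"
  proof (rule integral_dominated_convergence[where w="\<lambda>X. (\<psi> X)\<^sup>2"])
    show "(\<lambda>X. recip (real (Suc n)) (W X) * (W X * (\<psi> X)\<^sup>2)) \<in> borel_measurable L\<omega>" for n
      using picone_weak(4)[OF \<psi>, of "real (Suc n)"] by auto
    show "(\<lambda>X. (\<psi> X)\<^sup>2) \<in> borel_measurable L\<omega>" "integrable L\<omega> (\<lambda>X. (\<psi> X)\<^sup>2)" using sq by auto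
    show "AE X in L\<omega>. (\<lambda>n. recip (real (Suc n)) (W X) * (W X * (\<psi> X)\<^sup>2)) \<longlonglongrightarrow> (\<psi> X)\<^sup>2"
      using pos
    proof eventually_elim
      case (elim X)
      have "(\<lambda>n. W X * recip (real (Suc n)) (W X)) \<longlonglongrightarrow> 1"
      proof (rule tendsto_sandwich[OF _ _ _ tendsto_const])
        show "\<forall>\<^sub>F n in sequentially. 1 - 4 * inverse (W X) * inverse (real (Suc n)) \<le> W X * recip (real (Suc n)) (W X)"
        proof (intro always_eventually allI)
          fix n
          have "4 * inverse (W X) * inverse (real (Suc n)) = 4 / (real (Suc n) * W X)" by (simp add: field_simps)
          then show "1 - 4 * inverse (W X) * inverse (real (Suc n)) \<le> W X * recip (real (Suc n)) (W X)"
            using recip(7)[of "real (Suc n)" "W X"] elim by simp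
        qed
        show "\<forall>\<^sub>F n in sequentially. W X * recip (real (Suc n)) (W X) \<le> 1"
          using recip(6)[of "real (Suc _)" "W X"] elim by (intro always_eventually allI) simp
        have "(\<lambda>n. 1 - 4 * inverse (W X) * inverse (real (Suc n))) \<longlonglongrightarrow> 1 - 4 * inverse (W X) * 0"
          by (intro tendsto_intros LIMSEQ_inverse_real_of_nat)
        then show "(\<lambda>n. 1 - 4 * inverse (W X) * inverse (real (Suc n))) \<longlonglongrightarrow> 1" by simp
      qed
      from tendsto_mult_right[OF this, of "(\<psi> X)\<^sup>2"] show ?case by (simp add: mult_ac)
    qed
    show "AE X in L\<omega>. norm (recip (real (Suc n)) (W X) * (W X * (\<psi> X)\<^sup>2)) \<le> (\<psi> X)\<^sup>2" for n
      using pos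
    proof eventually_elim
      case (elim X)
      have "0 \<le> W X * recip (real (Suc n)) (W X)" using recip(2)[of "real (Suc n)" "W X"] elim by simp
      moreover have "W X * recip (real (Suc n)) (W X) \<le> 1" using recip(6)[of "real (Suc n)" "W X"] elim by simp
      ultimately have "\<bar>W X * recip (real (Suc n)) (W X)\<bar> * (\<psi> X)\<^sup>2 \<le> 1 * (\<psi> X)\<^sup>2" by (intro mult_right_mono) auto
      then show ?case by (simp add: abs_mult mult_ac)
    qed
  qed
  have "(\<lambda>n. \<mu> * (LINT X|L\<omega>. recip (real (Suc n)) (W X) * (W X * (\<psi> X)\<^sup>2))) \<longlonglongrightarrow> \<mu> * (LINT X|L\<omega>. (\<psi> X)\<^sup>2)"
    by (rule tendsto_mult_left[OF lim])
  then show ?thesis by (rule LIMSEQ_le_const2) (use le[of "real (Suc _)"] in auto)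
qed

lemma T_slice:
  assumes "\<phi> \<in> T"
  shows "(\<lambda>X. \<phi> (t, X)) \<in> test_functions \<omega>"
proof -
  obtain K where K: "compact K" "K \<subseteq> UNIV \<times> \<omega>" "\<forall>x. x \<notin> K \<longrightarrow> \<phi> x = 0 \<and> grad \<phi> x = 0"
    using test_support[OF assms] by blast
  show ?thesis
  proof (rule test_functionsI[of _ "snd ` K"])
    show "smooth (\<lambda>X. \<phi> (t, X))" by (rule smooth_Pair[OF T_smooth[OF assms]])
    show "compact (snd ` K)" by (rule compact_continuous_image[OF continuous_on_snd[OF continuous_on_id] K(1)])
    show "snd ` K \<subseteq> \<omega>" using K(2) by auto
    fix X assume nX: "X \<notin> snd ` K"
    have "(t, X) \<notin> K" using nX by (metis imageI snd_conv)
    then show "\<phi> (t, X) = 0" using K(3) by blast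
  qed
qed

text \<open>Integration of the slice inequality along the axis. It holds for every t and every open
  \<open>I\<close>, whatever the behaviour of the function at the ends.\<close>

lemma mu1_le_Q:
  assumes I: "open I" and \<phi>: "\<phi> \<in> T"
  shows "\<mu> * N I \<phi> \<le> Q I \<phi>"
proof -
  note sm = T_smooth[OF \<phi>]
  obtain K where K: "compact K" "\<forall>x. x \<notin> K \<longrightarrow> \<phi> x = 0 \<and> grad \<phi> x = 0" using test_support[OF \<phi>] by blast
  note iQ = indicator_integrable[OF I T_integrable(1)[OF \<phi>]] and iN = indicator_integrable[OF I T_integrable(2)[OF \<phi>]]
  have slice: "\<mu> * (LINT X|lborel. indicator (I \<times> \<omega>) (t, X) * (\<phi> (t, X))\<^sup>2)
     \<le> (LINT X|lborel. indicator (I \<times> \<omega>) (t, X) * (op (t, X) (grad \<phi> (t, X)) \<bullet> grad \<phi> (t, X)))" for t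
  proof (cases "t \<in> I")
    case False then show ?thesis by simp
  next
    case True
    have ind: "indicator (I \<times> \<omega>) (t, X) = (indicator \<omega> X :: real)" for X using True by (simp add: indicator_def)
    have cP: "continuous_on UNIV (\<lambda>X::real^'n. (t, X))" by (intro continuous_intros)
    have cg: "continuous_on UNIV (\<lambda>X. grad \<phi> (t, X))"
      using continuous_on_compose2[OF continuous_grad[OF sm] cP] by auto
    have mP: "(\<lambda>X::real^'n. (t, X)) \<in> borel_measurable borel" by (rule borel_of_continuous[OF cP])
    have m1: "(\<lambda>X. op (t, X) (grad \<phi> (t, X)) \<bullet> grad \<phi> (t, X)) \<in> borel_measurable borel"
      using measurable_compose[OF mP Q_measurable[OF sm sm]] .
    have m2: "(\<lambda>X. (\<phi> (t, X))\<^sup>2) \<in> borel_measurable borel"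
      by (intro borel_measurable_power grad_measurable(2) measurable_compose[OF mP] sm)
    have "integrable lborel (\<lambda>X. (norm (grad \<phi> (t, X)))\<^sup>2)"
    proof (rule compact_support_integrable[OF continuous_on_power[OF continuous_on_norm[OF cg]]])
      show "compact (snd ` K)" by (rule compact_continuous_image[OF continuous_on_snd[OF continuous_on_id] K(1)])
      fix X assume nX: "X \<notin> snd ` K"
      have "(t, X) \<notin> K" using nX by (metis imageI snd_conv)
      then show "(norm (grad \<phi> (t, X)))\<^sup>2 = 0" using K(2) by simp
    qed
    then have "integrable lborel (\<lambda>X. C * (norm (grad \<phi> (t, X)))\<^sup>2)" by simp
    then have i: "integrable lborel (\<lambda>X. op (t, X) (grad \<phi> (t, X)) \<bullet> grad \<phi> (t, X))"
    proof (rule Bochner_Integration.integrable_bound)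
      show "(\<lambda>X. op (t, X) (grad \<phi> (t, X)) \<bullet> grad \<phi> (t, X)) \<in> borel_measurable lborel" using m1 by simp
      show "AE X in lborel. norm (op (t, X) (grad \<phi> (t, X)) \<bullet> grad \<phi> (t, X)) \<le> norm (C * (norm (grad \<phi> (t, X)))\<^sup>2)"
        unfolding power2_eq_square real_norm_def by (intro AE_I2 order_trans[OF op_bound abs_ge_self])
    qed
    have "integrable lborel (\<lambda>X. indicator \<omega> X *\<^sub>R (op (t, X) (grad \<phi> (t, X)) \<bullet> grad \<phi> (t, X)))"
      by (rule integrable_mult_indicator[OF _ i]) (use open_\<omega> in simp)
    then have iL: "integrable L\<omega> (\<lambda>X. op (t, X) (grad \<phi> (t, X)) \<bullet> grad \<phi> (t, X))"
      using lebesgue_on_lborel(2)[OF open_\<omega> m1] by simp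
    \<comment> \<open>The axial derivative takes the role of the free component \<zeta>; the rest is
      the gradient of the slice.\<close>
    have pr: "grad \<phi> (t, X) = (fst (grad \<phi> (t, X)), grad (\<lambda>X. \<phi> (t, X)) X)" for X
      unfolding grad_Pair[OF sm] by simp
    have "\<mu> * (LINT X|L\<omega>. (\<phi> (t, X))\<^sup>2) \<le> (LINT X|L\<omega>. op (t, X) (grad \<phi> (t, X)) \<bullet> grad \<phi> (t, X))"
      using picone_slice[OF T_slice[OF \<phi>, of t], of t "\<lambda>X. fst (grad \<phi> (t, X))"] iL unfolding pr[symmetric] .
    then show ?thesis unfolding ind using lebesgue_on_lborel(1)[OF open_\<omega> m1] lebesgue_on_lborel(1)[OF open_\<omega> m2] by simp
  qed
  have "\<mu> * N I \<phi> = (LINT t|lborel. \<mu> * (LINT X|lborel. indicator (I \<times> \<omega>) (t, X) * (\<phi> (t, X))\<^sup>2))"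
    unfolding N_def lborel_Fubini(1)[OF iN] by simp
  also have "\<dots> \<le> (LINT t|lborel. LINT X|lborel. indicator (I \<times> \<omega>) (t, X) * (op (t, X) (grad \<phi> (t, X)) \<bullet> grad \<phi> (t, X)))"
    by (rule integral_mono[OF integrable_mult_right[OF lborel_Fubini(2)[OF iN]] lborel_Fubini(2)[OF iQ] slice])
  also have "\<dots> = Q I \<phi>" unfolding Q_def lborel_Fubini(1)[OF iQ] ..
  finally show ?thesis .
qed

text \<open>Products constant along the axis give the upper bound and the slices the lower one; both
  are exact for each \<open>l\<close>.\<close>

lemma lambda1_eq_mu1: "l > 0 \<Longrightarrow> lambda1 \<omega> a b M l = \<mu>"
  by (rule antisym[OF lambda1_le_mu1 le_lambda1]) (auto intro!: mu1_le_Q)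

end

section \<open>Passage to Borel coefficients\<close>

lemma borel_version_real:
  fixes f :: "'a::euclidean_space \<Rightarrow> real"
  assumes \<Omega>: "open \<Omega>" and f: "f \<in> borel_measurable (lebesgue_on \<Omega>)"
  shows "\<exists>g\<in>borel_measurable borel. AE x in lebesgue. x \<in> \<Omega> \<longrightarrow> f x = g x"
proof -
  have "(\<lambda>x. indicator \<Omega> x *\<^sub>R f x) \<in> borel_measurable lebesgue"
    using f by (simp add: borel_measurable_restrict_space_iff open_in_lebesgue[OF \<Omega>])
  then obtain g where g: "g \<in> borel_measurable lborel" "AE x in lborel. indicator \<Omega> x *\<^sub>R f x = g x"
    using completion_ex_borel_measurable_real by blast
  from AE_completion[OF g(2)] have "AE x in lebesgue. x \<in> \<Omega> \<longrightarrow> f x = g x"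
    by eventually_elim (auto simp: indicator_def)
  then show ?thesis using g(1) by auto
qed

lemma borel_measurable_vec_lambda:
  fixes f :: "'i::finite \<Rightarrow> 'a \<Rightarrow> 'b::euclidean_space"
  assumes "\<And>i. f i \<in> borel_measurable N"
  shows "(\<lambda>x. \<chi> i. f i x) \<in> borel_measurable N"
proof (rule borel_measurable_euclidean_space[THEN iffD2], intro ballI)
  fix e :: "'b^'i" assume "e \<in> Basis"
  then obtain i u where e: "e = axis i u" by (auto simp: Basis_vec_def)
  have "(\<lambda>x. (\<chi> i. f i x) \<bullet> e) = (\<lambda>x. f i x \<bullet> u)" by (simp add: e inner_axis)
  then show "(\<lambda>x. (\<chi> i. f i x) \<bullet> e) \<in> borel_measurable N" using assms[of i] by simp
qed

text \<open>Measurability is known only for the integrand of \<open>A'\<close>; completeness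
  transfers it to that of \<open>A\<close>.\<close>

lemma energy_cong_AE:
  assumes \<Omega>: "open \<Omega>" and A': "bounded_op \<Omega> C A'" and eq: "AE x in lebesgue_on \<Omega>. A x = A' x" and u: "u \<in> H1 \<Omega>"
  shows "energy \<Omega> A u = energy \<Omega> A' u"
proof -
  obtain g where g: "sqint (lebesgue_on \<Omega>) g" "has_weak_gradient \<Omega> u g" using u by (auto simp: H1_def L2_sqint)
  let ?w = "weak_gradient \<Omega> u"
  have w: "?w \<in> borel_measurable (lebesgue_on \<Omega>)" using weak_gradient_sqint[OF \<Omega> g(2,1)] by (simp add: sqint_def)
  have m: "(\<lambda>x. A' x (?w x) \<bullet> ?w x) \<in> borel_measurable (lebesgue_on \<Omega>)" by (rule bounded_op_bilinear(3)[OF A' w w])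
  have ae: "AE x in lebesgue_on \<Omega>. A' x (?w x) \<bullet> ?w x = A x (?w x) \<bullet> ?w x" using eq by eventually_elim simp
  have m2: "(\<lambda>x. A x (?w x) \<bullet> ?w x) \<in> borel_measurable (lebesgue_on \<Omega>)"
    by (rule measurable_lebesgue_on_AE[OF open_in_lebesgue[OF \<Omega>] m ae])
  show ?thesis unfolding energy_def by (rule integral_cong_AE[OF m2 m]) (use ae in \<open>auto elim!: eventually_mono\<close>)
qed

lemma Inf_image_cong:
  fixes f g :: "'a \<Rightarrow> real"
  assumes "\<And>u. P u \<Longrightarrow> f u = g u"
  shows "Inf {f u | u. P u} = Inf {g u | u. P u}"
proof -
  have "{f u | u. P u} = f ` Collect P" "{g u | u. P u} = g ` Collect P" by blast+
  moreover have "f ` Collect P = g ` Collect P" by (rule image_cong) (simp_all add: assms)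
  ultimately show ?thesis by simp
qed

text \<open>Produces the pointwise hypotheses of \<open>cylinder\<close>: entrywise Borel versions,
  cut off to a harmless matrix wherever one of the almost everywhere properties might fail.\<close>

lemma borel_coefficients:
  fixes \<omega> :: "(real^'n) set" and a11 :: "real^'n \<Rightarrow> real" and A12 :: "real^'n \<Rightarrow> real^'n" and A22 :: "real^'n \<Rightarrow> real^'n^'n"
  assumes \<omega>: "open \<omega>" "\<omega> \<noteq> {}" "bounded \<omega>"
    and meas: "a11 \<in> borel_measurable (lebesgue_on \<omega>)"
      "\<And>i. (\<lambda>X. A12 X $ i) \<in> borel_measurable (lebesgue_on \<omega>)"
      "\<And>i j. (\<lambda>X. A22 X $ i $ j) \<in> borel_measurable (lebesgue_on \<omega>)"
    and tr: "\<And>X. X \<in> \<omega> \<Longrightarrow> transpose (A22 X) = A22 X"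
    and pos: "C_A > 0" "lambda_A > 0"
    and bnd: "AE X in lebesgue_on \<omega>. onorm (block_op (a11 X) (A12 X) (A22 X)) \<le> C_A"
    and ell: "AE X in lebesgue_on \<omega>. \<forall>\<xi>. block_op (a11 X) (A12 X) (A22 X) \<xi> \<bullet> \<xi> \<ge> lambda_A * (norm \<xi>)\<^sup>2"
  shows "\<exists>a b M Z. cylinder \<omega> a b M (max C_A lambda_A) lambda_A \<and> Z \<in> null_sets lborel \<and>
    (\<forall>X\<in>\<omega> - Z. a11 X = a X \<and> A12 X = b X \<and> A22 X = M X)"
proof -
  obtain a' where a': "a' \<in> borel_measurable borel" "AE X in lebesgue. X \<in> \<omega> \<longrightarrow> a11 X = a' X"
    using borel_version_real[OF \<omega>(1) meas(1)] by blast
  have "\<forall>i. \<exists>g. g \<in> borel_measurable borel \<and> (AE X in lebesgue. X \<in> \<omega> \<longrightarrow> A12 X $ i = g X)"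
    using borel_version_real[OF \<omega>(1) meas(2)] by blast
  from choice[OF this] obtain b' where
    "\<forall>i. b' i \<in> borel_measurable borel \<and> (AE X in lebesgue. X \<in> \<omega> \<longrightarrow> A12 X $ i = b' i X)" ..
  then have b': "\<And>i. b' i \<in> borel_measurable borel" "\<And>i. AE X in lebesgue. X \<in> \<omega> \<longrightarrow> A12 X $ i = b' i X"
    by blast+
  have "\<exists>m. \<forall>j. m j \<in> borel_measurable borel \<and> (AE X in lebesgue. X \<in> \<omega> \<longrightarrow> A22 X $ i $ j = m j X)" for i
    by (intro choice allI) (use borel_version_real[OF \<omega>(1) meas(3)] in blast)
  then have "\<forall>i. \<exists>m. \<forall>j. m j \<in> borel_measurable borel \<and> (AE X in lebesgue. X \<in> \<omega> \<longrightarrow> A22 X $ i $ j = m j X)"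
    by blast
  from choice[OF this] obtain M' where
    "\<forall>i j. M' i j \<in> borel_measurable borel \<and> (AE X in lebesgue. X \<in> \<omega> \<longrightarrow> A22 X $ i $ j = M' i j X)" ..
  then have M': "\<And>i j. M' i j \<in> borel_measurable borel" "\<And>i j. AE X in lebesgue. X \<in> \<omega> \<longrightarrow> A22 X $ i $ j = M' i j X"
    by blast+
  have e1: "AE X in lebesgue. \<forall>i\<in>UNIV. X \<in> \<omega> \<longrightarrow> A12 X $ i = b' i X" by (rule AE_finite_allI[OF finite b'(2)])
  have e2: "AE X in lebesgue. \<forall>i\<in>UNIV. \<forall>j\<in>UNIV. X \<in> \<omega> \<longrightarrow> A22 X $ i $ j = M' i j X"
    by (rule AE_finite_allI[OF finite], rule AE_finite_allI[OF finite M'(2)])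
  have e3: "AE X in lebesgue. X \<in> \<omega> \<longrightarrow> onorm (block_op (a11 X) (A12 X) (A22 X)) \<le> C_A"
    and e4: "AE X in lebesgue. X \<in> \<omega> \<longrightarrow> (\<forall>\<xi>. block_op (a11 X) (A12 X) (A22 X) \<xi> \<bullet> \<xi> \<ge> lambda_A * (norm \<xi>)\<^sup>2)"
    using bnd ell \<omega>(1) by (simp_all add: AE_restrict_space_iff open_in_lebesgue)
  \<comment> \<open>All exceptional sets are merged into one predicate, so that a single Borel null
    set \<open>Z\<close> contains them and the modification stays Borel.\<close>
  define P where "P X \<longleftrightarrow> (X \<in> \<omega> \<longrightarrow> a11 X = a' X \<and> A12 X = (\<chi> i. b' i X) \<and> A22 X = (\<chi> i j. M' i j X) \<and>
      onorm (block_op (a11 X) (A12 X) (A22 X)) \<le> C_A \<and> (\<forall>\<xi>. block_op (a11 X) (A12 X) (A22 X) \<xi> \<bullet> \<xi> \<ge> lambda_A * (norm \<xi>)\<^sup>2))" for X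
  have "AE X in lebesgue. P X" using a'(2) e1 e2 e3 e4
    by eventually_elim (simp add: P_def vec_eq_iff)
  then have "AE X in lborel. P X" by (simp add: AE_completion_iff)
  then obtain Z where Z: "{X \<in> space lborel. \<not> P X} \<subseteq> Z" "Z \<in> null_sets lborel" by (auto simp: eventually_ae_filter)
  define S where "S = \<omega> - Z"
  have S: "S \<in> sets borel" using \<omega>(1) Z(2) by (auto simp: S_def null_sets_def)
  have SP: "X \<in> \<omega> \<and> P X" if "X \<in> S" for X using that Z(1) by (auto simp: S_def)
  \<comment> \<open>Off \<open>S\<close> the matrix is \<open>lambda_A\<close> times the identity:
    symmetric, elliptic with the same constant and of norm \<open>lambda_A\<close>, which is why the
    uniform bound is \<open>max C_A lambda_A\<close>.\<close>
  define a where "a X = (if X \<in> S then a' X else lambda_A)" for X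
  define b where "b X = (if X \<in> S then (\<chi> i. b' i X) else 0)" for X
  define M where "M X = (if X \<in> S then (\<chi> i j. M' i j X) else lambda_A *\<^sub>R mat 1)" for X
  have eq: "a11 X = a X \<and> A12 X = b X \<and> A22 X = M X" if "X \<in> S" for X
    using SP[OF that] that by (simp add: P_def a_def b_def M_def)
  have off: "block_op (a X) (b X) (M X) \<xi> = lambda_A *\<^sub>R \<xi>" if "X \<notin> S" for X \<xi>
    using that by (simp add: a_def b_def M_def block_op_def scaleR_prod_def scaleR_matrix_vector_assoc[symmetric])
  have lin: "bounded_linear (block_op x y N)" for x and y :: "real^'n" and N
    by (rule linear_linear[THEN iffD2]) (auto simp: linear_iff block_op_def inner_add_right algebra_simps matrix_vector_right_distrib matrix_vector_mult_scaleR)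
  have "cylinder \<omega> a b M (max C_A lambda_A) lambda_A"
  proof
    show "a \<in> borel_measurable borel" unfolding a_def[abs_def] using S a'(1) by (intro measurable_If_set) auto
    show "b \<in> borel_measurable borel" unfolding b_def[abs_def] using S
      by (intro measurable_If_set borel_measurable_vec_lambda b'(1)) auto
    show "M \<in> borel_measurable borel" unfolding M_def[abs_def] using S
      by (intro measurable_If_set borel_measurable_vec_lambda M'(1)) auto
    fix X
    show "transpose (M X) = M X"
    proof (cases "X \<in> S")
      case True
      then have "A22 X = M X" using eq by blast
      moreover have "X \<in> \<omega>" using SP[OF True] by blast
      ultimately show ?thesis using tr by metis
    next
      case False then show ?thesis by (simp add: M_def transpose_scalar)
    qed
    fix \<xi> :: "real \<times> (real^'n)"
    show "norm (block_op (a X) (b X) (M X) \<xi>) \<le> max C_A lambda_A * norm \<xi>"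
    proof (cases "X \<in> S")
      case True
      have "onorm (block_op (a11 X) (A12 X) (A22 X)) \<le> C_A" using SP[OF True] unfolding P_def by blast
      then have "onorm (block_op (a X) (b X) (M X)) \<le> C_A" using eq[OF True] by simp
      then have "onorm (block_op (a X) (b X) (M X)) * norm \<xi> \<le> max C_A lambda_A * norm \<xi>" by (intro mult_right_mono) auto
      then show ?thesis using onorm[OF lin, of "a X" "b X" "M X" \<xi>] by linarith
    next
      case False then show ?thesis using pos by (simp add: off mult_right_mono)
    qed
    show "lambda_A * (norm \<xi>)\<^sup>2 \<le> block_op (a X) (b X) (M X) \<xi> \<bullet> \<xi>"
    proof (cases "X \<in> S")
      case True
      have "lambda_A * (norm \<xi>)\<^sup>2 \<le> block_op (a11 X) (A12 X) (A22 X) \<xi> \<bullet> \<xi>" using SP[OF True] unfolding P_def by blast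
      then show ?thesis using eq[OF True] by simp
    next
      case False then show ?thesis by (simp add: off power2_norm_eq_inner)
    qed
  qed (use \<omega> pos in auto)
  then show ?thesis using Z(2) eq by (intro exI conjI) (auto simp: S_def)
qed

text \<open>A null set of the cross-section times the line is a null set of the product, so changing
  the coefficients there is invisible on the cylinder.\<close>

lemma AE_cylinder:
  fixes I :: "real set" and \<omega> Z :: "'b::euclidean_space set"
  assumes "open I" "open \<omega>" "Z \<in> null_sets lborel"
  shows "AE x in lebesgue_on (I \<times> \<omega>). snd x \<in> \<omega> - Z"
proof -
  have "UNIV \<times> Z \<in> null_sets (lborel \<Otimes>\<^sub>M lborel :: (real \<times> 'b) measure)"
    by (rule lborel.times_in_null_sets2) (use assms(3) in auto)
  then have "AE x in (lborel :: (real \<times> 'b) measure). x \<notin> UNIV \<times> Z" by (intro AE_not_in) (simp add: lborel_prod)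
  from AE_completion[OF this] have "AE x in lebesgue. x \<in> I \<times> \<omega> \<longrightarrow> snd x \<in> \<omega> - Z"
    by eventually_elim (auto simp: mem_Times_iff)
  moreover have "(I \<times> \<omega>) \<inter> space lebesgue \<in> sets lebesgue" using open_in_lebesgue[OF open_Times[OF assms(1,2)]] by simp
  ultimately show ?thesis using AE_restrict_space_iff by blast
qed

lemma AE_base:
  assumes "open \<omega>" "Z \<in> null_sets (lborel :: 'a::euclidean_space measure)"
  shows "AE x in lebesgue_on \<omega>. x \<in> \<omega> - Z"
proof -
  have "AE x in lborel. x \<notin> Z" by (rule AE_not_in[OF assms(2)])
  from AE_completion[OF this] have "AE x in lebesgue. x \<in> \<omega> \<longrightarrow> x \<in> \<omega> - Z" by eventually_elim auto
  then show ?thesis using assms(1) by (simp add: AE_restrict_space_iff open_in_lebesgue)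
qed

section \<open>Almost everywhere approximation of the eigenfunction and conclusion\<close>

lemma L2conv_AE_subseq:
  fixes F :: "nat \<Rightarrow> 'a \<Rightarrow> 'b::euclidean_space"
  assumes "L2conv M F f"
  shows "\<exists>r. strict_mono r \<and> (AE x in M. (\<lambda>k. F (r k) x) \<longlonglongrightarrow> f x)"
proof -
  have sq: "sqint M (\<lambda>x. F k x - f x)" for k by (rule sqint_diff) (use assms in \<open>auto simp: L2conv_def\<close>)
  have "\<exists>r::nat\<Rightarrow>nat. strict_mono r \<and> (AE x in M. (\<lambda>n. (norm (F (r n) x - f x))\<^sup>2) \<longlonglongrightarrow> 0)"
    by (rule tendsto_L1_AE_subseq) (use sq assms in \<open>auto simp: sqint_def L2conv_def\<close>)
  then obtain r :: "nat \<Rightarrow> nat" where r: "strict_mono r" "AE x in M. (\<lambda>n. (norm (F (r n) x - f x))\<^sup>2) \<longlonglongrightarrow> 0" by blast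
  have "AE x in M. (\<lambda>k. F (r k) x) \<longlonglongrightarrow> f x"
    using r(2)
  proof eventually_elim
    case (elim x)
    from tendsto_real_sqrt[OF this] have "(\<lambda>n. norm (F (r n) x - f x)) \<longlonglongrightarrow> 0" by simp
    then have "(\<lambda>n. F (r n) x - f x) \<longlonglongrightarrow> 0" by (rule tendsto_norm_zero_cancel)
    then show ?case by (rule LIM_zero_cancel)
  qed
  then show ?thesis using r(1) by blast
qed

lemma L2conv_subseq: "L2conv M F f \<Longrightarrow> strict_mono r \<Longrightarrow> L2conv M (\<lambda>k. F (r k)) f"
  using LIMSEQ_subseq_LIMSEQ[of "\<lambda>k. LINT x|M. (norm (F k x - f x))\<^sup>2" 0 r] by (simp add: L2conv_def o_def)

text \<open>One subsequence provides both the L2 convergences required by \<open>eigen\<close> and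
  the almost everywhere convergence required by \<open>positive_eigen\<close>.\<close>

lemma (in cylinder) first_eigenfunction_approx:
  assumes W: "first_eigenfunction \<omega> M W"
  shows "\<exists>p. eigen \<omega> a b M C lam W p (weak_gradient \<omega> W) \<and> (AE X in lebesgue_on \<omega>. (\<lambda>k. p k X) \<longlonglongrightarrow> W X)"
proof -
  have S: "test_functions \<omega> \<subseteq> test_functions UNIV" using test_mono by blast
  have "W \<in> H1_closure \<omega> (test_functions \<omega>)" using W by (simp add: first_eigenfunction_def H10_def)
  from H1_closure_approx[OF open_\<omega> S this] obtain q where q: "\<forall>k. q k \<in> test_functions \<omega>" "L2conv L\<omega> q W"
    "L2conv L\<omega> (\<lambda>k. grad (q k)) (weak_gradient \<omega> W)" by blast
  obtain r where r: "strict_mono r" "AE X in L\<omega>. (\<lambda>k. q (r k) X) \<longlonglongrightarrow> W X"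
    using L2conv_AE_subseq[OF q(2)] by blast
  have e: "fm (weak_gradient \<omega> W) (weak_gradient \<omega> W) = mu1 \<omega> M * f0 W W"
    using W by (simp add: first_eigenfunction_def fm_def f0_def energy_def power2_eq_square)
  have "eigen \<omega> a b M C lam W (\<lambda>k. q (r k)) (weak_gradient \<omega> W)"
    by (intro eigen.intro cylinder_axioms eigen_axioms.intro)
      (use q(1) L2conv_subseq[OF q(2) r(1)] L2conv_subseq[OF q(3) r(1)] e in auto)
  then show ?thesis using r(2) by (intro exI conjI)
qed

theorem mainTheorem1:
  fixes \<omega> :: "(real^'n) set"
    and a11 :: "real^'n \<Rightarrow> real"
    and A12 :: "real^'n \<Rightarrow> real^'n"
    and A22 :: "real^'n \<Rightarrow> real^'n^'n"
    and C_A lambda_A :: real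
  assumes "open \<omega>" "connected \<omega>" "\<omega> \<noteq> {}" "bounded \<omega>"
    and "a11 \<in> borel_measurable (lebesgue_on \<omega>)"
    and "\<And>i. (\<lambda>X. A12 X $ i) \<in> borel_measurable (lebesgue_on \<omega>)"
    and "\<And>i j. (\<lambda>X. A22 X $ i $ j) \<in> borel_measurable (lebesgue_on \<omega>)"
    and "\<And>X. X \<in> \<omega> \<Longrightarrow> transpose (A22 X) = A22 X"
    and "C_A > 0" "lambda_A > 0"
    and "AE X in lebesgue_on \<omega>. onorm (block_op (a11 X) (A12 X) (A22 X)) \<le> C_A"
    and "AE X in lebesgue_on \<omega>. \<forall>\<xi>. block_op (a11 X) (A12 X) (A22 X) \<xi> \<bullet> \<xi> \<ge> lambda_A * (norm \<xi>)\<^sup>2"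
  shows "((\<lambda>l. lambda1 \<omega> a11 A12 A22 l) \<longlongrightarrow>
            min (nu_plus \<omega> a11 A12 A22) (nu_minus \<omega> a11 A12 A22)) at_top \<and>
         (\<forall>W\<^sub>1. first_eigenfunction \<omega> A22 W\<^sub>1 \<longrightarrow>
            (\<not> (AE X in lebesgue_on \<omega>. A12 X \<bullet> weak_gradient \<omega> W\<^sub>1 X = 0) \<longrightarrow>
               Lim at_top (\<lambda>l. lambda1 \<omega> a11 A12 A22 l) < mu1 \<omega> A22) \<and>
            ((AE X in lebesgue_on \<omega>. A12 X \<bullet> weak_gradient \<omega> W\<^sub>1 X = 0) \<longrightarrow>
               (\<forall>l>0. lambda1 \<omega> a11 A12 A22 l = mu1 \<omega> A22)))"
proof -
  obtain a b M Z where cyl: "cylinder \<omega> a b M (max C_A lambda_A) lambda_A" and Z: "Z \<in> null_sets lborel"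
    and eq: "\<forall>X\<in>\<omega> - Z. a11 X = a X \<and> A12 X = b X \<and> A22 X = M X"
    using borel_coefficients[OF assms(1,3-12)] by blast
  interpret cylinder \<omega> a b M "max C_A lambda_A" lambda_A by (rule cyl)
  have energy_cyl: "energy (I \<times> \<omega>) (coeff_op a11 A12 A22) u = energy (I \<times> \<omega>) (coeff_op a b M) u"
    if "open I" "u \<in> V I \<omega>" for I u
  proof (rule energy_cong_AE[OF open_cyl[OF that(1)] bounded_op_cyl])
    show "AE x in lebesgue_on (I \<times> \<omega>). coeff_op a11 A12 A22 x = coeff_op a b M x"
      using AE_cylinder[OF that(1) open_\<omega> Z] by eventually_elim (use eq in \<open>simp add: coeff_op_def\<close>)
    show "u \<in> H1 (I \<times> \<omega>)" using that(2) by (simp add: V_def H1_closure_def)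
  qed
  have energy_base: "energy \<omega> (\<lambda>X. (*v) (A22 X)) u = energy \<omega> (\<lambda>X. (*v) (M X)) u" if "u \<in> H10 \<omega>" for u
  proof (rule energy_cong_AE[OF open_\<omega> bounded_op_base])
    show "AE X in lebesgue_on \<omega>. (*v) (A22 X) = (*v) (M X)"
      using AE_base[OF open_\<omega> Z] by eventually_elim (use eq in simp)
    show "u \<in> H1 \<omega>" using that by (simp add: H10_def H1_closure_def)
  qed
  \<comment> \<open>The admissible functions and the normalisations do not involve the coefficients,
    so equality of the energies on them is enough for equality of the infima.\<close>
  have lam: "lambda1 \<omega> a11 A12 A22 l = lambda1 \<omega> a b M l" for l
    unfolding lambda1_def by (rule Inf_image_cong) (simp add: energy_cyl)
  have nu: "nu J \<omega> a11 A12 A22 = nu J \<omega> a b M" if "open J" for J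
    unfolding nu_def by (rule Inf_image_cong) (simp add: energy_cyl that)
  have mu: "mu1 \<omega> A22 = mu1 \<omega> M"
    unfolding mu1_def by (rule Inf_image_cong) (simp add: energy_base)
  have lim: "((\<lambda>l. lambda1 \<omega> a11 A12 A22 l) \<longlongrightarrow> min (nu_plus \<omega> a11 A12 A22) (nu_minus \<omega> a11 A12 A22)) at_top"
    unfolding lam nu[OF open_greaterThan] nu[OF open_lessThan] by (rule lambda1_tendsto)
  have "(\<not> (AE X in lebesgue_on \<omega>. A12 X \<bullet> weak_gradient \<omega> W X = 0) \<longrightarrow>
               Lim at_top (\<lambda>l. lambda1 \<omega> a11 A12 A22 l) < mu1 \<omega> A22) \<and>
            ((AE X in lebesgue_on \<omega>. A12 X \<bullet> weak_gradient \<omega> W X = 0) \<longrightarrow>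
               (\<forall>l>0. lambda1 \<omega> a11 A12 A22 l = mu1 \<omega> A22))"
    if W: "first_eigenfunction \<omega> A22 W" for W
  proof -
    have W': "first_eigenfunction \<omega> M W" using W energy_base[of W] mu by (simp add: first_eigenfunction_def)
    obtain p where p: "eigen \<omega> a b M (max C_A lambda_A) lambda_A W p (weak_gradient \<omega> W)"
      "AE X in lebesgue_on \<omega>. (\<lambda>k. p k X) \<longlonglongrightarrow> W X"
      using first_eigenfunction_approx[OF W'] by blast
    interpret E: eigen \<omega> a b M "max C_A lambda_A" lambda_A W p "weak_gradient \<omega> W" by (rule p(1))
    have orth: "(AE X in lebesgue_on \<omega>. A12 X \<bullet> weak_gradient \<omega> W X = 0) \<longleftrightarrow> (AE X in lebesgue_on \<omega>. b X \<bullet> weak_gradient \<omega> W X = 0)"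
    proof -
      have "AE X in lebesgue_on \<omega>. A12 X \<bullet> weak_gradient \<omega> W X = 0 \<longleftrightarrow> b X \<bullet> weak_gradient \<omega> W X = 0"
        using AE_base[OF open_\<omega> Z] by eventually_elim (use eq in simp)
      then show ?thesis by (auto elim: eventually_elim2)
    qed
    show ?thesis
    proof (intro conjI impI allI)
      assume n: "\<not> (AE X in lebesgue_on \<omega>. A12 X \<bullet> weak_gradient \<omega> W X = 0)"
      \<comment> \<open>The contradiction needs both half-cylinders at once, so it shows that one of
        the two values lies below \<mu> without telling which.\<close>
      have "\<not> (mu1 \<omega> M \<le> nu_plus \<omega> a b M \<and> mu1 \<omega> M \<le> nu_minus \<omega> a b M)"
      proof
        assume "mu1 \<omega> M \<le> nu_plus \<omega> a b M \<and> mu1 \<omega> M \<le> nu_minus \<omega> a b M"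
        then have "AE X in lebesgue_on \<omega>. b X \<bullet> weak_gradient \<omega> W X = 0"
          by (intro E.orthogonal_imp_AE_zero E.no_gap_imp_orthogonal) auto
        then show False using n orth by blast
      qed
      then have "min (nu_plus \<omega> a b M) (nu_minus \<omega> a b M) < mu1 \<omega> M" by (auto simp: min_less_iff_disj not_le)
      then show "Lim at_top (\<lambda>l. lambda1 \<omega> a11 A12 A22 l) < mu1 \<omega> A22"
        unfolding tendsto_Lim[OF trivial_limit_at_top_linorder lim] nu[OF open_greaterThan] nu[OF open_lessThan] mu .
    next
      fix l :: real assume o: "AE X in lebesgue_on \<omega>. A12 X \<bullet> weak_gradient \<omega> W X = 0" and l: "0 < l"
      interpret P: positive_eigen \<omega> a b M "max C_A lambda_A" lambda_A W p "weak_gradient \<omega> W"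
        by (intro positive_eigen.intro p(1) positive_eigen_axioms.intro)
          (use p(2) W o orth in \<open>auto simp: first_eigenfunction_def\<close>)
      show "lambda1 \<omega> a11 A12 A22 l = mu1 \<omega> A22" unfolding lam mu by (rule P.lambda1_eq_mu1[OF l])
    qed
  qed
  then show ?thesis using lim by blast
qed

end
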